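(* Let $G=(V,E,w)$ be a connected weighted hypergraph with $V=\{1,\dots,N\}$, let $p\in[1,\infty)$, $a>0$, $q>2$, $T>0$, and let $\pi:\mathbb{R}^N\to\mathbb{R}^N$ be Lipschitz continuous with a primitive $k:\mathbb{R}^N\to\mathbb{R}$ (i.e. $\nabla k=\pi$). For any $\tau>0$, $u_0\in\mathbb{R}^N$ and $f\in L^2(0,T;\mathbb{R}^N)$, the system $$\begin{cases} u'(t)+\mathcal{L}_{G,p}(\mu(t))\ni 0, & t\in(0,T),\\ \mu(t)\in \tau u'(t)+\mathcal{L}_{G,p}(u(t))+a\|u(t)\|^{q-2}u(t)+\pi(u(t))-f(t), & t\in(0,T),\\ u(0)=u_0,\end{cases}$$ possesses at least one solution $(u,\mu)$ satisfying $u\in W^{1,2}(0,T;\mathbb{R}^N)$ and $\mu\in L^2(0,T;\mathbb{R}^N)$.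
   Context: A weighted hypergraph $G=(V,E,w)$ consists of a finite vertex set $V=\{1,\dots,N\}$, a family $E$ of subsets $e\subset V$ with $\#e\ge 2$ (hyperedges), and a weight $w:E\to(0,\infty)$. $G$ is connected if for all $i,j\in V$ there exist $i_1,\dots,i_{n-1}\in V$ and $e_1,\dots,e_n\in E$ such that, with $i_0=i$ and $i_n=j$, one has $i_{l-1},i_l\in e_l$ for every $l=1,\dots,n$. For $e\in E$ and $x\in\mathbb{R}^N$ put $f_e(x):=\max_{i,j\in e}|x_i-x_j|$, and for $p\in[1,\infty)$ put $\varphi_{G,p}(x):=\frac1p\sum_{e\in E}w(e)(f_e(x))^p$, a continuous convex function on $\mathbb{R}^N$. The hypergraph Laplacian is the set-valued operator $\mathcal{L}_{G,p}:=\partial\varphi_{G,p}:\mathbb{R}^N\to 2^{\mathbb{R}^N}$, where $\partial\varphi_{G,p}(x)=\{\eta\in\mathbb{R}^N:\ \eta\cdot(z-x)\le\varphi_{G,p}(z)-\varphi_{G,p}(x)\ \ \forall z\in\mathbb{R}^N\}$. $\|\cdot\|$ and $\cdot$ denote the Euclidean norm and inner product on $\mathbb{R}^N$; $\|x\|^{q-2}x$ is $0$ at $x=0$. A solution on $[0,T]$ is a pair $u,\mu:[0,T]\to\mathbb{R}^N$ with $u\in W^{1,1}(0,T;\mathbb{R}^N)$ (identified with its absolutely continuous representative) and $\mu\in L^1(0,T;\mathbb{R}^N)$ such that the two inclusions hold for a.e. $t\in(0,T)$ and $u(0)=u_0$. *)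

theory Defs
  imports "HOL-Analysis.Analysis"
begin

text \<open>The vertex set is the finite type \<open>'n\<close>, so that \<open>real ^ 'n\<close> is the space of real-valued
  functions on the vertices and every set of hyperedges is automatically finite.  Only the values
  of the weight on hyperedges matter.\<close>

definition weighted_hypergraph :: "'n::finite set set \<Rightarrow> ('n set \<Rightarrow> real) \<Rightarrow> bool" where
  "weighted_hypergraph E w \<longleftrightarrow> (\<forall>e\<in>E. card e \<ge> 2 \<and> w e > 0)"

definition hypergraph_connected :: "'n::finite set set \<Rightarrow> bool" where
  "hypergraph_connected E \<longleftrightarrow>
     (\<forall>i j. \<exists>n\<ge>1. \<exists>(v :: nat \<Rightarrow> 'n) (d :: nat \<Rightarrow> 'n set).
        v 0 = i \<and> v n = j \<and>
        (\<forall>l\<in>{1..n}. d l \<in> E \<and> v (l - 1) \<in> d l \<and> v l \<in> d l))"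

definition edge_spread :: "'n::finite set \<Rightarrow> real ^ 'n \<Rightarrow> real" where
  "edge_spread e x = Max ((\<lambda>(i, j). \<bar>x $ i - x $ j\<bar>) ` (e \<times> e))"

definition hypergraph_energy ::
  "'n::finite set set \<Rightarrow> ('n set \<Rightarrow> real) \<Rightarrow> real \<Rightarrow> real ^ 'n \<Rightarrow> real" where
  "hypergraph_energy E w p x = (1 / p) * (\<Sum>e\<in>E. w e * edge_spread e x powr p)"

definition subdifferential :: "('a::real_inner \<Rightarrow> real) \<Rightarrow> 'a \<Rightarrow> 'a set" where
  "subdifferential \<phi> x = {\<eta>. \<forall>z. \<eta> \<bullet> (z - x) \<le> \<phi> z - \<phi> x}"

definition hypergraph_Laplacian ::
  "'n::finite set set \<Rightarrow> ('n set \<Rightarrow> real) \<Rightarrow> real \<Rightarrow> real ^ 'n \<Rightarrow> (real ^ 'n) set" where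
  "hypergraph_Laplacian E w p = subdifferential (hypergraph_energy E w p)"

text \<open>Elements of \<open>L\<^sup>r(S)\<close> are represented by functions on the whole real line; their values outside
  \<open>S\<close> are irrelevant.\<close>

definition in_L :: "real \<Rightarrow> real set \<Rightarrow> (real \<Rightarrow> 'a::euclidean_space) \<Rightarrow> bool" where
  "in_L r S g \<longleftrightarrow> g \<in> borel_measurable (lebesgue_on S) \<and>
     integrable (lebesgue_on S) (\<lambda>t. norm (g t) powr r)"

definition test_function :: "real set \<Rightarrow> (real \<Rightarrow> real) \<Rightarrow> bool" where
  "test_function S \<theta> \<longleftrightarrow>
     (\<forall>n. (deriv ^^ n) \<theta> differentiable_on UNIV) \<and>
     (\<exists>K. compact K \<and> K \<subseteq> S \<and> (\<forall>t. t \<notin> K \<longrightarrow> \<theta> t = 0))"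

text \<open>The Bochner integral of a non-integrable function is \<open>0\<close> by convention, so the following is
  meaningful only for locally integrable \<open>g\<close> and \<open>g'\<close>; it is used only together with \<open>in_L\<close>.\<close>

definition has_weak_deriv ::
  "(real \<Rightarrow> 'a::euclidean_space) \<Rightarrow> (real \<Rightarrow> 'a) \<Rightarrow> real set \<Rightarrow> bool" where
  "has_weak_deriv g g' S \<longleftrightarrow>
     (\<forall>\<theta>. test_function S \<theta> \<longrightarrow>
        (LINT t|lebesgue_on S. deriv \<theta> t *\<^sub>R g t) = - (LINT t|lebesgue_on S. \<theta> t *\<^sub>R g' t))"

definition in_W1 :: "real \<Rightarrow> real set \<Rightarrow> (real \<Rightarrow> 'a::euclidean_space) \<Rightarrow> bool" where
  "in_W1 r S g \<longleftrightarrow> in_L r S g \<and> (\<exists>g'. in_L r S g' \<and> has_weak_deriv g g' S)"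

definition abs_continuous_on :: "real set \<Rightarrow> (real \<Rightarrow> 'a::real_normed_vector) \<Rightarrow> bool" where
  "abs_continuous_on I g \<longleftrightarrow>
     (\<forall>\<epsilon>>0. \<exists>\<delta>>0. \<forall>(n::nat) s t.
        (\<forall>i<n. s i \<in> I \<and> t i \<in> I \<and> s i \<le> t i) \<and>
        disjoint_family_on (\<lambda>i. {s i<..<t i}) {..<n} \<and>
        (\<Sum>i<n. t i - s i) < \<delta> \<longrightarrow>
        (\<Sum>i<n. norm (g (t i) - g (s i))) < \<epsilon>)"

text \<open>Here \<open>u'\<close> is the weak derivative of \<open>u\<close>, which is determined almost everywhere, so the choice
  of its representative is immaterial; absolute continuity selects the representative of \<open>u\<close> on the
  closed interval for which the initial condition makes sense.\<close>

definition hypergraph_system_solution ::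
  "'n::finite set set \<Rightarrow> ('n set \<Rightarrow> real) \<Rightarrow> real \<Rightarrow> real \<Rightarrow> real \<Rightarrow> (real ^ 'n \<Rightarrow> real ^ 'n) \<Rightarrow> real \<Rightarrow>
     real \<Rightarrow> real ^ 'n \<Rightarrow> (real \<Rightarrow> real ^ 'n) \<Rightarrow> (real \<Rightarrow> real ^ 'n) \<Rightarrow> (real \<Rightarrow> real ^ 'n) \<Rightarrow> bool" where
  "hypergraph_system_solution E w p a q \<pi> \<tau> T u\<^sub>0 f u \<mu> \<longleftrightarrow>
     abs_continuous_on {0..T} u \<and> in_L 1 {0<..<T} u \<and> in_L 1 {0<..<T} \<mu> \<and> u 0 = u\<^sub>0 \<and>
     (\<exists>u'. in_L 1 {0<..<T} u' \<and> has_weak_deriv u u' {0<..<T} \<and>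
        (AE t in lebesgue_on {0<..<T}.
           0 \<in> (\<lambda>\<xi>. u' t + \<xi>) ` hypergraph_Laplacian E w p (\<mu> t)) \<and>
        (AE t in lebesgue_on {0<..<T}.
           \<mu> t \<in> (\<lambda>\<xi>. \<tau> *\<^sub>R u' t + \<xi> + (a * norm (u t) powr (q - 2)) *\<^sub>R u t + \<pi> (u t) - f t)
                   ` hypergraph_Laplacian E w p (u t)))"

end

theory Submission
  imports Defs "HOL-Complex_Analysis.Great_Picard"
begin

text \<open>
  Write \<open>\<phi>\<close> for the hypergraph energy, a finite convex function with minimum \<open>\<phi> 0 = 0\<close>, and collect all
  terms that act on \<open>u\<close> in the energy \<open>F x = \<phi> x + (a / q) * norm x powr q + k x\<close>.  The system then
  reads \<open>- u' \<in> \<partial>\<phi>(\<mu>)\<close> and \<open>\<mu> = \<tau> u' + \<eta> - f\<close> with \<open>\<eta> \<in> \<partial>F(u)\<close>.  Because \<open>\<tau> > 0\<close>, the first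
  inclusion can be solved for \<open>u'\<close>: it says that \<open>\<mu>\<close> is the proximal point of \<open>\<eta> - f\<close>, and hence
  that \<open>u' = - A (\<eta> - f)\<close>, where \<open>A\<close> is the Yosida approximation of \<open>\<partial>\<phi>\<close> with parameter \<open>\<tau>\<close>.  This
  map is single-valued and cocoercive with constant \<open>\<tau>\<close> (\<open>moreau_grad_cocoercive\<close>).  Since \<open>\<pi>\<close> is
  Lipschitz continuous, \<open>F\<close> is semiconvex, and since \<open>q > 2\<close> it is coercive.  It remains to solve
  \<open>u' \<in> - A (\<partial>F(u) - f)\<close>; this is \<open>doubly_nonlinear_existence\<close>.

  Approximate solutions come from an explicit Euler scheme in which \<open>F\<close> is replaced by its Moreau
  envelope (\<open>explicit_scheme\<close>).  The envelope satisfies a one-sided quadratic descent inequality, so for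
  small steps the scheme dissipates energy.  This bounds the velocities in \<open>L\<^sup>2\<close> and keeps the
  trajectories, and therefore the subgradients, bounded.  The trajectories converge uniformly along a
  subsequence by the Arzela-Ascoli theorem.  For the velocities and subgradients, weak convergence is
  replaced by strong convergence of averages of the tails (\<open>weak_limit_exists\<close>), and the
  limit of the subgradients lies in \<open>\<partial>F(u)\<close>.

  The limit equation is identified by energy.  Cocoercivity bounds the distance between the
  approximate velocities and \<open>- A (\<eta> - f)\<close>, with \<open>\<eta>\<close> the limit of the subgradients, by an expression
  that is linear apart from the integral of velocity times subgradient.  Along the scheme that integral
  is at least the increment of the energy, up to a vanishing error, while in the limit it is at most
  that increment by the chain rule for semiconvex functions along absolutely continuous curves
  (\<open>chain_inequality\<close>).  Hence the distance vanishes.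
\<close>

section \<open>Square-integrable functions and their primitives\<close>

text \<open>Fatou's lemma for real-valued functions, with an upper bound that may vary along the sequence.\<close>

lemma fatou_real:
  fixes g :: "nat \<Rightarrow> 'a \<Rightarrow> real"
  assumes g: "\<And>n. integrable M (g n)" and nonneg: "\<And>n x. 0 \<le> g n x"
    and lim: "AE x in M. (\<lambda>n. g n x) \<longlonglongrightarrow> G x" and G: "G \<in> borel_measurable M"
    and le: "\<And>n. (LINT x|M. g n x) \<le> c n" and c: "c \<longlonglongrightarrow> C"
  shows "integrable M G" "(LINT x|M. G x) \<le> C"
proof -
  have [measurable]: "\<And>n. g n \<in> borel_measurable M" "G \<in> borel_measurable M" using g G by auto
  have G0: "AE x in M. 0 \<le> G x"
    using lim by eventually_elim (rule LIMSEQ_le_const, auto simp: nonneg)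
  have "(\<integral>\<^sup>+x. G x \<partial>M) = (\<integral>\<^sup>+x. liminf (\<lambda>n. ennreal (g n x)) \<partial>M)"
  proof (rule nn_integral_cong_AE)
    show "AE x in M. ennreal (G x) = liminf (\<lambda>n. ennreal (g n x))"
      using lim
    proof eventually_elim
      case (elim x)
      then have "(\<lambda>n. ennreal (g n x)) \<longlonglongrightarrow> ennreal (G x)" by (intro tendsto_ennrealI)
      from lim_imp_Liminf[OF _ this] show ?case by simp
    qed
  qed
  also have "\<dots> \<le> liminf (\<lambda>n. \<integral>\<^sup>+x. ennreal (g n x) \<partial>M)" by (rule nn_integral_liminf) simp
  also have "\<dots> = liminf (\<lambda>n. ennreal (LINT x|M. g n x))"
    by (simp add: nn_integral_eq_integral[OF g] nonneg)
  also have "\<dots> \<le> liminf (\<lambda>n. ennreal (c n))"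
    by (intro Liminf_mono always_eventually allI ennreal_leI le)
  also have "\<dots> = ennreal C" using lim_imp_Liminf[OF _ tendsto_ennrealI[OF c]] by simp
  finally have *: "(\<integral>\<^sup>+x. G x \<partial>M) \<le> ennreal C" .
  then have "(\<integral>\<^sup>+x. G x \<partial>M) < \<infinity>" by (metis ennreal_less_top infinity_ennreal_def order_le_less_trans)
  then show i: "integrable M G" by (intro integrableI_nonneg G0) auto
  have "0 \<le> c n" for n
    by (rule order_trans[OF integral_nonneg_AE le]) (simp add: nonneg)
  then have "0 \<le> C" by (intro LIMSEQ_le_const[OF c]) auto
  with * show "(LINT x|M. G x) \<le> C"
    by (simp add: nn_integral_eq_integral[OF i G0])
qed

text \<open>Square integrability on the whole line.  Functions on a bounded interval are extended by zero,
  and Borel (not just Lebesgue) measurability is required, so that all integrals can be taken with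
  respect to \<open>lborel\<close>.\<close>

definition sq_integrable :: "(real \<Rightarrow> 'a::euclidean_space) \<Rightarrow> bool" where
  "sq_integrable v \<longleftrightarrow> v \<in> borel_measurable lborel \<and> integrable lborel (\<lambda>t. (norm (v t))\<^sup>2)"

text \<open>The indefinite integral from \<open>-\<infinity>\<close>.  It is used for functions that vanish outside
  \<open>{0<..T}\<close>; then it is \<open>0\<close> at \<open>0\<close> and constant after \<open>T\<close>.\<close>

definition primitive :: "(real \<Rightarrow> 'a::euclidean_space) \<Rightarrow> real \<Rightarrow> 'a" where
  "primitive v t = (LINT s:{..t}|lborel. v s)"

lemma sq_integrable_measurable: "sq_integrable v \<Longrightarrow> v \<in> borel_measurable borel"
  by (auto simp: sq_integrable_def)

lemma inner_abs_le: "\<bar>(x::'a::real_inner) \<bullet> y\<bar> \<le> (norm x)\<^sup>2 + (norm y)\<^sup>2"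
proof -
  have "\<bar>x \<bullet> y\<bar> \<le> norm x * norm y" by (rule Cauchy_Schwarz_ineq2)
  also have "\<dots> \<le> (norm x)\<^sup>2 + (norm y)\<^sup>2"
    using sum_squares_bound[of "norm x" "norm y"]
        mult_nonneg_nonneg[OF norm_ge_zero[of x] norm_ge_zero[of y]]
    by linarith
  finally show ?thesis .
qed

lemma sq_integrable_inner:
  assumes "sq_integrable v" "sq_integrable w"
  shows "integrable lborel (\<lambda>t. v t \<bullet> w t)"
proof -
  have [measurable]: "v \<in> borel_measurable borel" "w \<in> borel_measurable borel"
    using assms by (auto simp: sq_integrable_def)
  show ?thesis
    by (rule Bochner_Integration.integrable_bound[of lborel "\<lambda>t. (norm (v t))\<^sup>2 + (norm (w t))\<^sup>2"])
      (use assms inner_abs_le in \<open>auto simp: sq_integrable_def\<close>)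
qed

lemma parallelogram: "(norm ((x::'a::real_inner) - y))\<^sup>2
    = 2 * (norm x)\<^sup>2 + 2 * (norm y)\<^sup>2 - (norm (x + y))\<^sup>2"
  by (simp add: power2_norm_eq_inner inner_add inner_diff inner_commute)

lemma norm_add_sq_le: "(norm ((x::'a::real_inner) + y))\<^sup>2 \<le> 2 * (norm x)\<^sup>2 + 2 * (norm y)\<^sup>2"
  using parallelogram[of x y] zero_le_power2[of "norm (x - y)"] by linarith

lemma sq_integrable_bound:
  assumes "v \<in> borel_measurable borel" "integrable lborel g" "\<And>t. (norm (v t))\<^sup>2 \<le> g t"
  shows "sq_integrable v"
  unfolding sq_integrable_def
proof (intro conjI)
  show "v \<in> borel_measurable lborel" using assms by simp
  show "integrable lborel (\<lambda>t. (norm (v t))\<^sup>2)"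
    by (rule Bochner_Integration.integrable_bound[OF assms(2)])
      (use assms in \<open>auto intro: order_trans[OF _ abs_ge_self]\<close>)
qed

lemma sq_integrable_scale: "sq_integrable v \<Longrightarrow> sq_integrable (\<lambda>t. c *\<^sub>R v t)"
  by (auto simp: sq_integrable_def power_mult_distrib)

lemma sq_integrable_add: "sq_integrable v \<Longrightarrow> sq_integrable w \<Longrightarrow> sq_integrable (\<lambda>t. v t + w t)"
  by (rule sq_integrable_bound[of _ "\<lambda>t. 2 * (norm (v t))\<^sup>2 + 2 * (norm (w t))\<^sup>2"])
    (auto simp: sq_integrable_def norm_add_sq_le)

lemma sq_integrable_minus: "sq_integrable v \<Longrightarrow> sq_integrable (\<lambda>t. - v t)"
  by (auto simp: sq_integrable_def)

lemma sq_integrable_diff: "sq_integrable v \<Longrightarrow> sq_integrable w \<Longrightarrow> sq_integrable (\<lambda>t. v t - w t)"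
  using sq_integrable_add[of v "\<lambda>t. - w t"] sq_integrable_minus[of w] by simp

lemma sq_integrable_imp_integrable:
  assumes "sq_integrable v" "\<And>t. t \<notin> {0<..T} \<Longrightarrow> v t = 0"
  shows "integrable lborel v"
proof (rule Bochner_Integration.integrable_bound[of lborel "\<lambda>t. indicator {0<..T} t + (norm (v t))\<^sup>2"])
  show "integrable lborel (\<lambda>t. indicator {0<..T} t + (norm (v t))\<^sup>2 :: real)"
    using assms(1) by (cases "0 \<le> T") (auto simp: sq_integrable_def)
  show "AE t in lborel. norm (v t) \<le> norm (indicator {0<..T} t + (norm (v t))\<^sup>2 :: real)"
  proof (intro AE_I2)
    fix t
    have "norm (v t) \<le> 1 + (norm (v t))\<^sup>2"
    proof -
      have "2 * norm (v t) \<le> 1 + (norm (v t))\<^sup>2"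
        using sum_squares_bound[of 1 "norm (v t)"] by simp
      moreover have "0 \<le> (norm (v t))\<^sup>2" by simp
      ultimately show ?thesis by linarith
    qed
    then show "norm (v t) \<le> norm (indicator {0<..T} t + (norm (v t))\<^sup>2 :: real)"
      using assms(2)[of t] by (cases "t \<in> {0<..T}") (auto simp: )
  qed
qed (use assms in \<open>auto simp: sq_integrable_def\<close>)

lemma set_integrable_of_integrable:
  fixes v :: "real \<Rightarrow> 'a::euclidean_space"
  assumes "integrable lborel v" "A \<in> sets borel"
  shows "set_integrable lborel A v"
  using assms integrable_mult_indicator[of A lborel v] by (simp add: set_integrable_def)

lemma primitive_diff:
  assumes "integrable lborel v" "s \<le> t"
  shows "primitive v t - primitive v s = (LINT r:{s<..t}|lborel. v r)"
proof -
  have "primitive v t = (LINT r:{..s} \<union> {s<..t}|lborel. v r)"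
    unfolding primitive_def using assms(2)
        by (intro arg_cong2[where f="\<lambda>A f. set_lebesgue_integral lborel A f"]) auto
  also have "\<dots> = primitive v s + (LINT r:{s<..t}|lborel. v r)"
    unfolding primitive_def by (rule set_integral_Un) (auto intro: set_integrable_of_integrable assms)
  finally show ?thesis by simp
qed

lemma primitive_outside:
  assumes "\<And>t. t \<notin> {0<..T} \<Longrightarrow> v t = 0"
  shows "t \<le> 0 \<Longrightarrow> primitive v t = 0" "t \<ge> T \<Longrightarrow> primitive v t = (LINT s|lborel. v s)"
proof -
  assume "t \<le> 0"
  then have "(\<lambda>s. indicator {..t} s *\<^sub>R v s) = (\<lambda>s. 0)"
    using assms by (auto simp: fun_eq_iff indicator_def)
  then show "primitive v t = 0" by (simp add: primitive_def set_lebesgue_integral_def)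
next
  assume "t \<ge> T"
  then have "(\<lambda>s. indicator {..t} s *\<^sub>R v s) = v"
    using assms by (fastforce simp: fun_eq_iff indicator_def)
  then show "primitive v t = (LINT s|lborel. v s)"
      by (simp add: primitive_def set_lebesgue_integral_def)
qed

lemma sq_integrable_Cauchy_Schwarz:
  assumes v: "sq_integrable v" and w: "sq_integrable w"
  shows "(LINT t|lborel. v t \<bullet> w t)\<^sup>2
      \<le> (LINT t|lborel. (norm (v t))\<^sup>2) * (LINT t|lborel. (norm (w t))\<^sup>2)"
proof -
  define a b c where "a = (LINT t|lborel. (norm (v t))\<^sup>2)" and "b = (LINT t|lborel. v t \<bullet> w t)"
    and "c = (LINT t|lborel. (norm (w t))\<^sup>2)"
  have i: "integrable lborel (\<lambda>t. (norm (v t))\<^sup>2)" "integrable lborel (\<lambda>t. (norm (w t))\<^sup>2)"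
    "integrable lborel (\<lambda>t. v t \<bullet> w t)"
    using v w sq_integrable_inner[OF v w] by (auto simp: sq_integrable_def)
  have key: "0 \<le> x\<^sup>2 * a - 2 * x * y * b + y\<^sup>2 * c" for x y
  proof -
    have "0 \<le> (LINT t|lborel. (norm (x *\<^sub>R v t - y *\<^sub>R w t))\<^sup>2)" by (intro integral_nonneg_AE) auto
    also have "\<dots> = (LINT t|lborel. x\<^sup>2 * (norm (v t))\<^sup>2 - 2 * x * y * (v t \<bullet> w t)
        + y\<^sup>2 * (norm (w t))\<^sup>2)"
      by (intro Bochner_Integration.integral_cong refl)
        (simp only: power2_norm_eq_inner, simp add: inner_diff inner_commute power2_eq_square
            algebra_simps)
    also have "\<dots> = x\<^sup>2 * a - 2 * x * y * b + y\<^sup>2 * c" using i by (simp add: a_def b_def c_def)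
    finally show ?thesis .
  qed
  have "0 \<le> a" "0 \<le> c" using key[of 1 0] key[of 0 1] by auto
  have "b\<^sup>2 \<le> a * c"
  proof (cases "c = 0")
    case True
    have "b = 0"
    proof (rule ccontr)
      assume "b \<noteq> 0"
      then show False using key[of 1 "(a + 1) / b"] True \<open>0 \<le> a\<close> by simp
    qed
    then show ?thesis using True by simp
  next
    case False
    then have "c > 0" using \<open>0 \<le> c\<close> by simp
    have "0 \<le> c\<^sup>2 * a - 2 * c * b * b + b\<^sup>2 * c" by (rule key)
    then have "0 \<le> c * (a * c - b\<^sup>2)" by (simp add: power2_eq_square algebra_simps)
    then show ?thesis using \<open>c > 0\<close> by (simp add: zero_le_mult_iff)
  qed
  then show ?thesis by (simp add: a_def b_def c_def)
qed

lemma set_integral_norm_sq_le: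
  fixes v :: "real \<Rightarrow> 'a::euclidean_space"
  assumes v: "sq_integrable v" and A: "A \<in> sets borel" "emeasure lborel A < \<infinity>"
  shows "(LINT r:A|lborel. norm (v r))\<^sup>2 \<le> measure lborel A * (LINT r:A|lborel. (norm (v r))\<^sup>2)"
proof -
  have [measurable]: "v \<in> borel_measurable borel" "A \<in> sets borel"
    using sq_integrable_measurable[OF v] A by auto
  have g2: "(norm (indicator A r *\<^sub>R norm (v r)))\<^sup>2 = indicator A r *\<^sub>R (norm (v r))\<^sup>2" for r
    by (simp add: indicator_def)
  have h2: "(norm (indicator A r :: real))\<^sup>2 = indicator A r" for r
    by (simp add: indicator_def)
  have "integrable lborel (\<lambda>r. indicator A r *\<^sub>R (norm (v r))\<^sup>2)"
    using set_integrable_of_integrable[of "\<lambda>r. (norm (v r))\<^sup>2" A] v A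
    by (simp add: set_integrable_def sq_integrable_def)
  then have g: "sq_integrable (\<lambda>r. indicator A r *\<^sub>R norm (v r))"
    unfolding sq_integrable_def g2 by simp
  have h: "sq_integrable (\<lambda>r. indicator A r :: real)"
    unfolding sq_integrable_def h2 using A by simp
  have "(\<lambda>r. (indicator A r *\<^sub>R norm (v r)) \<bullet> (indicator A r :: real))
      = (\<lambda>r. indicator A r *\<^sub>R norm (v r))"
    by (auto simp: fun_eq_iff indicator_def)
  with sq_integrable_Cauchy_Schwarz[OF g h] show ?thesis
    unfolding g2 h2 set_lebesgue_integral_def using A by (simp add: mult.commute)
qed

lemma norm_set_integral_le:
  fixes v :: "real \<Rightarrow> 'a::euclidean_space"
  assumes "integrable lborel v" "A \<in> sets borel"
  shows "norm (LINT r:A|lborel. v r) \<le> (LINT r:A|lborel. norm (v r))"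
  unfolding set_lebesgue_integral_def
  by (rule order_trans[OF integral_norm_bound])
      (auto intro!: Bochner_Integration.integral_mono simp: assms
      set_integrable_of_integrable[unfolded set_integrable_def, of "\<lambda>r. norm (v r)"] intro:
      set_integrable_of_integrable[unfolded set_integrable_def])

lemma primitive_increment_norm:
  assumes "integrable lborel v" "s \<le> t"
  shows "norm (primitive v t - primitive v s)
      \<le> primitive (\<lambda>r. norm (v r)) t - primitive (\<lambda>r. norm (v r)) s"
  using primitive_diff[of v s t] primitive_diff[of "\<lambda>r. norm (v r)" s t]
      norm_set_integral_le[of v "{s<..t}"] assms
  by auto

lemma primitive_increment_sq:
  assumes "sq_integrable v" "integrable lborel v" "s \<le> t"
  shows "(norm (primitive v t - primitive v s))\<^sup>2
    \<le> (t - s) * (primitive (\<lambda>r. (norm (v r))\<^sup>2) t - primitive (\<lambda>r. (norm (v r))\<^sup>2) s)"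
proof -
  have "(norm (primitive v t - primitive v s))\<^sup>2 \<le> (LINT r:{s<..t}|lborel. norm (v r))\<^sup>2"
    unfolding primitive_diff[OF assms(2,3)] by (intro power_mono norm_set_integral_le assms) auto
  also have "\<dots> \<le> measure lborel {s<..t} * (LINT r:{s<..t}|lborel. (norm (v r))\<^sup>2)"
    by (intro set_integral_norm_sq_le assms) (auto simp: assms)
  also have "\<dots> = (t - s) * (primitive (\<lambda>r. (norm (v r))\<^sup>2) t - primitive (\<lambda>r. (norm (v r))\<^sup>2) s)"
    using assms by (subst primitive_diff) (auto simp: sq_integrable_def)
  finally show ?thesis .
qed

lemma primitive_nonneg_mono:
  fixes g :: "real \<Rightarrow> real"
  assumes "integrable lborel g" "\<And>t. 0 \<le> g t" 
  shows "s \<le> t \<Longrightarrow> primitive g s \<le> primitive g t" "0 \<le> primitive g t" "primitive g t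
      \<le> (LINT r|lborel. g r)"
proof -
  show "s \<le> t \<Longrightarrow> primitive g s \<le> primitive g t"
    using primitive_increment_norm[OF assms(1), of s t] assms(2)
    by (smt (verit) norm_ge_zero primitive_def real_norm_def set_lebesgue_integral_def
        Bochner_Integration.integral_cong)
  show "0 \<le> primitive g t" unfolding primitive_def set_lebesgue_integral_def
    by (intro integral_nonneg_AE) (auto simp: assms)
  show "primitive g t \<le> (LINT r|lborel. g r)" unfolding primitive_def set_lebesgue_integral_def
    using assms set_integrable_of_integrable[OF assms(1), of "{..t}"]
    by (intro Bochner_Integration.integral_mono) (auto simp: set_integrable_def split: split_indicator)
qed

lemma sq_integrable_increment_sqrt:
  assumes "sq_integrable v" "integrable lborel v" "s \<le> t" "(LINT r|lborel. (norm (v r))\<^sup>2) \<le> C"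
  shows "norm (primitive v t - primitive v s) \<le> sqrt ((t - s) * C)"
proof -
  have i: "integrable lborel (\<lambda>r. (norm (v r))\<^sup>2)" using assms by (auto simp: sq_integrable_def)
  have "primitive (\<lambda>r. (norm (v r))\<^sup>2) t - primitive (\<lambda>r. (norm (v r))\<^sup>2) s \<le> C"
    using primitive_nonneg_mono(2,3)[OF i] assms(4) by (smt (verit) zero_le_power2)
  then have "(t - s) * (primitive (\<lambda>r. (norm (v r))\<^sup>2) t - primitive (\<lambda>r. (norm (v r))\<^sup>2) s)
      \<le> (t - s) * C"
    using assms by (intro mult_left_mono) auto
  with primitive_increment_sq[OF assms(1-3)] show ?thesis by (intro real_le_rsqrt) linarith
qed

lemma continuous_primitive:
  assumes "integrable lborel v"
  shows "continuous_on S (primitive v)"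
proof -
  have "isCont (primitive v) t" for t
    unfolding continuous_at_sequentially comp_def
  proof (intro allI impI)
    fix x assume x: "x \<longlonglongrightarrow> t"
    show "(\<lambda>n. primitive v (x n)) \<longlonglongrightarrow> primitive v t"
      unfolding primitive_def set_lebesgue_integral_def
    proof (rule integral_dominated_convergence[where w="\<lambda>s. norm (v s)"])
      show "AE s in lborel. (\<lambda>n. indicator {..x n} s *\<^sub>R v s) \<longlonglongrightarrow> indicator {..t} s *\<^sub>R v s"
        using AE_lborel_singleton[of t]
      proof eventually_elim
        case (elim s)
        have "\<forall>\<^sub>F n in sequentially. indicator {..x n} s *\<^sub>R v s = indicator {..t} s *\<^sub>R v s"
        proof (cases "s < t")
          case True
          from order_tendstoD(1)[OF x this] show ?thesis
            by eventually_elim (use True elim in \<open>auto simp: indicator_def\<close>)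
        next
          case False
          with elim have "t < s" by auto
          from order_tendstoD(2)[OF x this] show ?thesis
            by eventually_elim (use False \<open>t < s\<close> in \<open>auto simp: indicator_def\<close>)
        qed
        then show ?case by (rule tendsto_eventually)
      qed
    qed (use assms in \<open>auto simp: indicator_def\<close>)
  qed
  then show ?thesis by (simp add: continuous_at_imp_continuous_on)
qed



section \<open>The chain rule along absolutely continuous curves\<close>

lemma integrable_lborel_continuous_interval:
  fixes Z :: "real \<Rightarrow> 'a::euclidean_space"
  assumes "continuous_on UNIV Z"
  shows "integrable lborel (\<lambda>t. indicator {a<..<b} t *\<^sub>R Z t)"
    "a \<le> b \<Longrightarrow> (LINT t|lborel. indicator {a<..<b} t *\<^sub>R Z t) = integral {a..b} Z"
proof -
  have i: "set_integrable lborel {a..b} Z"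
    by (rule borel_integrable_atLeastAtMost') (use assms continuous_on_subset in blast)
  then have i': "set_integrable lborel {a<..<b} Z"
    by (rule set_integrable_subset) auto
  then show "integrable lborel (\<lambda>t. indicator {a<..<b} t *\<^sub>R Z t)" by (simp add: set_integrable_def)
  assume "a \<le> b"
  have "(LINT t|lborel. indicator {a<..<b} t *\<^sub>R Z t) = integral {a<..<b} Z"
    using set_borel_integral_eq_integral(2)[OF i'] by (simp add: set_lebesgue_integral_def)
  also have "\<dots> = integral {a..b} Z" by (simp add: integral_open_interval_real)
  finally show "(LINT t|lborel. indicator {a<..<b} t *\<^sub>R Z t) = integral {a..b} Z" .
qed

text \<open>The integral over \<open>(0,T)\<close> of the difference quotient of \<open>Z\<close> telescopes to the difference of
  two averages of \<open>Z\<close>, near \<open>T\<close> and near \<open>0\<close>.\<close>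

lemma shift_average_limit:
  fixes Z :: "real \<Rightarrow> real"
  assumes Z: "continuous_on UNIV Z" and T: "0 < T"
  shows "(\<lambda>n. (LINT t|lborel. indicator {0<..<T} t * (Z (t + 1 / real (Suc n)) - Z t)) * real (Suc n))
       \<longlonglongrightarrow> Z T - Z 0"
proof -
  define F where "F x = integral {-1..x} Z" for x
  have F': "(F has_real_derivative Z x) (at x)" if "x > -1" for x
  proof -
    have "(F has_vector_derivative Z x) (at x within {-1..x+1})"
      unfolding F_def
      by (rule integral_has_vector_derivative) (use that continuous_on_subset[OF Z] in auto)
    then have "(F has_vector_derivative Z x) (at x)"
      using that by (subst (asm) at_within_interior) auto
    then show ?thesis by (simp add: has_real_derivative_iff_has_vector_derivative)
  qed
  have int: "integral {a..b} Z = F b - F a" if "-1 \<le> a" "a \<le> b" for a b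
    unfolding F_def using that
    by (subst Henstock_Kurzweil_Integration.integral_combine[of "-1" a b, symmetric])
      (auto intro!: integrable_continuous_interval continuous_on_subset[OF Z])
  have eq: "(LINT t|lborel. indicator {0<..<T} t * (Z (t + h) - Z t))
      = (F (T + h) - F T) - (F (0 + h) - F 0)"
    if "h > 0" for h
  proof -
    have Zh: "continuous_on UNIV (\<lambda>t. Z (t + h))"
      by (intro continuous_on_compose2[OF Z] continuous_intros) auto
    have "(LINT t|lborel. indicator {0<..<T} t * (Z (t + h) - Z t))
      = (LINT t|lborel. indicator {0<..<T} t *\<^sub>R Z (t + h))
          - (LINT t|lborel. indicator {0<..<T} t *\<^sub>R Z t)"
      using integrable_lborel_continuous_interval(1)[OF Z, of 0 T]
          integrable_lborel_continuous_interval(1)[OF Zh, of 0 T]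
      by (simp add: algebra_simps)
    also have "\<dots> = integral {0..T} (\<lambda>t. Z (t + h)) - integral {0..T} Z"
      using integrable_lborel_continuous_interval(2)[OF Z, of 0 T]
          integrable_lborel_continuous_interval(2)[OF Zh, of 0 T] T
      by simp
    also have "integral {0..T} (\<lambda>t. Z (t + h)) = integral {0+h..T+h} Z"
      using integral_shift_real_ivl[of "0+h" h "T+h" Z] by simp
    finally show ?thesis using int[of "0+h" "T+h"] int[of 0 T] that T by simp
  qed
  have lim: "(\<lambda>n. (F (x + 1 / real (Suc n)) - F x) * real (Suc n)) \<longlonglongrightarrow> Z x" if "x > -1" for x
  proof -
    have "((\<lambda>h. (F (x + h) - F x) / h) \<longlongrightarrow> Z x) (at 0)"
      using F'[OF that] by (simp add: DERIV_def)
    moreover have "filterlim (\<lambda>n. 1 / real (Suc n)) (at 0) sequentially"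
      unfolding filterlim_at using lim_1_over_n[THEN LIMSEQ_Suc] by auto
    ultimately have "(\<lambda>n. (F (x + 1 / real (Suc n)) - F x) / (1 / real (Suc n))) \<longlonglongrightarrow> Z x"
      by (rule filterlim_compose)
    then show ?thesis by simp
  qed
  have "(\<lambda>n. (LINT t|lborel. indicator {0<..<T} t * (Z (t + 1 / real (Suc n)) - Z t)) * real (Suc n))
    = (\<lambda>n. (F (T + 1 / real (Suc n)) - F T) * real (Suc n)
        - (F (0 + 1 / real (Suc n)) - F 0) * real (Suc n))"
    by (intro ext, subst eq) (simp_all only: left_diff_distrib, simp)
  then show ?thesis
    using tendsto_diff[OF lim[of T] lim[of 0]] T by simp
qed

text \<open>The Lebesgue differentiation theorem for averages to the right.\<close>

lemma primitive_right_difference_quotient: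
  fixes v :: "real \<Rightarrow> 'a::euclidean_space"
  assumes v: "integrable lborel v"
  shows "AE t in lborel. (\<lambda>n. real (Suc n) *\<^sub>R (primitive v (t + 1 / real (Suc n)) - primitive v t))
      \<longlonglongrightarrow> v t"
proof -
  have si: "set_integrable lborel A v" if "A \<in> sets borel" for A
    using set_integrable_of_integrable[OF v that] .
  have "v integrable_on cbox a b" for a b
    using set_borel_integral_eq_integral(1)[OF si, of "cbox a b"] by simp
  from integrable_ccontinuous_explicit[OF this] obtain N where N: "negligible N"
    "\<And>x e. \<lbrakk>x \<notin> N; 0 < e\<rbrakk> \<Longrightarrow> \<exists>d>0. \<forall>h. 0 < h \<and> h < d \<longrightarrow>
         norm (integral (cbox x (x + h *\<^sub>R One)) v /\<^sub>R h ^ DIM(real) - v x) < e" by metis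
  have "AE t in lebesgue. t \<notin> N" using N(1) by (simp add: negligible_iff_null_sets AE_not_in)
  then have "AE t in lborel. t \<notin> N" by (simp add: AE_completion_iff)
  then show ?thesis
  proof eventually_elim
    case (elim t)
    have eq: "integral (cbox t (t + h *\<^sub>R One)) v = primitive v (t + h) - primitive v t" if "h > 0"
        for h
    proof -
      have "primitive v (t + h) - primitive v t = (LINT r:{t<..t+h}|lborel. v r)"
        using primitive_diff[OF v, of t "t+h"] that by simp
      also have "\<dots> = integral {t<..t+h} v"
        by (rule set_borel_integral_eq_integral(2)) (rule si, simp)
      also have "\<dots> = integral {t..t+h} v"
        by (rule integral_subset_negligible) (auto intro: negligible_subset[of "{t}"])
      finally show ?thesis by simp
    qed
    show ?case
    proof (rule metric_LIMSEQ_I)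
      fix e :: real assume "e > 0"
      from N(2)[OF elim this] obtain d where d: "d > 0" "\<And>h. 0 < h \<Longrightarrow> h < d \<Longrightarrow>
         norm (integral (cbox t (t + h *\<^sub>R One)) v /\<^sub>R h ^ DIM(real) - v t) < e" by blast
      obtain n0 where n0: "1 / real (Suc n0) < d" using nat_approx_posE[OF d(1)] by blast
      show "\<exists>n0. \<forall>n\<ge>n0. dist (real (Suc n) *\<^sub>R (primitive v (t + 1 / real (Suc n)) - primitive v t))
          (v t) < e"
      proof (intro exI allI impI)
        fix n assume "n \<ge> n0"
        then have "1 / real (Suc n) \<le> 1 / real (Suc n0)" by (simp add: frac_le)
        with n0 have "1 / real (Suc n) < d" by simp
        from d(2)[OF _ this] show "dist
            (real (Suc n) *\<^sub>R (primitive v (t + 1 / real (Suc n)) - primitive v t)) (v t) < e"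
          using eq[of "1 / real (Suc n)"] by (simp add: dist_norm)
      qed
    qed
  qed
qed


text \<open>One half of the chain rule \<open>(E \<circ> u)' = \<eta> \<bullet> u'\<close> for \<open>\<eta>\<close> in the subdifferential of a semiconvex \<open>E\<close>
  along \<open>u\<close>.  The subgradient inequality between the times \<open>t\<close> and \<open>t + h\<close> bounds
  \<open>\<eta> t \<bullet> (u (t + h) - u t) / h\<close> by the difference quotient of \<open>E \<circ> u\<close> up to a vanishing error, and
  Fatou's lemma lets \<open>h\<close> tend to \<open>0\<close>.  Neither differentiability of \<open>E \<circ> u\<close> nor a bound on the
  difference quotients is needed.\<close>

lemma chain_inequality:
  fixes E :: "'a::euclidean_space \<Rightarrow> real" and v \<eta> :: "real \<Rightarrow> 'a"
  assumes E: "continuous_on UNIV E" and T: "0 < T" and L: "0 \<le> L" and M: "0 \<le> M"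
    and v: "sq_integrable v" and v0: "\<And>t. t \<notin> {0<..T} \<Longrightarrow> v t = 0"
    and \<eta>: "\<eta> \<in> borel_measurable borel" and \<eta>M: "\<And>t. norm (\<eta> t) \<le> M"
    and sub: "AE t in lborel. t \<in> {0<..<T} \<longrightarrow>
       (\<forall>z. \<eta> t \<bullet> (z - (u0 + primitive v t))
           \<le> E z - E (u0 + primitive v t) + L * (norm (z - (u0 + primitive v t)))\<^sup>2)"
  shows "(LINT t|lborel. \<eta> t \<bullet> v t) \<le> E (u0 + primitive v T) - E u0"
proof -
  define u where "u t = u0 + primitive v t" for t
  define W where "W = primitive (\<lambda>r. norm (v r))"
  define V where "V = primitive (\<lambda>r. (norm (v r))\<^sup>2)"
  \<comment> \<open>The term with \<open>W\<close> makes the integrands \<open>g n\<close> below nonnegative, as Fatou's lemma requires; its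
    contributions to both sides cancel at the end.\<close>
  define Z where "Z t = E (u t) + M * W t" for t
  have vm [measurable]: "v \<in> borel_measurable borel" using v by (rule sq_integrable_measurable)
  have iv: "integrable lborel v" by (rule sq_integrable_imp_integrable[OF v v0])
  have iv2: "integrable lborel (\<lambda>t. (norm (v t))\<^sup>2)" using v by (simp add: sq_integrable_def)
  have ivn: "integrable lborel (\<lambda>t. norm (v t))" using iv by simp
  have cu: "continuous_on UNIV u" unfolding u_def by (intro continuous_intros continuous_primitive iv)
  have cW: "continuous_on UNIV W" unfolding W_def by (intro continuous_primitive ivn)
  have cV: "continuous_on UNIV V" unfolding V_def by (intro continuous_primitive iv2)
  have cZ: "continuous_on UNIV Z" unfolding Z_def
    by (intro continuous_intros cW continuous_on_compose2[OF E cu]) auto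
  have shift: "continuous_on UNIV (\<lambda>t. F (t + h))"
      if "continuous_on UNIV F" for F :: "real \<Rightarrow> 'b::topological_space" and h
    by (intro continuous_on_compose2[OF that] continuous_intros) auto
  note [measurable] = \<eta> borel_measurable_continuous_onI[OF cu] borel_measurable_continuous_onI[OF cW]
  note [measurable] = borel_measurable_continuous_onI[OF shift[OF cu]]
      borel_measurable_continuous_onI[OF shift[OF cW]]
  define h where "h n = 1 / real (Suc n)" for n
  have h: "h n > 0" "real (Suc n) * h n = 1" for n by (auto simp: h_def)
  define g where "g n t = indicator {0<..<T} t *
      (\<eta> t \<bullet> (real (Suc n) *\<^sub>R (u (t + h n) - u t)) + M * (real (Suc n) * (W (t + h n) - W t)))" for n t
  have du: "norm (u (t + h n) - u t) \<le> W (t + h n) - W t" for n t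
    using primitive_increment_norm[OF iv, of t "t + h n"] h(1)[of n] by (simp add: u_def W_def)
  have du2: "(norm (u (t + h n) - u t))\<^sup>2 \<le> h n * (V (t + h n) - V t)" for n t
    using primitive_increment_sq[OF v iv, of t "t + h n"] h(1)[of n] by (simp add: u_def V_def)
  have \<eta>du: "\<bar>\<eta> t \<bullet> (u (t + h n) - u t)\<bar> \<le> M * (W (t + h n) - W t)" for n t
    by (rule order_trans[OF Cauchy_Schwarz_ineq2]) (intro mult_mono \<eta>M du M norm_ge_zero)
  have g_eq: "g n t = indicator {0<..<T} t *
      (real (Suc n) * (\<eta> t \<bullet> (u (t + h n) - u t) + M * (W (t + h n) - W t)))" for n t
    by (simp add: g_def algebra_simps)
  have g0: "0 \<le> g n t" for n t
    unfolding g_eq using \<eta>du[of t n] by (intro mult_nonneg_nonneg) auto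
  have dWint: "integrable lborel (\<lambda>t. indicator {0<..<T} t * (F (t + h n) - F t))"
      if "continuous_on UNIV F" for F :: "real \<Rightarrow> real" and n
    using integrable_lborel_continuous_interval(1)[OF continuous_on_diff[OF shift[OF that] that], of 0
        T "h n"] by simp
  have gint: "integrable lborel (g n)" for n
  proof (rule Bochner_Integration.integrable_bound[OF
      integrable_mult_right[OF dWint[OF cW, of n], of "2 * M * real (Suc n)"]])
    show "g n \<in> borel_measurable lborel" unfolding g_def by measurable
    show "AE t in lborel. norm (g n t)
        \<le> norm (2 * M * real (Suc n) * (indicator {0<..<T} t * (W (t + h n) - W t)))"
    proof (intro AE_I2)
      fix t
      have "g n t \<le> indicator {0<..<T} t * (real (Suc n) * (2 * (M * (W (t + h n) - W t))))"
        unfolding g_eq using \<eta>du[of t n] by (intro mult_left_mono) auto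
      also have "\<dots> = 2 * M * real (Suc n) * (indicator {0<..<T} t * (W (t + h n) - W t))" by simp
      finally show "norm (g n t) \<le> norm
          (2 * M * real (Suc n) * (indicator {0<..<T} t * (W (t + h n) - W t)))"
        using g0[of n t] by simp
    qed
  qed
  define G where "G t = indicator {0<..<T} t * (\<eta> t \<bullet> v t + M * norm (v t))" for t
  define x where "x F n = (LINT t|lborel. indicator {0<..<T} t * (F (t + h n) - F t)) * real (Suc n)"
      for F :: "real \<Rightarrow> real" and n
  have x: "x F \<longlonglongrightarrow> F T - F 0" if "continuous_on UNIV F" for F
    using shift_average_limit[OF that T] by (simp add: x_def[abs_def] h_def)
  have le: "(LINT t|lborel. g n t) \<le> x Z n + L * (x V n * h n)" for n
  proof -
    have "(LINT t|lborel. g n t) \<le> (LINT t|lborel. real (Suc n) *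
        (indicator {0<..<T} t * (Z (t + h n) - Z t))
        + L * (indicator {0<..<T} t * (V (t + h n) - V t)))"
    proof (rule integral_mono_AE)
      show "AE t in lborel. g n t \<le> real (Suc n) * (indicator {0<..<T} t * (Z (t + h n) - Z t))
        + L * (indicator {0<..<T} t * (V (t + h n) - V t))"
        using sub
      proof eventually_elim
        case (elim t)
        show ?case
        proof (cases "t \<in> {0<..<T}")
          case True
          have "\<eta> t \<bullet> (u (t + h n) - u t)
              \<le> E (u (t + h n)) - E (u t) + L * (norm (u (t + h n) - u t))\<^sup>2"
            using elim[rule_format, OF True, of "u (t + h n)"] by (simp add: u_def)
          also have "\<dots> \<le> E (u (t + h n)) - E (u t) + L * (h n * (V (t + h n) - V t))"
            using du2[of t n] L by (intro add_left_mono mult_left_mono)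
          finally have "\<eta> t \<bullet> (u (t + h n) - u t) + M * (W (t + h n) - W t)
              \<le> (Z (t + h n) - Z t) + L * (h n * (V (t + h n) - V t))"
            by (simp add: Z_def algebra_simps)
          then have "real (Suc n) * (\<eta> t \<bullet> (u (t + h n) - u t) + M * (W (t + h n) - W t))
             \<le> real (Suc n) * ((Z (t + h n) - Z t) + L * (h n * (V (t + h n) - V t)))"
            by (rule mult_left_mono) simp
          also have "\<dots> = real (Suc n) * (Z (t + h n) - Z t)
              + L * ((real (Suc n) * h n) * (V (t + h n) - V t))"
            by (simp only: algebra_simps)
          finally show ?thesis using True unfolding g_eq h(2) by simp
        qed (simp add: g_def)
      qed
    qed (intro gint Bochner_Integration.integrable_add integrable_mult_right dWint cZ cV)+
    also have "\<dots> = real (Suc n) * (LINT t|lborel. indicator {0<..<T} t * (Z (t + h n) - Z t))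
        + L * (LINT t|lborel. indicator {0<..<T} t * (V (t + h n) - V t))"
      by (subst Bochner_Integration.integral_add) (intro integrable_mult_right dWint cZ cV | simp)+
    also have "\<dots> = x Z n + L * (x V n * h n)"
    proof -
      have "(LINT t|lborel. indicator {0<..<T} t * (V (t + h n) - V t)) = x V n * h n"
        unfolding x_def mult.assoc h(2) by simp
      then show ?thesis by (simp add: x_def)
    qed
    finally show ?thesis .
  qed
  have h0: "h \<longlonglongrightarrow> 0" unfolding h_def using lim_1_over_n[THEN LIMSEQ_Suc] by simp
  have lim: "AE t in lborel. (\<lambda>n. g n t) \<longlonglongrightarrow> G t"
    using primitive_right_difference_quotient[OF iv] primitive_right_difference_quotient[OF ivn]
  proof eventually_elim
    case (elim t)
    show ?case unfolding g_def G_def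
      by (intro tendsto_intros) (use elim in \<open>auto simp: u_def W_def h_def\<close>)
  qed
  have Gm: "G \<in> borel_measurable lborel" unfolding G_def by measurable
  have "(\<lambda>n. x Z n + L * (x V n * h n)) \<longlonglongrightarrow> (Z T - Z 0) + L * ((V T - V 0) * 0)"
    by (intro tendsto_intros x cZ cV h0)
  then have c: "(\<lambda>n. x Z n + L * (x V n * h n)) \<longlonglongrightarrow> Z T - Z 0" by simp
  have "(LINT t|lborel. G t) \<le> Z T - Z 0"
    using fatou_real(2)[OF gint g0 lim Gm le c] .
  moreover have "(LINT t|lborel. G t) = (LINT t|lborel. \<eta> t \<bullet> v t) + M * (LINT t|lborel. norm (v t))"
  proof -
    have "integrable lborel (\<lambda>t. \<eta> t \<bullet> v t)"
    proof (rule Bochner_Integration.integrable_bound[OF integrable_mult_right[OF ivn, of M]])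
      show "AE t in lborel. norm (\<eta> t \<bullet> v t) \<le> norm (M * norm (v t))"
        by (intro AE_I2) (use \<eta>M M in \<open>auto intro!: order_trans[OF Cauchy_Schwarz_ineq2]
            mult_right_mono\<close>)
    qed measurable
    moreover have "(LINT t|lborel. G t) = (LINT t|lborel. \<eta> t \<bullet> v t + M * norm (v t))"
    proof (rule integral_cong_AE)
      show "AE t in lborel. G t = \<eta> t \<bullet> v t + M * norm (v t)"
        using AE_lborel_singleton[of T]
      proof eventually_elim
        case (elim t)
        then show ?case using v0[of t] by (cases "t \<in> {0<..<T}") (auto simp: G_def)
      qed
    qed (use Gm in measurable)
    ultimately show ?thesis using ivn by simp
  qed
  moreover have "W T = (LINT t|lborel. norm (v t))" "W 0 = 0"
    unfolding W_def by (rule primitive_outside[of T]; use v0 in auto)+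
  moreover have "primitive v 0 = 0" by (rule primitive_outside[of T]; use v0 in auto)
  ultimately show ?thesis by (simp add: Z_def u_def)
qed


section \<open>Weak limits through averages of tails\<close>

text \<open>The functions obtained from \<open>x n, x (n + 1), \<dots>\<close> by repeatedly taking midpoints.  These are the
  dyadic convex combinations of the tail; since they are all that Mazur's argument needs, no
  coefficient sequences have to be carried along, and facts about them follow by rule induction.\<close>

inductive tail_average :: "(nat \<Rightarrow> real \<Rightarrow> 'a::real_vector) \<Rightarrow> nat \<Rightarrow> (real \<Rightarrow> 'a) \<Rightarrow> bool"
  for x and n where
  base: "n \<le> k \<Longrightarrow> tail_average x n (x k)"
| mid: "tail_average x n f \<Longrightarrow> tail_average x n g \<Longrightarrow> tail_average x n (\<lambda>t. (1/2) *\<^sub>R (f t + g t))"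

lemma tail_average_antimono: "tail_average x n f \<Longrightarrow> m \<le> n \<Longrightarrow> tail_average x m f"
  by (induction rule: tail_average.induct) (auto intro: tail_average.intros)

lemma norm_mid_sq_le: "(norm ((1/2) *\<^sub>R ((x::'a::real_inner) + y)))\<^sup>2
    \<le> (1/2) * (norm x)\<^sup>2 + (1/2) * (norm y)\<^sup>2"
  using norm_add_sq_le[of x y] by (simp add: power_mult_distrib power_divide)

lemma tail_average_sq_integrable:
  assumes x: "\<And>k. sq_integrable (x k)" "\<And>k. (LINT t|lborel. (norm (x k t))\<^sup>2) \<le> C"
    "\<And>k t. t \<notin> S \<Longrightarrow> x k t = 0" and f: "tail_average x n f"
  shows "sq_integrable f" "(LINT t|lborel. (norm (f t))\<^sup>2) \<le> C" "\<And>t. t \<notin> S \<Longrightarrow> f t = 0"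
proof -
  have "sq_integrable f \<and> (LINT t|lborel. (norm (f t))\<^sup>2) \<le> C \<and> (\<forall>t. t \<notin> S \<longrightarrow> f t = 0)"
    using f
  proof induction
    case (mid f g)
    then have sq: "sq_integrable (\<lambda>t. (1/2) *\<^sub>R (f t + g t))"
      by (intro sq_integrable_scale sq_integrable_add) auto
    have "(LINT t|lborel. (norm ((1/2) *\<^sub>R (f t + g t)))\<^sup>2)
        \<le> (LINT t|lborel. (1/2) * (norm (f t))\<^sup>2 + (1/2) * (norm (g t))\<^sup>2)"
      by (intro Bochner_Integration.integral_mono norm_mid_sq_le)
          (use sq mid in \<open>auto simp: sq_integrable_def\<close>)
    also have "\<dots> = (1/2) * (LINT t|lborel. (norm (f t))\<^sup>2) + (1/2) * (LINT t|lborel. (norm (g t))\<^sup>2)"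
      using mid by (simp add: sq_integrable_def)
    also have "\<dots> \<le> C" using mid by linarith
    finally show ?case using sq mid by auto
  qed (use x in auto)
  then show "sq_integrable f" "(LINT t|lborel. (norm (f t))\<^sup>2) \<le> C" "\<And>t. t \<notin> S \<Longrightarrow> f t = 0" by auto
qed

text \<open>Mazur's theorem for a bounded sequence in \<open>L\<^sup>2(0,T)\<close>: functions of almost minimal norm among the
  averages of the \<open>n\<close>-th tail form a Cauchy sequence by the parallelogram law.\<close>

lemma mazur_sq_integrable:
  fixes x :: "nat \<Rightarrow> real \<Rightarrow> 'a::euclidean_space"
  assumes x: "\<And>k. sq_integrable (x k)" "\<And>k. (LINT t|lborel. (norm (x k t))\<^sup>2) \<le> C"
    "\<And>k t. t \<notin> {0<..T} \<Longrightarrow> x k t = 0" and T: "0 < T"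
  obtains y z where "\<And>n. tail_average x n (y n)" "sq_integrable z" "\<And>t. t \<notin> {0<..T} \<Longrightarrow> z t = 0"
    "AE t in lborel. (\<lambda>n. y n t) \<longlonglongrightarrow> z t"
    "(\<lambda>n. LINT t|lborel. (norm (y n t - z t))\<^sup>2) \<longlonglongrightarrow> 0"
proof -
  have ta: "sq_integrable f" "(LINT t|lborel. (norm (f t))\<^sup>2) \<le> C" "t \<notin> {0<..T} \<Longrightarrow> f t = 0"
    if "tail_average x n f" for n f t
    using tail_average_sq_integrable[where S = "{0<..T}", OF x(1,2) _ that] x(3) by auto
  define N where "N f = (LINT t|lborel. (norm (f t))\<^sup>2)" for f :: "real \<Rightarrow> 'a"
  have N0: "0 \<le> N f" for f unfolding N_def by (intro integral_nonneg_AE) auto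
  define D where "D n = Inf (N ` {f. tail_average x n f})" for n
  have ne: "{f. tail_average x n f} \<noteq> {}" for n by (auto intro!: exI tail_average.base)
  have bdd: "bdd_below (N ` {f. tail_average x n f})" for n by (rule bdd_belowI[of _ 0]) (auto simp: N0)
  have D_le: "D n \<le> N f" if "tail_average x n f" for n f
    unfolding D_def by (rule cInf_lower[OF _ bdd]) (use that in auto)
  have Dmono: "D m \<le> D n" if "m \<le> n" for m n
    unfolding D_def
    by (rule cInf_superset_mono[OF _ bdd image_mono])
        (use ne[of n] tail_average_antimono[OF _ that] in auto)
  have DC: "D n \<le> C" for n
    using D_le[OF tail_average.base[of n n x]] x(2)[of n] by (simp add: N_def)
  obtain Dl where Dl: "D \<longlonglongrightarrow> Dl" "\<And>n. D n \<le> Dl"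
    using incseq_convergent[of D C] Dmono DC by (auto simp: incseq_def)
  have "\<exists>f. tail_average x n f \<and> N f < D n + 1 / real (Suc n)" for n
  proof -
    have "Inf (N ` {f. tail_average x n f}) < D n + 1 / real (Suc n)" by (simp add: D_def)
    from cInf_lessD[OF _ this] ne show ?thesis by auto
  qed
  then obtain f where f: "\<And>n. tail_average x n (f n)" "\<And>n. N (f n) < D n + 1 / real (Suc n)" by metis
  have fsq: "sq_integrable (f n)" for n using ta(1) f(1) .
  have f0: "f n t = 0" if "t \<notin> {0<..T}" for n t using ta(3)[OF f(1) that] .
  have fm [measurable]: "f n \<in> borel_measurable borel" for n using fsq
      by (rule sq_integrable_measurable)
  have diff: "N (\<lambda>t. f i t - f j t) \<le> 4 * (Dl - D n) + 4 / real (Suc n)" if "n \<le> i" "n \<le> j" for i j n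
  proof -
    have m: "tail_average x n (\<lambda>t. (1/2) *\<^sub>R (f i t + f j t))"
      using that f(1) by (intro tail_average.mid) (auto intro: tail_average_antimono)
    have "N (\<lambda>t. f i t - f j t) = (LINT t|lborel. 2 * (norm (f i t))\<^sup>2 + 2 * (norm (f j t))\<^sup>2
        - 4 * (norm ((1/2) *\<^sub>R (f i t + f j t)))\<^sup>2)"
      unfolding N_def by (intro Bochner_Integration.integral_cong refl)
          (simp add: parallelogram power_divide)
    also have "\<dots> = 2 * N (f i) + 2 * N (f j) - 4 * N (\<lambda>t. (1/2) *\<^sub>R (f i t + f j t))"
      using fsq[of i] fsq[of j] ta(1)[OF m] by (simp add: sq_integrable_def N_def del: norm_scaleR)
    also have "\<dots> \<le> 2 * (D i + 1 / real (Suc i)) + 2 * (D j + 1 / real (Suc j)) - 4 * D n"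
    proof -
      have "2 * a + 2 * b - 4 * c \<le> 2 * a' + 2 * b' - 4 * c'" if "a < a'" "b < b'" "c' \<le> c"
          for a b c a' b' c' :: real
        using that by linarith
      then show ?thesis using f(2)[of i] f(2)[of j] D_le[OF m] .
    qed
    also have "\<dots> \<le> 2 * (Dl + 1 / real (Suc n)) + 2 * (Dl + 1 / real (Suc n)) - 4 * D n"
    proof -
      have "1 / real (Suc i) \<le> 1 / real (Suc n)" "1 / real (Suc j) \<le> 1 / real (Suc n)"
        using that by (auto intro!: frac_le)
      then show ?thesis using Dl(2)[of i] Dl(2)[of j]
        by (intro diff_right_mono add_mono mult_left_mono) auto
    qed
    also have "\<dots> = 4 * (Dl - D n) + 4 / real (Suc n)"
    proof -
      have "2 * (Dl + c) + 2 * (Dl + c) - 4 * D n = 4 * (Dl - D n) + 4 * c" for c by simp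
      from this[of "1 / real (Suc n)"] show ?thesis by simp
    qed
    finally show ?thesis .
  qed
  have Cauchy2: "\<exists>n0. \<forall>i\<ge>n0. \<forall>j\<ge>n0. N (\<lambda>t. f i t - f j t) \<le> e" if "e > 0" for e
  proof -
    have "(\<lambda>n. 4 * (Dl - D n) + 4 * (1 / real (Suc n))) \<longlonglongrightarrow> 4 * (Dl - Dl) + 4 * 0"
      by (intro tendsto_intros Dl lim_1_over_n[THEN LIMSEQ_Suc])
    then have "\<forall>\<^sub>F n in sequentially. 4 * (Dl - D n) + 4 * (1 / real (Suc n)) < e"
      by (rule order_tendstoD) (use that in auto)
    then obtain n0 where n0: "4 * (Dl - D n0) + 4 / real (Suc n0) < e"
      by (auto simp: eventually_sequentially)
    show ?thesis by (intro exI[of _ n0] allI impI order_trans[OF diff less_imp_le[OF n0]])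
  qed
  have fint: "integrable lborel (f n)" for n by (rule sq_integrable_imp_integrable[OF fsq f0])
  have L1: "(LINT t|lborel. norm (g t)) \<le> sqrt (T * N g)"
    if "sq_integrable g" "\<And>t. t \<notin> {0<..T} \<Longrightarrow> g t = 0" for g :: "real \<Rightarrow> 'a"
  proof -
    have "(LINT r:{0<..T}|lborel. norm (g r))\<^sup>2
        \<le> measure lborel {0<..T} * (LINT r:{0<..T}|lborel. (norm (g r))\<^sup>2)"
      by (rule set_integral_norm_sq_le[OF that(1)]) (use T in auto)
    moreover have "(\<lambda>r. indicator {0<..T} r *\<^sub>R norm (g r)) = (\<lambda>r. norm (g r))"
      "(\<lambda>r. indicator {0<..T} r *\<^sub>R (norm (g r))\<^sup>2) = (\<lambda>r. (norm (g r))\<^sup>2)"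
      using that(2) by (force simp: fun_eq_iff indicator_def)+
    ultimately have "(LINT r|lborel. norm (g r))\<^sup>2 \<le> T * N g"
      using T by (simp add: set_lebesgue_integral_def N_def)
    then show ?thesis by (rule real_le_rsqrt)
  qed
  have CauchyL1: "\<exists>n0. \<forall>i\<ge>n0. \<forall>j\<ge>n0. LINT t|lborel. norm (f i t - f j t) < e" if "e > 0" for e
  proof -
    have "e\<^sup>2 / (4 * T) > 0" using that T by simp
    from Cauchy2[OF this] obtain n0 where n0: "\<And>i j. i \<ge> n0 \<Longrightarrow> j \<ge> n0 \<Longrightarrow> N (\<lambda>t. f i t - f j t)
        \<le> e\<^sup>2 / (4 * T)" by blast
    have "LINT t|lborel. norm (f i t - f j t) < e" if "i \<ge> n0" "j \<ge> n0" for i j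
    proof -
      have "(LINT t|lborel. norm (f i t - f j t)) \<le> sqrt (T * N (\<lambda>t. f i t - f j t))"
        by (intro L1 sq_integrable_diff fsq) (simp add: f0)
      also have "\<dots> \<le> sqrt ((e/2)\<^sup>2)"
        using n0[OF that] T by (intro real_sqrt_le_mono) (simp add: field_simps power2_eq_square)
      also have "\<dots> < e" using \<open>e > 0\<close> by simp
      finally show ?thesis .
    qed
    then show ?thesis by blast
  qed
  obtain r where r: "strict_mono r" "AE t in lborel. Cauchy (\<lambda>i. f (r i) t)"
    using cauchy_L1_AE_cauchy_subseq[OF fint CauchyL1] by metis
  define z where "z t = lim (\<lambda>i. f (r i) t)" for t
  have zm [measurable]: "z \<in> borel_measurable borel" unfolding z_def
    by (rule borel_measurable_lim_metric) measurable
  have z0: "z t = 0" if "t \<notin> {0<..T}" for t using f0[OF that] by (simp add: z_def)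
  have lim: "AE t in lborel. (\<lambda>i. f (r i) t) \<longlonglongrightarrow> z t"
    using r(2) by eventually_elim (simp add: z_def Cauchy_convergent convergent_LIMSEQ_iff[symmetric])
  have r_ge: "n \<le> r n" for n using r(1) by (rule seq_suble)
  have close: "integrable lborel (\<lambda>t. (norm (f (r i) t - z t))\<^sup>2)
      \<and> (LINT t|lborel. (norm (f (r i) t - z t))\<^sup>2) \<le> e"
    if "\<And>i j. i \<ge> n0 \<Longrightarrow> j \<ge> n0 \<Longrightarrow> N (\<lambda>t. f i t - f j t) \<le> e" "i \<ge> n0" for e n0 i
  proof -
    define g where "g j t = (norm (f (r i) t - f (r (j + n0)) t))\<^sup>2" for j t
    have 1: "integrable lborel (g j)" for j
      using sq_integrable_diff[OF fsq fsq, of "r i" "r (j + n0)"]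
          by (simp add: g_def[abs_def] sq_integrable_def)
    have 2: "0 \<le> g j t" for j t by (simp add: g_def)
    have 3: "AE t in lborel. (\<lambda>j. g j t) \<longlonglongrightarrow> (norm (f (r i) t - z t))\<^sup>2"
      using lim
    proof eventually_elim
      case (elim t)
      then show ?case unfolding g_def by (intro tendsto_intros LIMSEQ_ignore_initial_segment)
    qed
    have 4: "(LINT t|lborel. g j t) \<le> e" for j
      using that(1)[of "r i" "r (j + n0)"] r_ge[of i] r_ge[of "j + n0"] that(2)
          by (simp add: N_def g_def)
    have 5: "(\<lambda>t. (norm (f (r i) t - z t))\<^sup>2) \<in> borel_measurable lborel" by measurable
    show ?thesis using fatou_real[OF 1 2 3 5 4 tendsto_const] by auto
  qed
  have zsq: "sq_integrable z"
  proof -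
    obtain n0 where n0: "\<And>i j. i \<ge> n0 \<Longrightarrow> j \<ge> n0 \<Longrightarrow> N (\<lambda>t. f i t - f j t) \<le> 1" using Cauchy2[of 1] by auto
    have "sq_integrable (\<lambda>t. f (r n0) t - z t)"
      using close[OF n0, of n0] by (auto simp: sq_integrable_def)
    from sq_integrable_diff[OF fsq[of "r n0"] this] show ?thesis by simp
  qed
  have l2: "(\<lambda>n. LINT t|lborel. (norm (f (r n) t - z t))\<^sup>2) \<longlonglongrightarrow> 0"
  proof (rule LIMSEQ_I)
    fix e :: real assume "e > 0"
    then obtain n0 where n0: "\<And>i j. i \<ge> n0 \<Longrightarrow> j \<ge> n0 \<Longrightarrow> N (\<lambda>t. f i t - f j t) \<le> e/2"
        using Cauchy2[of "e/2"] by auto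
    have "norm ((LINT t|lborel. (norm (f (r n) t - z t))\<^sup>2) - 0) < e" if "n \<ge> n0" for n
    proof -
      have "0 \<le> (LINT t|lborel. (norm (f (r n) t - z t))\<^sup>2)" by (intro integral_nonneg_AE) auto
      then show ?thesis using close[OF n0 that] \<open>e > 0\<close> by auto
    qed
    then show "\<exists>n0. \<forall>n\<ge>n0. norm ((LINT t|lborel. (norm (f (r n) t - z t))\<^sup>2) - 0) < e" by blast
  qed
  show ?thesis
    by (rule that[of "\<lambda>n. f (r n)" z]) (use zsq z0 lim l2 tail_average_antimono[OF f(1) r_ge] in auto)
qed


lemma tail_average_le:
  assumes f: "tail_average x n f" and x: "\<And>k. n \<le> k \<Longrightarrow> \<phi> (x k) \<le> (c::real)"
    and mid: "\<And>f g. tail_average x n f \<Longrightarrow> tail_average x n g \<Longrightarrow>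
      \<phi> (\<lambda>t. (1/2) *\<^sub>R (f t + g t)) = (\<phi> f + \<phi> g) / 2"
  shows "\<phi> f \<le> c"
  using f
proof induction
  case (mid f g)
  have "\<phi> (\<lambda>t. (1/2) *\<^sub>R (f t + g t)) = (\<phi> f + \<phi> g) / 2" by (rule assms(3)[OF mid.hyps])
  also have "\<dots> \<le> c" using add_mono[OF mid.IH] by simp
  finally show ?case .
qed (rule x)

text \<open>The strong limit of averages inherits every upper bound of a linear functional that holds
  asymptotically along the sequence, both for functionals on \<open>L\<^sup>2\<close> and for the value at almost every
  point.  This does the work of a weakly convergent subsequence; no subsequence of \<open>x\<close> is extracted.\<close>

lemma weak_limit_exists:
  fixes x :: "nat \<Rightarrow> real \<Rightarrow> 'a::euclidean_space"
  assumes x: "\<And>k. sq_integrable (x k)" "\<And>k. (LINT t|lborel. (norm (x k t))\<^sup>2) \<le> C"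
    "\<And>k t. t \<notin> {0<..T} \<Longrightarrow> x k t = 0" and T: "0 < T"
  obtains z where "sq_integrable z" "\<And>t. t \<notin> {0<..T} \<Longrightarrow> z t = 0"
    "\<And>W c l. sq_integrable W \<Longrightarrow> (\<And>k. (LINT t|lborel. x k t \<bullet> W t) \<le> c k) \<Longrightarrow> c \<longlonglongrightarrow> l \<Longrightarrow>
       (LINT t|lborel. z t \<bullet> W t) \<le> l"
    "AE t in lborel. \<forall>a c l. (\<forall>k. x k t \<bullet> a \<le> c k) \<longrightarrow> c \<longlonglongrightarrow> l \<longrightarrow> z t \<bullet> a \<le> l"
proof -
  obtain y z where y: "\<And>n. tail_average x n (y n)" and z: "sq_integrable z" "\<And>t. t \<notin> {0<..T} \<Longrightarrow> z t = 0"
    and lim: "AE t in lborel. (\<lambda>n. y n t) \<longlonglongrightarrow> z t"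
    "(\<lambda>n. LINT t|lborel. (norm (y n t - z t))\<^sup>2) \<longlonglongrightarrow> 0"
    by (rule mazur_sq_integrable[where x = x, OF x(1,2) _ T]) (rule x(3), assumption, rule that)
  have ta: "sq_integrable f" if "tail_average x n f" for n f
    using tail_average_sq_integrable(1)[where S = "{0<..T}", OF x(1,2) _ that] x(3) by auto
  have eventually_le: "l' \<le> l"
    if le: "\<And>k. \<phi> (x k) \<le> c k" and c: "c \<longlonglongrightarrow> l" and l': "(\<lambda>n. \<phi> (y n)) \<longlonglongrightarrow> l'"
      and mid: "\<And>n f g. tail_average x n f \<Longrightarrow> tail_average x n g \<Longrightarrow>
      \<phi> (\<lambda>t. (1/2) *\<^sub>R (f t + g t)) = (\<phi> f + \<phi> g) / 2"
    for \<phi> :: "(real \<Rightarrow> 'a) \<Rightarrow> real" and c l l'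
  proof (rule field_le_epsilon)
    fix e :: real assume "e > 0"
    then have "\<forall>\<^sub>F n in sequentially. c n < l + e" by (intro order_tendstoD(2)[OF c]) simp
    then obtain n0 where n0: "\<And>n. n \<ge> n0 \<Longrightarrow> c n < l + e" by (auto simp: eventually_sequentially)
    have "\<phi> (y n) \<le> l + e" if "n \<ge> n0" for n
    proof (rule tail_average_le[where \<phi> = \<phi>, OF y])
      show "\<phi> (x k) \<le> l + e" if "n \<le> k" for k
        using le[of k] n0[of k] that \<open>n \<ge> n0\<close> by simp
    qed (rule mid)
    then show "l' \<le> l + e" by (intro LIMSEQ_le_const2[OF l']) auto
  qed
  have weak: "(LINT t|lborel. z t \<bullet> W t) \<le> l"
    if W: "sq_integrable W" and le: "\<And>k. (LINT t|lborel. x k t \<bullet> W t) \<le> c k" and c: "c \<longlonglongrightarrow> l"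
    for W c l
  proof -
    have "(\<lambda>n. sqrt ((LINT t|lborel. (norm (y n t - z t))\<^sup>2) * (LINT t|lborel. (norm (W t))\<^sup>2)))
       \<longlonglongrightarrow> sqrt (0 * (LINT t|lborel. (norm (W t))\<^sup>2))"
      by (intro tendsto_intros lim(2))
    then have null: "(\<lambda>n. sqrt ((LINT t|lborel. (norm (y n t - z t))\<^sup>2) *
        (LINT t|lborel. (norm (W t))\<^sup>2))) \<longlonglongrightarrow> 0" by simp
    have bound: "norm ((LINT t|lborel. y n t \<bullet> W t) - (LINT t|lborel. z t \<bullet> W t))
       \<le> sqrt ((LINT t|lborel. (norm (y n t - z t))\<^sup>2) * (LINT t|lborel. (norm (W t))\<^sup>2))" for n
    proof -
      have "(LINT t|lborel. y n t \<bullet> W t) - (LINT t|lborel. z t \<bullet> W t)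
          = (LINT t|lborel. (y n t - z t) \<bullet> W t)"
        using sq_integrable_inner[OF ta[OF y] W, of n] sq_integrable_inner[OF z(1) W]
            by (simp add: inner_diff_left)
      then show ?thesis
        using sq_integrable_Cauchy_Schwarz[OF sq_integrable_diff[OF ta[OF y] z(1)] W, of n]
        by (simp add: real_le_rsqrt)
    qed
    have "(\<lambda>n. (LINT t|lborel. y n t \<bullet> W t) - (LINT t|lborel. z t \<bullet> W t)) \<longlonglongrightarrow> 0"
      by (rule Lim_null_comparison[OF always_eventually null]) (intro allI bound)
    then have l: "(\<lambda>n. LINT t|lborel. y n t \<bullet> W t) \<longlonglongrightarrow> (LINT t|lborel. z t \<bullet> W t)"
        by (rule LIM_zero_cancel)
    show "(LINT t|lborel. z t \<bullet> W t) \<le> l"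
    proof (rule eventually_le[of "\<lambda>f. LINT t|lborel. f t \<bullet> W t" c l, OF _ c l])
      show "(LINT t|lborel. x k t \<bullet> W t) \<le> c k" for k by (rule le)
    next
      fix n f g assume "tail_average x n f" "tail_average x n g"
      then show "(LINT t|lborel. (1/2) *\<^sub>R (f t + g t) \<bullet> W t)
          = ((LINT t|lborel. f t \<bullet> W t) + (LINT t|lborel. g t \<bullet> W t)) / 2"
        using sq_integrable_inner[OF ta W] by (simp add: inner_add_left)
    qed
  qed
  have pointwise: "AE t in lborel. \<forall>a c l. (\<forall>k. x k t \<bullet> a \<le> c k) \<longrightarrow> c \<longlonglongrightarrow> l \<longrightarrow> z t \<bullet> a \<le> l"
      using lim(1)
    proof (eventually_elim, intro allI impI)
      fix t a and c :: "nat \<Rightarrow> real" and l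
      assume t: "(\<lambda>n. y n t) \<longlonglongrightarrow> z t" and le: "\<forall>k. x k t \<bullet> a \<le> c k" and c: "c \<longlonglongrightarrow> l"
      show "z t \<bullet> a \<le> l"
      proof (rule eventually_le[of "\<lambda>f. f t \<bullet> a" c l])
        show "x k t \<bullet> a \<le> c k" for k using le by simp
        show "(\<lambda>n. y n t \<bullet> a) \<longlonglongrightarrow> z t \<bullet> a" by (intro tendsto_inner t tendsto_const)
      qed (simp_all add: c inner_add_left)
    qed
  show ?thesis
  proof (rule that)
    show "sq_integrable z" by (rule z(1))
    show "z t = 0" if "t \<notin> {0<..T}" for t using that by (rule z(2))
    show "(LINT t|lborel. z t \<bullet> W t) \<le> l"
      if "sq_integrable W" "\<And>k. (LINT t|lborel. x k t \<bullet> W t) \<le> c k" "c \<longlonglongrightarrow> l" for W c l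
      using that by (rule weak)
  qed (rule pointwise)
qed


section \<open>Moreau envelopes and the explicit Euler scheme\<close>

text \<open>Convexity of \<open>x \<mapsto> E x + L * (norm x)\<^sup>2\<close>, written as an inequality along segments.\<close>

definition semiconvex :: "real \<Rightarrow> ('a::real_inner \<Rightarrow> real) \<Rightarrow> bool" where
  "semiconvex L E \<longleftrightarrow> (\<forall>x z s. 0 \<le> s \<longrightarrow> s \<le> 1 \<longrightarrow>
     E (x + s *\<^sub>R (z - x)) \<le> (1 - s) * E x + s * E z + L * (s * (1 - s) * (norm (z - x))\<^sup>2))"

text \<open>Subgradients of a function that is semiconvex with constant \<open>L\<close>; for \<open>L = 0\<close> these are the
  subgradients of convex analysis.\<close>

definition semiconvex_subdifferential :: "real \<Rightarrow> ('a::real_inner \<Rightarrow> real) \<Rightarrow> 'a \<Rightarrow> 'a set" where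
  "semiconvex_subdifferential L E x = {\<eta>. \<forall>z. \<eta> \<bullet> (z - x) \<le> E z - E x + L * (norm (z - x))\<^sup>2}"

text \<open>Some minimiser of \<open>z \<mapsto> E z + (norm (z - x))\<^sup>2 / (2 * l)\<close>; it need not be unique when \<open>E\<close> is not
  convex.\<close>

definition prox :: "('a::real_inner \<Rightarrow> real) \<Rightarrow> real \<Rightarrow> 'a \<Rightarrow> 'a" where
  "prox E l x = (SOME p. \<forall>z. E p + (norm (p - x))\<^sup>2 / (2 * l) \<le> E z + (norm (z - x))\<^sup>2 / (2 * l))"

text \<open>The Moreau envelope of \<open>E\<close> with parameter \<open>l\<close>.\<close>

definition moreau :: "('a::real_inner \<Rightarrow> real) \<Rightarrow> real \<Rightarrow> 'a \<Rightarrow> real" where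
  "moreau E l x = E (prox E l x) + (norm (prox E l x - x))\<^sup>2 / (2 * l)"

text \<open>The Yosida approximation.  For convex \<open>E\<close> it is the gradient of the Moreau envelope; below it is
  used without any differentiability, through the descent inequality \<open>moreau_descent\<close>.\<close>

definition moreau_grad :: "('a::real_inner \<Rightarrow> real) \<Rightarrow> real \<Rightarrow> 'a \<Rightarrow> 'a" where
  "moreau_grad E l x = (1 / l) *\<^sub>R (x - prox E l x)"

lemma prox_exists:
  fixes E :: "'a::euclidean_space \<Rightarrow> real"
  assumes E: "continuous_on UNIV E" and m: "\<And>z. m \<le> E z" and l: "0 < l"
  shows "\<exists>p. \<forall>z. E p + (norm (p - x))\<^sup>2 / (2 * l) \<le> E z + (norm (z - x))\<^sup>2 / (2 * l)"
proof -
  define F where "F z = E z + (norm (z - x))\<^sup>2 / (2 * l)" for z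
  define R where "R = sqrt (2 * l * (E x - m))"
  have R: "0 \<le> R" "R\<^sup>2 = 2 * l * (E x - m)" using m[of x] l by (auto simp: R_def)
  have "continuous_on (cball x R) F" unfolding F_def
    using l by (intro continuous_intros continuous_on_subset[OF E]) auto
  then obtain p where p: "p \<in> cball x R" "\<And>z. z \<in> cball x R \<Longrightarrow> F p \<le> F z"
    using continuous_attains_inf[of "cball x R" F] R(1) by auto
  have "F p \<le> F z" for z
  proof (cases "z \<in> cball x R")
    case False
    then have "R \<le> norm (z - x)" by (simp add: dist_norm norm_minus_commute)
    then have "R\<^sup>2 \<le> (norm (z - x))\<^sup>2" using R(1) by (intro power_mono)
    then have "E x - m \<le> (norm (z - x))\<^sup>2 / (2 * l)" using l by (simp add: R(2) field_simps)
    then have "F x \<le> F z" using m[of z] by (simp add: F_def)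
    moreover have "F p \<le> F x" using p(2)[of x] R(1) by simp
    ultimately show ?thesis by linarith
  qed (rule p(2))
  then show ?thesis unfolding F_def by blast
qed

lemma moreau_le:
  fixes E :: "'a::euclidean_space \<Rightarrow> real"
  assumes "continuous_on UNIV E" "\<And>z. m \<le> E z" "0 < l"
  shows "moreau E l x \<le> E z + (norm (z - x))\<^sup>2 / (2 * l)"
  using someI_ex[OF prox_exists[OF assms, of x]] by (simp add: moreau_def prox_def)

lemma prox_eq: "0 < l \<Longrightarrow> x - prox E l x = l *\<^sub>R moreau_grad E l x"
  by (simp add: moreau_grad_def)

text \<open>The envelope at \<open>y\<close> is estimated by using the proximal point of \<open>x\<close> as a competitor, so neither
  convexity nor differentiability enters.\<close>

lemma moreau_descent:
  fixes E :: "'a::euclidean_space \<Rightarrow> real"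
  assumes "continuous_on UNIV E" "\<And>z. m \<le> E z" "0 < l"
  shows "moreau E l y \<le> moreau E l x + moreau_grad E l x \<bullet> (y - x) + 1 / (2 * l) * (norm (y - x))\<^sup>2"
proof -
  define p where "p = prox E l x"
  have "(norm (p - y))\<^sup>2 = (norm (p - x))\<^sup>2 + 2 * ((x - p) \<bullet> (y - x)) + (norm (y - x))\<^sup>2"
    by (simp add: power2_norm_eq_inner inner_add inner_diff inner_commute)
  then have "(norm (p - y))\<^sup>2 / (2 * l)
      = (norm (p - x))\<^sup>2 / (2 * l) + (1 / l) * ((x - p) \<bullet> (y - x)) + 1 / (2 * l) * (norm (y - x))\<^sup>2"
    using assms(3) by (simp add: add_divide_distrib)
  then show ?thesis
    using moreau_le[OF assms, of y p] by (simp add: moreau_def moreau_grad_def p_def)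
qed

lemma moreau_grad_subdifferential:
  fixes E :: "'a::euclidean_space \<Rightarrow> real"
  assumes E: "continuous_on UNIV E" "\<And>z. m \<le> E z" "0 < l" and sc: "semiconvex L E" and L: "0 \<le> L"
  shows "moreau_grad E l x \<in> semiconvex_subdifferential L E (prox E l x)"
  unfolding semiconvex_subdifferential_def
proof (intro CollectI allI)
  fix z
  define p where "p = prox E l x"
  define G where "G = moreau_grad E l x"
  define D where "D = (norm (z - p))\<^sup>2"
  have *: "G \<bullet> (z - p) \<le> E z - E p + L * D + s * (D / (2 * l))" if s: "0 < s" "s \<le> 1" for s
  proof -
    define y where "y = p + s *\<^sub>R (z - p)"
    have "(norm (y - x))\<^sup>2 = (norm (p - x))\<^sup>2 + 2 * (s * ((p - x) \<bullet> (z - p))) + s * s * D"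
      unfolding y_def D_def by (simp add: power2_norm_eq_inner inner_add inner_diff inner_commute
          algebra_simps)
    then have "(norm (y - x))\<^sup>2 / (2 * l)
        = (norm (p - x))\<^sup>2 / (2 * l) + (1 / l) * (s * ((p - x) \<bullet> (z - p))) + s * (s * (D / (2 * l)))"
      using E(3) by (simp add: add_divide_distrib)
    moreover have "(1 / l) * (s * ((p - x) \<bullet> (z - p))) = - (s * (G \<bullet> (z - p)))"
      by (simp add: G_def moreau_grad_def p_def inner_diff algebra_simps diff_divide_distrib)
    moreover have "E p + (norm (p - x))\<^sup>2 / (2 * l) \<le> E y + (norm (y - x))\<^sup>2 / (2 * l)"
      using moreau_le[OF E, of x y] by (simp add: moreau_def p_def)
    moreover have "E y \<le> (1 - s) * E p + s * E z + L * (s * (1 - s) * D)"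
      using sc s unfolding semiconvex_def y_def D_def by simp
    moreover have "(1 - s) * E p + s * E z + L * (s * (1 - s) * D) \<le> E p + s * (E z - E p + L * D)"
      using L s by (simp add: algebra_simps D_def)
    ultimately have "s * (G \<bullet> (z - p)) \<le> s * (E z - E p + L * D) + s * (s * (D / (2 * l)))"
      by linarith
    then have "s * (G \<bullet> (z - p)) \<le> s * (E z - E p + L * D + s * (D / (2 * l)))"
      by (simp only: distrib_left)
    then show ?thesis using s by simp
  qed
  have "((\<lambda>s. E z - E p + L * D + s * (D / (2 * l))) \<longlongrightarrow> E z - E p + L * D + 0 * (D / (2 * l)))
      (at_right 0)"
    by (intro tendsto_intros)
  moreover have "\<forall>\<^sub>F s in at_right 0. G \<bullet> (z - p) \<le> E z - E p + L * D + s * (D / (2 * l))"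
    using eventually_at_right_real[OF zero_less_one]
  proof eventually_elim
    case (elim s)
    then show ?case using *[of s] by simp
  qed
  ultimately have "G \<bullet> (z - p) \<le> E z - E p + L * D + 0 * (D / (2 * l))"
    by (intro tendsto_lowerbound) auto
  then show "moreau_grad E l x \<bullet> (z - prox E l x)
      \<le> E z - E (prox E l x) + L * (norm (z - prox E l x))\<^sup>2"
    by (simp add: G_def p_def D_def)
qed

text \<open>Cocoercivity (inverse strong monotonicity) with constant \<open>\<tau>\<close>.\<close>

definition cocoercive :: "real \<Rightarrow> ('a::real_inner \<Rightarrow> 'a) \<Rightarrow> bool" where
  "cocoercive \<tau> A \<longleftrightarrow> (\<forall>x y. \<tau> * (norm (A x - A y))\<^sup>2 \<le> (A x - A y) \<bullet> (x - y))"

lemma cocoercive_norm_le: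
  assumes "cocoercive \<tau> A" "0 < \<tau>"
  shows "norm (A x - A y) \<le> norm (x - y) / \<tau>"
proof (cases "A x = A y")
  case False
  have "\<tau> * (norm (A x - A y))\<^sup>2 \<le> norm (A x - A y) * norm (x - y)"
    using assms(1) norm_cauchy_schwarz[of "A x - A y" "x - y"] unfolding cocoercive_def
        by (meson order_trans)
  then have "norm (A x - A y) * (\<tau> * norm (A x - A y)) \<le> norm (A x - A y) * norm (x - y)"
    by (simp add: power2_eq_square algebra_simps)
  then have "\<tau> * norm (A x - A y) \<le> norm (x - y)" using False by simp
  then show ?thesis using assms(2) by (simp add: field_simps)
qed (use assms in simp)

lemma cocoercive_continuous:
  fixes A :: "'a::real_inner \<Rightarrow> 'a"
  assumes "cocoercive \<tau> A" "0 < \<tau>"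
  shows "continuous_on UNIV A"
proof (rule lipschitz_on_continuous_on[of "1 / \<tau>"])
  show "(1/\<tau>)-lipschitz_on UNIV A"
    using cocoercive_norm_le[OF assms] assms(2) by (intro lipschitz_onI) (auto simp: dist_norm)
qed

text \<open>The explicit Euler scheme for \<open>u' = - A (G u - f)\<close> with step \<open>T / N\<close>, where \<open>G\<close> is frozen at the
  grid points and \<open>f\<close> is not discretised.  The function \<open>v\<close> is the derivative of the resulting
  trajectory and \<open>w\<close> is the piecewise constant interpolation of its values on the grid.  Cocoercivity
  of \<open>A\<close> gives dissipation \<open>\<tau> * (norm v)\<^sup>2\<close>, which absorbs the quadratic error of the descent
  inequality as soon as \<open>K * (T / N) \<le> \<tau> / 4\<close>.\<close>

lemma explicit_scheme:
  fixes A G :: "'a::euclidean_space \<Rightarrow> 'a" and F :: "'a \<Rightarrow> real" and f :: "real \<Rightarrow> 'a"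
  assumes A: "cocoercive \<tau> A" "A 0 = 0" and \<tau>: "0 < \<tau>"
    and descent: "\<And>x y. F y \<le> F x + G x \<bullet> (y - x) + K * (norm (y - x))\<^sup>2"
    and f: "sq_integrable f" and T: "0 < T" and N: "0 < N" and K: "0 \<le> K" "K * (T / real N) \<le> \<tau> / 4"
  obtains v w where "sq_integrable v" "\<And>t. v t = (if t \<in> {0<..T} then - A (G (w t) - f t) else 0)"
    "(\<lambda>t. G (w t)) \<in> borel_measurable borel"
    "\<And>t. t \<in> {0<..T} \<Longrightarrow> \<exists>s. 0 \<le> s \<and> s \<le> t \<and> t - s \<le> T / real N \<and> w t = u0 + primitive v s"
    "\<And>t. t \<in> {0<..T} \<Longrightarrow> F (w t) \<le> F u0 + (LINT r|lborel. (norm (f r))\<^sup>2) / \<tau>"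
    "F (u0 + primitive v T) + \<tau> / 2 * (LINT r|lborel. (norm (v r))\<^sup>2)
        \<le> F u0 + (LINT r|lborel. (norm (f r))\<^sup>2) / \<tau>"
    "F (u0 + primitive v T) - F u0 \<le> (LINT r|lborel. v r \<bullet> G (w r))
        + K * (T / real N) * (LINT r|lborel. (norm (v r))\<^sup>2)"
proof -
  define h where "h = T / real N"
  have h: "0 < h" "real N * h = T" using T N by (auto simp: h_def)
  define tt where "tt j = real j * h" for j
  define x where "x = rec_nat u0 (\<lambda>j z. z + (LINT s:{tt j<..tt (Suc j)}|lborel. - A (G z - f s)))"
  have x0: "x 0 = u0" and xS: "\<And>j. x (Suc j)
      = x j + (LINT s:{tt j<..tt (Suc j)}|lborel. - A (G (x j) - f s))"
    by (simp_all add: x_def)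
  define idx where "idx t = nat (\<lceil>t / h\<rceil> - 1)" for t
  have idx: "idx t = j" if "t \<in> {tt j<..tt (Suc j)}" for t j
  proof -
    have "\<lceil>t / h\<rceil> = int (Suc j)"
      using that h(1) by (intro ceiling_unique) (auto simp: tt_def field_simps)
    then show ?thesis by (simp add: idx_def)
  qed
  define w where "w t = x (idx t)" for t
  define v where "v t = (if t \<in> {0<..T} then - A (G (w t) - f t) else 0)" for t
  have tt_mono: "tt i \<le> tt j" if "i \<le> j" for i j using that h(1) by (simp add: tt_def)
  have ttN: "tt N = T" and tt0: "tt 0 = 0" using h by (simp_all add: tt_def)
  have cover: "\<exists>j<N. t \<in> {tt j<..tt (Suc j)}" if t: "t \<in> {0<..T}" for t
  proof -
    define i where "i = \<lceil>t / h\<rceil>"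
    have i: "of_int i - 1 < t / h" "t / h \<le> of_int i" unfolding i_def by linarith+
    have "0 < t / h" "t / h \<le> real N" using t h by (auto simp: field_simps)
    then have "1 \<le> i" "i \<le> int N" unfolding i_def by linarith+
    then obtain j where j: "i = int (Suc j)" "j < N"
        by (metis Suc_diff_1 le_eq_less_or_eq less_Suc_eq_le nat_le_iff of_nat_0_less_iff of_nat_1
        int_nat_eq nat_int not_one_le_zero zero_less_one order_less_le_trans zero_less_nat_eq
        Suc_le_lessD of_nat_Suc zless_nat_conj nat_0_iff)
    have "t \<in> {tt j<..tt (Suc j)}" using i h(1) unfolding j(1) by (auto simp: tt_def field_simps)
    with j(2) show ?thesis by blast
  qed
  note [measurable] = sq_integrable_measurable[OF f]
      borel_measurable_continuous_onI[OF cocoercive_continuous[OF A(1) \<tau>]]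
  have idxm [measurable]: "idx \<in> measurable borel (count_space UNIV)"
    unfolding idx_def by measurable
  have Gwm [measurable]: "(\<lambda>t. G (w t)) \<in> borel_measurable borel"
    unfolding w_def by (rule measurable_compose[OF idxm]) simp
  have vm [measurable]: "v \<in> borel_measurable borel" unfolding v_def by measurable
  have v0: "v t = 0" if "t \<notin> {0<..T}" for t using that unfolding v_def by (rule if_not_P)
  define B where "B = (\<Sum>j<N. norm (G (x j)))"
  have B: "norm (G (w t)) \<le> B" if t: "t \<in> {0<..T}" for t
  proof -
    obtain j where j: "j < N" "t \<in> {tt j<..tt (Suc j)}" using cover[OF t] by blast
    have "norm (G (x j)) \<le> B" unfolding B_def by (rule member_le_sum) (use j in auto)
    then show ?thesis using idx[OF j(2)] by (simp add: w_def)
  qed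
  have Ale: "norm (A y) \<le> norm y / \<tau>" for y using cocoercive_norm_le[OF A(1) \<tau>, of y 0] A(2) by simp
  have if2: "integrable lborel (\<lambda>t. (norm (f t))\<^sup>2)" using f by (simp add: sq_integrable_def)
  have vsq: "sq_integrable v"
  proof (rule sq_integrable_bound[OF vm, of "\<lambda>t. (2 * B\<^sup>2 / \<tau>\<^sup>2) * indicator {0<..T} t
      + (2 / \<tau>\<^sup>2) * (norm (f t))\<^sup>2"])
    show "integrable lborel (\<lambda>t. (2 * B\<^sup>2 / \<tau>\<^sup>2) * indicator {0<..T} t + (2 / \<tau>\<^sup>2) * (norm (f t))\<^sup>2)"
      using T if2 by (intro Bochner_Integration.integrable_add integrable_mult_right) auto
    fix t
    show "(norm (v t))\<^sup>2 \<le> (2 * B\<^sup>2 / \<tau>\<^sup>2) * indicator {0<..T} t + (2 / \<tau>\<^sup>2) * (norm (f t))\<^sup>2"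
    proof (cases "t \<in> {0<..T}")
      case True
      have "(norm (v t))\<^sup>2 \<le> (norm (G (w t) - f t) / \<tau>)\<^sup>2"
        using Ale[of "G (w t) - f t"] True by (intro power_mono) (auto simp: v_def)
      also have "\<dots> = (norm (G (w t) + (- f t)))\<^sup>2 / \<tau>\<^sup>2" by (simp add: power_divide)
      also have "\<dots> \<le> (2 * B\<^sup>2 + 2 * (norm (f t))\<^sup>2) / \<tau>\<^sup>2"
      proof (intro divide_right_mono)
        have "(norm (G (w t)))\<^sup>2 \<le> B\<^sup>2" using B[OF True] by (intro power_mono) auto
        then show "(norm (G (w t) + (- f t)))\<^sup>2 \<le> 2 * B\<^sup>2 + 2 * (norm (f t))\<^sup>2"
          using norm_add_sq_le[of "G (w t)" "- f t"] by simp
      qed simp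
      finally show ?thesis using True by (simp add: add_divide_distrib)
    qed (simp add: v0)
  qed
  have vint: "integrable lborel v" using sq_integrable_imp_integrable[OF vsq v0] .
  have vint2: "integrable lborel (\<lambda>t. (norm (v t))\<^sup>2)" using vsq by (simp add: sq_integrable_def)
  have vGint: "integrable lborel (\<lambda>t. v t \<bullet> G (w t))"
  proof (rule Bochner_Integration.integrable_bound[OF
      integrable_mult_right[OF integrable_norm[OF vint], of B]])
    show "AE t in lborel. norm (v t \<bullet> G (w t)) \<le> norm (B * norm (v t))"
    proof (intro AE_I2)
      fix t
      show "norm (v t \<bullet> G (w t)) \<le> norm (B * norm (v t))"
      proof (cases "t \<in> {0<..T}")
        case True
        have "\<bar>v t \<bullet> G (w t)\<bar> \<le> norm (v t) * norm (G (w t))" by (rule Cauchy_Schwarz_ineq2)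
        also have "\<dots> \<le> norm (v t) * B" using B[OF True] by (intro mult_left_mono) auto
        finally show ?thesis by (simp add: mult.commute)
      qed (simp add: v0)
    qed
  qed measurable
  define P1 where "P1 = primitive (\<lambda>t. v t \<bullet> G (w t))"
  define P2 where "P2 = primitive (\<lambda>t. (norm (v t))\<^sup>2)"
  define P3 where "P3 = primitive (\<lambda>t. (norm (f t))\<^sup>2)"
  have sub: "{tt j<..tt (Suc j)} \<subseteq> {0<..T}" if "j < N" for j
    using tt_mono[of 0 j] tt_mono[of "Suc j" N] that by (auto simp: tt0 ttN)
  have ttS: "tt j \<le> tt (Suc j)" "tt (Suc j) - tt j = h" for j using h(1)
      by (auto simp: tt_def algebra_simps)
  have dv: "primitive v (tt (Suc j)) - primitive v (tt j) = x (Suc j) - x j" if "j < N" for j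
  proof -
    have "primitive v (tt (Suc j)) - primitive v (tt j) = (LINT s:{tt j<..tt (Suc j)}|lborel. v s)"
      by (rule primitive_diff[OF vint ttS(1)])
    also have "\<dots> = (LINT s:{tt j<..tt (Suc j)}|lborel. - A (G (x j) - f s))"
      unfolding set_lebesgue_integral_def
    proof (intro Bochner_Integration.integral_cong refl)
      fix s
      show "indicator {tt j<..tt (Suc j)} s *\<^sub>R v s
          = indicator {tt j<..tt (Suc j)} s *\<^sub>R - A (G (x j) - f s)"
        using idx[of s j] sub[OF that] by (auto simp: v_def w_def indicator_def)
    qed
    finally show ?thesis by (simp add: xS)
  qed
  have pv0: "primitive v 0 = 0" by (rule primitive_outside[of T]; use v0 in auto)
  have px: "j \<le> N \<Longrightarrow> u0 + primitive v (tt j) = x j" for j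
  proof (induction j)
    case (Suc j)
    then have IH: "x j = u0 + primitive v (tt j)" by simp
    have "primitive v (tt (Suc j)) = x (Suc j) - x j + primitive v (tt j)"
      using dv[of j] Suc.prems by (simp add: diff_eq_eq)
    then show ?case by (simp add: IH)
  qed (simp add: x0 tt0 pv0)
  have step: "F (x (Suc j)) - F (x j)
      \<le> (P1 (tt (Suc j)) - P1 (tt j)) + K * h * (P2 (tt (Suc j)) - P2 (tt j))"
    if j: "j < N" for j
  proof -
    have "G (x j) \<bullet> (x (Suc j) - x j)
        = G (x j) \<bullet> (LINT s|lborel. indicator {tt j<..tt (Suc j)} s *\<^sub>R v s)"
      using dv[OF j] primitive_diff[OF vint ttS(1), of j] by (simp add: set_lebesgue_integral_def)
    also have "\<dots> = (LINT s|lborel. G (x j) \<bullet> (indicator {tt j<..tt (Suc j)} s *\<^sub>R v s))"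
      using set_integrable_of_integrable[OF vint, of "{tt j<..tt (Suc j)}"]
          by (intro integral_inner_right[symmetric]) (simp add: set_integrable_def)
    also have "\<dots> = (LINT s:{tt j<..tt (Suc j)}|lborel. v s \<bullet> G (w s))"
      unfolding set_lebesgue_integral_def
      using idx[of _ j] by (intro Bochner_Integration.integral_cong refl)
          (auto simp: w_def indicator_def inner_commute)
    also have "\<dots> = P1 (tt (Suc j)) - P1 (tt j)"
      unfolding P1_def by (rule primitive_diff[OF vGint ttS(1), symmetric])
    finally have 1: "G (x j) \<bullet> (x (Suc j) - x j) = P1 (tt (Suc j)) - P1 (tt j)" .
    have "(norm (x (Suc j) - x j))\<^sup>2 \<le> h * (P2 (tt (Suc j)) - P2 (tt j))"
      using primitive_increment_sq[OF vsq vint ttS(1), of j] dv[OF j] by (simp add: ttS P2_def)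
    then have "K * (norm (x (Suc j) - x j))\<^sup>2 \<le> K * (h * (P2 (tt (Suc j)) - P2 (tt j)))"
      using K(1) by (rule mult_left_mono)
    then show ?thesis using descent[of "x (Suc j)" "x j"] 1 by (simp add: mult.assoc)
  qed
  have P2mono: "P2 s \<le> P2 t" if "s \<le> t" for s t
    unfolding P2_def by (rule primitive_nonneg_mono(1)[OF vint2 _ that]) simp
  have ptw: "v t \<bullet> G (w t) \<le> - (3 * \<tau> / 4) * (norm (v t))\<^sup>2 + (1 / \<tau>) * (norm (f t))\<^sup>2" for t
  proof (cases "t \<in> {0<..T}")
    case True
    define y where "y = G (w t) - f t"
    have v: "v t = - A y" using True by (simp add: v_def y_def)
    have "\<tau> * (norm (A y - A 0))\<^sup>2 \<le> (A y - A 0) \<bullet> (y - 0)" using A(1) unfolding cocoercive_def by blast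
    then have "v t \<bullet> y \<le> - \<tau> * (norm (v t))\<^sup>2" by (simp add: A(2) v)
    moreover have "v t \<bullet> G (w t) = v t \<bullet> y + v t \<bullet> f t" by (simp add: y_def inner_diff_right)
    moreover have "v t \<bullet> f t \<le> (\<tau> / 4) * (norm (v t))\<^sup>2 + (1 / \<tau>) * (norm (f t))\<^sup>2"
    proof -
      have "(norm (\<tau> *\<^sub>R v t - 2 *\<^sub>R f t))\<^sup>2
          = \<tau>\<^sup>2 * (norm (v t))\<^sup>2 - 4 * \<tau> * (v t \<bullet> f t) + 4 * (norm (f t))\<^sup>2"
        unfolding power2_norm_eq_inner
        by (simp add: inner_diff inner_commute power2_eq_square algebra_simps)
      then have "4 * \<tau> * (v t \<bullet> f t) \<le> \<tau>\<^sup>2 * (norm (v t))\<^sup>2 + 4 * (norm (f t))\<^sup>2"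
        using zero_le_power2[of "norm (\<tau> *\<^sub>R v t - 2 *\<^sub>R f t)"] by linarith
      also have "\<dots> = 4 * \<tau> * ((\<tau> / 4) * (norm (v t))\<^sup>2 + (1 / \<tau>) * (norm (f t))\<^sup>2)"
        using \<tau> by (simp add: distrib_left power2_eq_square)
      finally have "4 * \<tau> * (v t \<bullet> f t)
          \<le> 4 * \<tau> * ((\<tau> / 4) * (norm (v t))\<^sup>2 + (1 / \<tau>) * (norm (f t))\<^sup>2)" .
      then show ?thesis using \<tau> by simp
    qed
    ultimately show ?thesis by (simp add: algebra_simps)
  next
    case False
    then show ?thesis using \<tau> by (simp add: v0)
  qed
  have P1le: "P1 t - P1 s \<le> - (3 * \<tau> / 4) * (P2 t - P2 s) + (1 / \<tau>) * (P3 t - P3 s)" if "s \<le> t" for s t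
  proof -
    have i: "integrable lborel (\<lambda>r. indicator {s<..t} r * g r)" if "integrable lborel g"
        for g :: "real \<Rightarrow> real"
      using set_integrable_of_integrable[OF that, of "{s<..t}"] by (simp add: set_integrable_def)
    have "P1 t - P1 s = (LINT r|lborel. indicator {s<..t} r * (v r \<bullet> G (w r)))"
      unfolding P1_def primitive_diff[OF vGint that] by (simp add: set_lebesgue_integral_def)
    also have "\<dots> \<le> (LINT r|lborel. - (3 * \<tau> / 4) * (indicator {s<..t} r * (norm (v r))\<^sup>2)
        + (1 / \<tau>) * (indicator {s<..t} r * (norm (f r))\<^sup>2))"
      by (intro Bochner_Integration.integral_mono Bochner_Integration.integrable_add
          integrable_mult_right i vGint vint2 if2)
        (use ptw in \<open>auto simp: indicator_def\<close>)
    also have "\<dots> = - (3 * \<tau> / 4) * (LINT r|lborel. indicator {s<..t} r * (norm (v r))\<^sup>2)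
        + (1 / \<tau>) * (LINT r|lborel. indicator {s<..t} r * (norm (f r))\<^sup>2)"
      by (subst Bochner_Integration.integral_add) (intro integrable_mult_right i vint2 if2 | simp)+
    also have "\<dots> = - (3 * \<tau> / 4) * (P2 t - P2 s) + (1 / \<tau>) * (P3 t - P3 s)"
      unfolding P2_def P3_def primitive_diff[OF vint2 that] primitive_diff[OF if2 that]
          by (simp add: set_lebesgue_integral_def)
    finally show ?thesis .
  qed
  have zero: "P1 0 = 0" "P2 0 = 0" unfolding P1_def P2_def
      by (rule primitive_outside[of T]; use v0 in auto)+
  have PT: "P1 T = (LINT r|lborel. v r \<bullet> G (w r))" "P2 T = (LINT r|lborel. (norm (v r))\<^sup>2)"
    unfolding P1_def P2_def by (rule primitive_outside[of T]; use v0 in auto)+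
  have P3: "0 \<le> P3 t" "P3 t \<le> (LINT r|lborel. (norm (f r))\<^sup>2)" for t
    unfolding P3_def by (rule primitive_nonneg_mono[OF if2]; simp)+
  have Kh: "K * h \<le> \<tau> / 4" using K(2) by (simp add: h_def)
  have E1: "j \<le> N \<Longrightarrow> F (x j) - F u0 \<le> P1 (tt j) + K * h * P2 (tt j)" for j
  proof (induction j)
    case (Suc j)
    then show ?case using step[of j] by (simp add: algebra_simps)
  qed (simp add: x0 tt0 zero)
  have E2: "j \<le> N \<Longrightarrow> F (x j) + \<tau> / 2 * P2 (tt j) \<le> F u0 + (1 / \<tau>) * P3 (tt j)" for j
  proof (induction j)
    case 0
    then show ?case using P3(1)[of 0] \<tau> by (simp add: x0 tt0 zero)
  next
    case (Suc j)
    have Kd: "K * h * (P2 (tt (Suc j)) - P2 (tt j)) \<le> \<tau> / 4 * (P2 (tt (Suc j)) - P2 (tt j))"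
      using Kh P2mono[OF ttS(1), of j] by (intro mult_right_mono) auto
    have "F (x (Suc j)) - F (x j) \<le> - (\<tau> / 2) * (P2 (tt (Suc j)) - P2 (tt j))
        + (1 / \<tau>) * (P3 (tt (Suc j)) - P3 (tt j))"
    proof -
      have "- (3 * \<tau> / 4) * d + \<tau> / 4 * d = - (\<tau> / 2) * d" for d by (simp add: algebra_simps)
      from this[of "P2 (tt (Suc j)) - P2 (tt j)"] show ?thesis
        using step[of j] P1le[OF ttS(1), of j] Suc.prems Kd by linarith
    qed
    moreover have "- (\<tau> / 2) * (P2 (tt (Suc j)) - P2 (tt j))
        = \<tau> / 2 * P2 (tt j) - \<tau> / 2 * P2 (tt (Suc j))"
      "(1 / \<tau>) * (P3 (tt (Suc j)) - P3 (tt j)) = (1 / \<tau>) * P3 (tt (Suc j)) - (1 / \<tau>) * P3 (tt j)"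
      by (simp_all add: algebra_simps)
    moreover have "F (x j) + \<tau> / 2 * P2 (tt j) \<le> F u0 + (1 / \<tau>) * P3 (tt j)" using Suc by simp
    ultimately show ?case by linarith
  qed
  have P2n: "0 \<le> P2 t" for t unfolding P2_def by (rule primitive_nonneg_mono(2)[OF vint2]) simp
  have fle: "(1 / \<tau>) * P3 t \<le> (LINT r|lborel. (norm (f r))\<^sup>2) / \<tau>" for t
    using P3(2)[of t] \<tau> by (simp add: divide_right_mono)
  show ?thesis
  proof (rule that[of v w])
    show "v t = (if t \<in> {0<..T} then - A (G (w t) - f t) else 0)" for t by (rule v_def)
    fix t assume t: "t \<in> {0<..T}"
    obtain j where j: "j < N" "t \<in> {tt j<..tt (Suc j)}" using cover[OF t] by blast
    have w: "w t = x j" using idx[OF j(2)] by (simp add: w_def)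
    show "\<exists>s. 0 \<le> s \<and> s \<le> t \<and> t - s \<le> T / real N \<and> w t = u0 + primitive v s"
      using j ttS(2)[of j] px[of j] tt_mono[of 0 j]
          by (intro exI[of _ "tt j"]) (auto simp: w tt0 h_def[symmetric])
    have "0 \<le> \<tau> / 2 * P2 (tt j)" using P2n \<tau> by simp
    then show "F (w t) \<le> F u0 + (LINT r|lborel. (norm (f r))\<^sup>2) / \<tau>"
      using E2[of j] j(1) fle[of "tt j"] by (simp add: w)
  next
    show "F (u0 + primitive v T) + \<tau> / 2 * (LINT r|lborel. (norm (v r))\<^sup>2)
        \<le> F u0 + (LINT r|lborel. (norm (f r))\<^sup>2) / \<tau>"
      using E2[of N] fle[of T] px[of N] by (simp add: ttN PT)
    show "F (u0 + primitive v T) - F u0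
        \<le> (LINT r|lborel. v r \<bullet> G (w r)) + K * (T / real N) * (LINT r|lborel. (norm (v r))\<^sup>2)"
      using E1[of N] px[of N] by (simp add: ttN PT h_def)
  qed (use vsq Gwm in auto)
qed


section \<open>The doubly nonlinear evolution equation\<close>

lemma sq_integrable_bounded:
  assumes "v \<in> borel_measurable borel" "\<And>t. norm (v t) \<le> M" "\<And>t. t \<notin> {0<..T} \<Longrightarrow> v t = 0" "0 < T"
  shows "sq_integrable v" "(LINT t|lborel. (norm (v t))\<^sup>2) \<le> M\<^sup>2 * T"
proof -
  have le: "(norm (v t))\<^sup>2 \<le> M\<^sup>2 * indicator {0<..T} t" for t
    using assms(2)[of t] assms(3)[of t] by (cases "t \<in> {0<..T}") (auto intro: power_mono)
  have i: "integrable lborel (\<lambda>t. M\<^sup>2 * indicator {0<..T} t)" using assms(4) by simp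
  show v: "sq_integrable v" by (rule sq_integrable_bound[OF assms(1) i le])
  have "(LINT t|lborel. (norm (v t))\<^sup>2) \<le> (LINT t|lborel. M\<^sup>2 * indicator {0<..T} t)"
    by (rule Bochner_Integration.integral_mono[OF _ i le]) (use v in \<open>simp add: sq_integrable_def\<close>)
  also have "\<dots> = M\<^sup>2 * T" using assms(4) by simp
  finally show "(LINT t|lborel. (norm (v t))\<^sup>2) \<le> M\<^sup>2 * T" .
qed

lemma norm_Pair_sq: "(norm (a, b))\<^sup>2 = (norm a)\<^sup>2 + (norm b)\<^sup>2"
  by (simp add: norm_Pair)

lemma sq_integrable_Pair:
  assumes "sq_integrable v" "sq_integrable w"
  shows "sq_integrable (\<lambda>t. (v t, w t))"
    "(LINT t|lborel. (norm (v t, w t))\<^sup>2)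
        = (LINT t|lborel. (norm (v t))\<^sup>2) + (LINT t|lborel. (norm (w t))\<^sup>2)"
  using assms by (auto simp: sq_integrable_def norm_Pair_sq intro!: borel_measurable_Pair)

lemma sq_integrable_fst_snd:
  assumes "sq_integrable z"
  shows "sq_integrable (\<lambda>t. fst (z t))" "sq_integrable (\<lambda>t. snd (z t))"
proof -
  have i: "integrable lborel (\<lambda>t. (norm (z t))\<^sup>2)" and [measurable]: "z \<in> borel_measurable borel"
    using assms by (auto simp: sq_integrable_def)
  have n: "(norm (z t))\<^sup>2 = (norm (fst (z t)))\<^sup>2 + (norm (snd (z t)))\<^sup>2" for t
    by (metis norm_Pair_sq prod.collapse)
  show "sq_integrable (\<lambda>t. fst (z t))" "sq_integrable (\<lambda>t. snd (z t))"
    by (rule sq_integrable_bound[OF measurable_compose[OF \<open>z \<in> _\<close> borel_measurable_continuous_onI] i];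
        simp add: n continuous_on_fst continuous_on_snd)+
qed

lemma inner_sgn: "x \<bullet> sgn x = norm (x::'a::real_inner)"
  by (cases "x = 0") (simp_all add: sgn_div_norm power2_norm_eq_inner[symmetric] power2_eq_square)

lemma semiconvex_subdifferential_bounded:
  assumes \<eta>: "\<eta> \<in> semiconvex_subdifferential L E x" and x: "norm x \<le> R"
    and B: "\<And>z. norm z \<le> R + 1 \<Longrightarrow> \<bar>E z\<bar> \<le> B"
  shows "norm \<eta> \<le> 2 * B + \<bar>L\<bar>"
proof (cases "\<eta> = 0")
  case True
  have "0 \<le> B" using B[of x] x by linarith
  then show ?thesis using True by simp
next
  case False
  define e where "e = sgn \<eta>"
  have e: "norm e = 1" "\<eta> \<bullet> e = norm \<eta>"
    using False by (simp_all add: e_def norm_sgn inner_sgn)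
  have "\<eta> \<bullet> (x + e - x) \<le> E (x + e) - E x + L * (norm (x + e - x))\<^sup>2"
    using \<eta> unfolding semiconvex_subdifferential_def by blast
  moreover have "norm (x + e) \<le> R + 1" using norm_triangle_ineq[of x e] x e by linarith
  ultimately show ?thesis using B[of "x + e"] B[of x] x e by simp
qed

lemma prox_estimate:
  assumes "moreau E l x \<le> C" "\<And>z. m \<le> E z" "0 < l"
  shows "E (prox E l x) \<le> C" "norm (prox E l x - x) \<le> sqrt (2 * l * (C - m))"
proof -
  have "0 \<le> (norm (prox E l x - x))\<^sup>2 / (2 * l)" using assms(3) by simp
  then show "E (prox E l x) \<le> C" using assms(1) by (simp add: moreau_def)
  have "(norm (prox E l x - x))\<^sup>2 / (2 * l) \<le> C - m" using assms(1) assms(2)[of "prox E l x"]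
      by (simp add: moreau_def)
  then have "(norm (prox E l x - x))\<^sup>2 \<le> 2 * l * (C - m)" using assms(3) by (simp add: field_simps)
  then show "norm (prox E l x - x) \<le> sqrt (2 * l * (C - m))" by (rule real_le_rsqrt)
qed

text \<open>The scheme applied to the Moreau envelope with parameter \<open>\<epsilon>\<close>.  The step is chosen so small that
  the discretisation error in the energy balance is at most \<open>\<epsilon> * (C - m)\<close>, and it does not exceed
  \<open>\<epsilon>\<close>.\<close>

lemma approximate_solutions:
  fixes A :: "'a::euclidean_space \<Rightarrow> 'a" and E :: "'a \<Rightarrow> real" and f :: "real \<Rightarrow> 'a" and u0 :: 'a
  assumes E: "continuous_on UNIV E" "\<And>z. m \<le> E z"
    and A: "cocoercive \<tau> A" "A 0 = 0" and \<tau>: "0 < \<tau>"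
    and f: "sq_integrable f" and T: "0 < T" and \<epsilon>: "0 < \<epsilon>"
  defines "C \<equiv> E u0 + (LINT r|lborel. (norm (f r))\<^sup>2) / \<tau>"
  obtains v w where "sq_integrable v" "\<And>t. v t
      = (if t \<in> {0<..T} then - A (moreau_grad E \<epsilon> (w t) - f t) else 0)"
    "(\<lambda>t. moreau_grad E \<epsilon> (w t)) \<in> borel_measurable borel"
    "\<And>t. t \<in> {0<..T} \<Longrightarrow> \<exists>s. 0 \<le> s \<and> s \<le> t \<and> t - s \<le> \<epsilon> \<and> w t = u0 + primitive v s"
    "\<And>t. t \<in> {0<..T} \<Longrightarrow> moreau E \<epsilon> (w t) \<le> C" "moreau E \<epsilon> (u0 + primitive v T) \<le> C"
    "(LINT r|lborel. (norm (v r))\<^sup>2) \<le> 2 / \<tau> * (C - m)"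
    "- (LINT r|lborel. v r \<bullet> moreau_grad E \<epsilon> (w r))
        \<le> E u0 - E (prox E \<epsilon> (u0 + primitive v T)) + \<epsilon> * (C - m)"
proof -
  define K where "K = 1 / (2 * \<epsilon>)"
  have K: "0 < K" using \<epsilon> by (simp add: K_def)
  define \<delta> where "\<delta> = min \<epsilon> (min (\<tau> / (4 * K)) (\<epsilon> * \<tau> / (2 * K)))"
  have \<delta>: "0 < \<delta>" using \<epsilon> \<tau> K by (simp add: \<delta>_def)
  obtain N :: nat where N: "T / \<delta> < real N" using reals_Archimedean2 by blast
  have Npos: "0 < N" using N T \<delta> by (smt (verit) divide_pos_pos of_nat_0_less_iff)
  have TN: "T / real N \<le> \<delta>" using N \<delta> Npos by (simp add: field_simps)
  have K1: "K * (T / real N) \<le> \<tau> / 4"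
  proof -
    have "K * (T / real N) \<le> K * (\<tau> / (4 * K))" using TN K by (intro mult_left_mono) (auto simp: \<delta>_def)
    then show ?thesis using K by simp
  qed
  have K2: "K * (T / real N) \<le> \<epsilon> * \<tau> / 2"
  proof -
    have "K * (T / real N) \<le> K * (\<epsilon> * \<tau> / (2 * K))" using TN K
        by (intro mult_left_mono) (auto simp: \<delta>_def)
    then show ?thesis using K by simp
  qed
  obtain v w where v: "sq_integrable v" "\<And>t. v t
      = (if t \<in> {0<..T} then - A (moreau_grad E \<epsilon> (w t) - f t) else 0)"
    and gm: "(\<lambda>t. moreau_grad E \<epsilon> (w t)) \<in> borel_measurable borel"
    and grid: "\<And>t. t \<in> {0<..T} \<Longrightarrow> \<exists>s. 0 \<le> s \<and> s \<le> t \<and> t - s \<le> T / real N \<and> w t = u0 + primitive v s"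
    and e1: "\<And>t. t \<in> {0<..T} \<Longrightarrow> moreau E \<epsilon> (w t) \<le> moreau E \<epsilon> u0 + (LINT r|lborel. (norm (f r))\<^sup>2) / \<tau>"
    and e2: "moreau E \<epsilon> (u0 + primitive v T) + \<tau> / 2 * (LINT r|lborel. (norm (v r))\<^sup>2)
        \<le> moreau E \<epsilon> u0 + (LINT r|lborel. (norm (f r))\<^sup>2) / \<tau>"
    and e3: "moreau E \<epsilon> (u0 + primitive v T) - moreau E \<epsilon> u0
        \<le> (LINT r|lborel. v r \<bullet> moreau_grad E \<epsilon> (w r))
        + K * (T / real N) * (LINT r|lborel. (norm (v r))\<^sup>2)"
    by (rule explicit_scheme[OF A \<tau> moreau_descent[OF E \<epsilon>, folded K_def] f T Npos less_imp_le[OF K] K1,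
        of u0]) blast
  have mu0: "moreau E \<epsilon> u0 \<le> E u0" using moreau_le[OF E \<epsilon>, of u0 u0] by simp
  define V where "V = (LINT r|lborel. (norm (v r))\<^sup>2)"
  have V0: "0 \<le> V" unfolding V_def by (intro integral_nonneg_AE) auto
  have pos: "0 \<le> (norm (prox E \<epsilon> x - x))\<^sup>2 / (2 * \<epsilon>)" for x using \<epsilon> by simp
  have mm: "E (prox E \<epsilon> x) \<le> moreau E \<epsilon> x" for x unfolding moreau_def using pos[of x] by simp
  have "\<tau> / 2 * V \<le> C - m"
    using e2 mu0 mm[of "u0 + primitive v T"] E(2)[of "prox E \<epsilon> (u0 + primitive v T)"]
        unfolding V_def C_def by linarith
  then have Vle: "V \<le> 2 / \<tau> * (C - m)" using \<tau> by (simp add: field_simps)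
  show ?thesis
  proof (rule that[of v w])
    show "sq_integrable v" "\<And>t. v t = (if t \<in> {0<..T} then - A (moreau_grad E \<epsilon> (w t) - f t) else 0)"
      "(\<lambda>t. moreau_grad E \<epsilon> (w t)) \<in> borel_measurable borel" by (rule v gm)+
    show "\<exists>s. 0 \<le> s \<and> s \<le> t \<and> t - s \<le> \<epsilon> \<and> w t = u0 + primitive v s" if "t \<in> {0<..T}" for t
    proof -
      have "T / real N \<le> \<epsilon>" using TN by (simp add: \<delta>_def)
      then show ?thesis using grid[OF that] by force
    qed
    show "moreau E \<epsilon> (w t) \<le> C" if "t \<in> {0<..T}" for t using e1[OF that] mu0 by (simp add: C_def)
    have "0 \<le> \<tau> / 2 * V" using \<tau> V0 by simp
    then show "moreau E \<epsilon> (u0 + primitive v T) \<le> C" using e2 mu0 by (simp add: C_def V_def)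
    show "(LINT r|lborel. (norm (v r))\<^sup>2) \<le> 2 / \<tau> * (C - m)" using Vle by (simp add: V_def)
    have "K * (T / real N) * V \<le> \<epsilon> * \<tau> / 2 * (2 / \<tau> * (C - m))"
    proof (rule mult_mono[OF K2 Vle _ V0])
      show "0 \<le> \<epsilon> * \<tau> / 2" using \<epsilon> \<tau> by simp
    qed
    also have "\<dots> = \<epsilon> * (C - m)" using \<tau> by simp
    finally show "- (LINT r|lborel. v r \<bullet> moreau_grad E \<epsilon> (w r))
        \<le> E u0 - E (prox E \<epsilon> (u0 + primitive v T)) + \<epsilon> * (C - m)"
      using e3 mu0 mm[of "u0 + primitive v T"] by (simp add: V_def)
  qed
qed


lemma primitive_inner:
  assumes "integrable lborel v"
  shows "primitive v t \<bullet> e = (LINT s|lborel. v s \<bullet> (indicator {..t} s *\<^sub>R e))"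
proof -
  have "primitive v t \<bullet> e = (LINT s|lborel. (indicator {..t} s *\<^sub>R v s) \<bullet> e)"
    unfolding primitive_def set_lebesgue_integral_def
    using set_integrable_of_integrable[OF assms, of "{..t}"]
    by (intro integral_inner_left[symmetric]) (simp add: set_integrable_def)
  then show ?thesis by (simp add: inner_commute)
qed

lemma eq_if_inner_le: "(\<And>e. a \<bullet> e \<le> b \<bullet> e) \<Longrightarrow> a = (b::'a::real_inner)"
proof -
  assume "\<And>e. a \<bullet> e \<le> b \<bullet> e"
  from this[of "a - b"] have "(a - b) \<bullet> (a - b) \<le> 0" by (simp add: inner_diff_left)
  then have "(a - b) \<bullet> (a - b) = 0" by (intro antisym inner_ge_zero)
  then show "a = b" by simp
qed

text \<open>Existence for \<open>u' \<in> - A (\<partial>E u - f)\<close> with a single-valued cocoercive map \<open>A\<close> and a semiconvex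
  coercive energy \<open>E\<close>.  Since \<open>A\<close> is nonlinear, weak limits alone do not identify the equation.
  Cocoercivity compares the approximations \<open>(v k, \<eta> k)\<close> with the candidate \<open>vt = - A (\<eta>' - f)\<close>, and
  the only product of two weakly convergent factors, the integral of \<open>v k \<bullet> \<eta> k\<close>, is controlled by
  the energy balance along the scheme and the chain inequality in the limit.\<close>

theorem doubly_nonlinear_existence:
  fixes A :: "'a::euclidean_space \<Rightarrow> 'a" and E :: "'a \<Rightarrow> real" and f :: "real \<Rightarrow> 'a" and u0 :: 'a
  assumes E: "continuous_on UNIV E" "\<And>z. m \<le> E z" and bdd: "\<And>r. bounded {x. E x \<le> r}"
    and sc: "semiconvex L E" and L: "0 \<le> L"
    and A: "cocoercive \<tau> A" "A 0 = 0" and \<tau>: "0 < \<tau>"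
    and f: "sq_integrable f" and T: "0 < T"
  obtains v \<eta> where "sq_integrable v" "sq_integrable \<eta>" "\<And>t. t \<notin> {0<..T} \<Longrightarrow> v t = 0"
    "AE t in lborel. t \<in> {0<..<T} \<longrightarrow> \<eta> t \<in> semiconvex_subdifferential L E (u0 + primitive v t)"
    "AE t in lborel. t \<in> {0<..<T} \<longrightarrow> v t = - A (\<eta> t - f t)"
proof -
  define C where "C = E u0 + (LINT r|lborel. (norm (f r))\<^sup>2) / \<tau>"
  define Cv where "Cv = 2 / \<tau> * (C - m)"
  define l where "l n = 1 / real (Suc n)" for n
  have l: "0 < l n" for n by (simp add: l_def)
  have l0: "l \<longlonglongrightarrow> 0" unfolding l_def using lim_1_over_n[THEN LIMSEQ_Suc] by simp
  define P where "P n v w \<longleftrightarrow> sq_integrable v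
      \<and> (\<forall>t. v t = (if t \<in> {0<..T} then - A (moreau_grad E (l n) (w t) - f t) else 0))
    \<and> (\<lambda>t. moreau_grad E (l n) (w t)) \<in> borel_measurable borel
    \<and> (\<forall>t. t \<in> {0<..T} \<longrightarrow> (\<exists>s. 0 \<le> s \<and> s \<le> t \<and> t - s \<le> l n \<and> w t = u0 + primitive v s))
    \<and> (\<forall>t. t \<in> {0<..T} \<longrightarrow> moreau E (l n) (w t) \<le> C) \<and> moreau E (l n) (u0 + primitive v T) \<le> C
    \<and> (LINT r|lborel. (norm (v r))\<^sup>2) \<le> Cv
    \<and> - (LINT r|lborel. v r \<bullet> moreau_grad E (l n) (w r))
        \<le> E u0 - E (prox E (l n) (u0 + primitive v T)) + l n * (C - m)" for n v w
  have "\<exists>v w. P n v w" for n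
    unfolding P_def C_def Cv_def
    by (rule approximate_solutions[OF E A \<tau> f T l[of n], of u0]) blast
  then obtain v w where P: "\<And>n. P n (v n) (w n)" by metis
  have v: "sq_integrable (v n)" "v n t
      = (if t \<in> {0<..T} then - A (moreau_grad E (l n) (w n t) - f t) else 0)"
    and gm: "(\<lambda>t. moreau_grad E (l n) (w n t)) \<in> borel_measurable borel"
    and grid: "t \<in> {0<..T} \<Longrightarrow> \<exists>s. 0 \<le> s \<and> s \<le> t \<and> t - s \<le> l n \<and> w n t = u0 + primitive (v n) s"
    and en: "t \<in> {0<..T} \<Longrightarrow> moreau E (l n) (w n t) \<le> C" "moreau E (l n) (u0 + primitive (v n) T) \<le> C"
    and vC: "(LINT r|lborel. (norm (v n r))\<^sup>2) \<le> Cv"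
    and diss: "- (LINT r|lborel. v n r \<bullet> moreau_grad E (l n) (w n r))
        \<le> E u0 - E (prox E (l n) (u0 + primitive (v n) T)) + l n * (C - m)"
    for n t using P[of n] unfolding P_def by blast+
  have v0: "v n t = 0" if "t \<notin> {0<..T}" for n t using v(2)[of n t] that by (simp only: if_False)
  have vint: "integrable lborel (v n)" for n by (rule sq_integrable_imp_integrable[OF v(1) v0])
  have Cv: "0 \<le> Cv" by (rule order_trans[OF integral_nonneg_AE vC[of 0]]) simp
  define u where "u n t = u0 + primitive (v n) t" for n t
  have uinc: "norm (u n t - u n s) \<le> sqrt (\<bar>t - s\<bar> * Cv)" for n s t
  proof (cases "s \<le> t")
    case True
    then show ?thesis using sq_integrable_increment_sqrt[OF v(1) vint True vC] by (simp add: u_def)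
  next
    case False
    then show ?thesis using sq_integrable_increment_sqrt[OF v(1) vint _ vC, of t s]
        by (simp add: u_def norm_minus_commute)
  qed
  have pv0: "primitive (v n) 0 = 0" for n by (rule primitive_outside[of T]; use v0 in auto)

  \<comment> \<open>The trajectories are uniformly Hoelder continuous with exponent one half.\<close>
  obtain U \<kappa> where \<kappa>: "strict_mono (\<kappa> :: nat \<Rightarrow> nat)"
    and U: "\<And>e. 0 < e \<Longrightarrow> \<exists>N. \<forall>n x. n \<ge> N \<and> x \<in> {0..T} \<longrightarrow> norm (u (\<kappa> n) x - U x) < e"
  proof (rule Arzela_Ascoli[of "{0..T}" u "norm u0 + sqrt (T * Cv)"])
    show "norm (u n t) \<le> norm u0 + sqrt (T * Cv)" if "t \<in> {0..T}" for n t
    proof -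
      have "norm (u n t - u n 0) \<le> sqrt (T * Cv)"
        using uinc[of n t 0] that Cv by (auto intro!: order_trans[OF uinc] mult_right_mono)
      then show ?thesis using norm_triangle_ineq[of "u n 0" "u n t - u n 0"] by (simp add: u_def pv0)
    qed
    show "\<exists>d>0. \<forall>n y. y \<in> {0..T} \<and> norm (t - y) < d \<longrightarrow> norm (u n t - u n y) < e" if "0 < e" for t e
    proof (intro exI conjI allI impI)
      show "0 < e\<^sup>2 / (Cv + 1)" using that Cv by simp
      fix n y assume "y \<in> {0..T} \<and> norm (t - y) < e\<^sup>2 / (Cv + 1)"
      then have "\<bar>t - y\<bar> * (Cv + 1) < e\<^sup>2" using Cv by (simp add: field_simps)
      moreover have "\<bar>t - y\<bar> * Cv \<le> \<bar>t - y\<bar> * (Cv + 1)" by (intro mult_left_mono) auto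
      ultimately have "\<bar>t - y\<bar> * Cv < e\<^sup>2" by linarith
      then have "sqrt (\<bar>t - y\<bar> * Cv) < e" using that by (simp add: real_less_lsqrt Cv)
      then show "norm (u n t - u n y) < e" using uinc[of n t y] by linarith
    qed
    show "compact {0..T}" by simp
  qed (rule that)
  have Ulim: "(\<lambda>n. u (\<kappa> n) t) \<longlonglongrightarrow> U t" if "t \<in> {0..T}" for t
  proof (rule LIMSEQ_I)
    fix e :: real assume "0 < e"
    then show "\<exists>N. \<forall>n\<ge>N. norm (u (\<kappa> n) t - U t) < e" using U[of e] that by auto
  qed
  have l\<kappa>: "(\<lambda>n. l (\<kappa> n)) \<longlonglongrightarrow> 0" using LIMSEQ_subseq_LIMSEQ[OF l0 \<kappa>] by (simp add: o_def)

  \<comment> \<open>The proximal points stay in one sublevel set of \<open>E\<close>, and there subgradients are bounded.\<close>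
  obtain R where R: "\<And>x. E x \<le> C \<Longrightarrow> norm x \<le> R" using bdd[of C] by (auto simp: bounded_iff)
  have "bounded (E ` cball 0 (R + 1))"
    by (intro compact_imp_bounded compact_continuous_image continuous_on_subset[OF E(1)]) auto
  then obtain B where "\<forall>y\<in>E ` cball 0 (R + 1). norm y \<le> B" by (auto simp: bounded_iff)
  then have B: "\<bar>E z\<bar> \<le> B" if "norm z \<le> R + 1" for z using that by simp
  define M where "M = 2 * B + \<bar>L\<bar>"
  define \<eta> where "\<eta> n t = (if t \<in> {0<..T} then moreau_grad E (l n) (w n t) else 0)" for n t
  define p where "p n t = prox E (l n) (w n t)" for n t
  have \<eta>sub: "\<eta> n t \<in> semiconvex_subdifferential L E (p n t)" if "t \<in> {0<..T}" for n t
    using moreau_grad_subdifferential[OF E l sc L] that by (simp add: \<eta>_def p_def)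
  have pw: "E (p n t) \<le> C" "norm (p n t - w n t) \<le> sqrt (2 * l n * (C - m))" if "t \<in> {0<..T}" for n t
    using prox_estimate[OF en(1)[OF that] E(2) l] by (simp_all add: p_def)
  have "0 \<le> B" using B[of "p 0 T"] R[OF pw(1)[of T 0]] T by auto
  then have M: "0 \<le> M" by (simp add: M_def)
  have \<eta>M: "norm (\<eta> n t) \<le> M" for n t
  proof (cases "t \<in> {0<..T}")
    case True
    then show ?thesis unfolding M_def
      by (intro semiconvex_subdifferential_bounded[OF \<eta>sub R B]) (use pw in auto)
  qed (use M in \<open>auto simp: \<eta>_def\<close>)
  have \<eta>0: "\<eta> n t = 0" if "t \<notin> {0<..T}" for n t using that unfolding \<eta>_def by (rule if_not_P)
  have \<eta>m: "\<eta> n \<in> borel_measurable borel" for n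
  proof -
    note [measurable] = gm[of n]
    show ?thesis unfolding \<eta>_def by measurable
  qed
  note \<eta>sq = sq_integrable_bounded[OF \<eta>m \<eta>M \<eta>0 T]
  have plim: "(\<lambda>n. p (\<kappa> n) t) \<longlonglongrightarrow> U t" if t: "t \<in> {0<..T}" for t
  proof -
    have le: "norm (p n t - u n t) \<le> sqrt (2 * l n * (C - m)) + sqrt (l n * Cv)" for n
    proof -
      obtain s where s: "0 \<le> s" "s \<le> t" "t - s \<le> l n" "w n t = u n s" using grid[OF t] unfolding u_def
          by blast
      have "norm (w n t - u n t) \<le> sqrt (l n * Cv)"
        unfolding s(4) using s Cv by (intro order_trans[OF uinc] real_sqrt_le_mono mult_right_mono) auto
      then show ?thesis using norm_triangle_ineq[of "p n t - w n t" "w n t - u n t"] pw(2)[OF t, of n]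
          by simp
    qed
    have "(\<lambda>n. sqrt (2 * l (\<kappa> n) * (C - m)) + sqrt (l (\<kappa> n) * Cv))
        \<longlonglongrightarrow> sqrt (2 * 0 * (C - m)) + sqrt (0 * Cv)"
      by (intro tendsto_intros l\<kappa>)
    then have null: "(\<lambda>n. sqrt (2 * l (\<kappa> n) * (C - m)) + sqrt (l (\<kappa> n) * Cv)) \<longlonglongrightarrow> 0" by simp
    have "(\<lambda>n. p (\<kappa> n) t - u (\<kappa> n) t) \<longlonglongrightarrow> 0"
      by (rule Lim_null_comparison[OF always_eventually null]) (intro allI le)
    from tendsto_add[OF this Ulim[of t]] t show ?thesis by simp
  qed

  \<comment> \<open>Velocities and subgradients are treated as one sequence, so that the same averages serve both.\<close>
  define x where "x n t = (v (\<kappa> n) t, \<eta> (\<kappa> n) t)" for n t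
  have x: "sq_integrable (x n)" "(LINT t|lborel. (norm (x n t))\<^sup>2) \<le> Cv + M\<^sup>2 * T" for n
    unfolding x_def using sq_integrable_Pair[OF v(1) \<eta>sq(1)] vC[of "\<kappa> n"] \<eta>sq(2)[of "\<kappa> n"] by auto
  have x0: "x n t = 0" if "t \<notin> {0<..T}" for n t using v0[OF that] \<eta>0[OF that]
      by (simp add: x_def zero_prod_def)
  obtain z where z: "sq_integrable z" "\<And>t. t \<notin> {0<..T} \<Longrightarrow> z t = 0"
    and weak: "\<And>W c l. sq_integrable W \<Longrightarrow> (\<And>k. (LINT t|lborel. x k t \<bullet> W t) \<le> c k) \<Longrightarrow> c \<longlonglongrightarrow> l \<Longrightarrow>
       (LINT t|lborel. z t \<bullet> W t) \<le> l"
    and pointwise: "AE t in lborel. \<forall>a c l. (\<forall>k. x k t \<bullet> a \<le> c k) \<longrightarrow> c \<longlonglongrightarrow> l \<longrightarrow> z t \<bullet> a \<le> l"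
  proof (rule weak_limit_exists[where x = x, OF x _ T])
    show "x k t = 0" if "t \<notin> {0<..T}" for k t using that by (rule x0)
  next
    fix z
    assume "sq_integrable z" "\<And>t. t \<notin> {0<..T} \<Longrightarrow> z t = 0"
      "\<And>W c l. sq_integrable W \<Longrightarrow> (\<And>k. (LINT t|lborel. x k t \<bullet> W t) \<le> c k) \<Longrightarrow> c \<longlonglongrightarrow> l \<Longrightarrow>
         (LINT t|lborel. z t \<bullet> W t) \<le> l"
      "AE t in lborel. \<forall>a c l. (\<forall>k. x k t \<bullet> a \<le> c k) \<longrightarrow> c \<longlonglongrightarrow> l \<longrightarrow> z t \<bullet> a \<le> l"
    then show thesis by (rule that)
  qed
  define v' where "v' t = fst (z t)" for t
  \<comment> \<open>The truncation changes the limit on a null set only and makes it bounded everywhere.\<close>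
  define \<eta>' where "\<eta>' t = (if norm (snd (z t)) \<le> M then snd (z t) else 0)" for t
  have v'sq: "sq_integrable v'" unfolding v'_def by (rule sq_integrable_fst_snd[OF z(1)])
  have szsq: "sq_integrable (\<lambda>t. snd (z t))" by (rule sq_integrable_fst_snd[OF z(1)])
  have v'0: "v' t = 0" and \<eta>'0: "\<eta>' t = 0" if "t \<notin> {0<..T}" for t using z(2)[OF that]
      by (auto simp: v'_def \<eta>'_def)
  have v'int: "integrable lborel v'" by (rule sq_integrable_imp_integrable[OF v'sq v'0])
  note [measurable] = sq_integrable_measurable[OF szsq] sq_integrable_measurable[OF v'sq]
      sq_integrable_measurable[OF f]
    borel_measurable_continuous_onI[OF cocoercive_continuous[OF A(1) \<tau>]]
  have \<eta>'m [measurable]: "\<eta>' \<in> borel_measurable borel" unfolding \<eta>'_def by measurable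
  have \<eta>'M: "norm (\<eta>' t) \<le> M" for t using M by (simp add: \<eta>'_def)
  have \<eta>'sq: "sq_integrable \<eta>'" by (rule sq_integrable_bounded(1)[OF \<eta>'m \<eta>'M \<eta>'0 T])
  have \<eta>'eq: "AE t in lborel. snd (z t) = \<eta>' t"
    using pointwise
  proof eventually_elim
    case (elim t)
    have "norm (snd (z t)) \<le> M"
    proof (cases "snd (z t) = 0")
      case False
      define e where "e = sgn (snd (z t))"
      have e: "norm e = 1" "snd (z t) \<bullet> e = norm (snd (z t))"
        using False by (simp_all add: e_def norm_sgn inner_sgn)
      have "x k t \<bullet> (0, e) \<le> M" for k
        using norm_cauchy_schwarz[of "\<eta> (\<kappa> k) t" e] \<eta>M[of "\<kappa> k" t] e by (simp add: x_def)
      then have "z t \<bullet> (0, e) \<le> M" by (rule elim[rule_format, OF _ tendsto_const])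
      then show ?thesis using e by (simp add: inner_prod_def)
    qed (use M in simp)
    then show ?case by (simp add: \<eta>'_def)
  qed

  have U_eq: "U t = u0 + primitive v' t" if t: "t \<in> {0..T}" for t
  proof -
    have "primitive v' t = U t - u0"
    proof (rule eq_if_inner_le)
      fix e
      define W :: "real \<Rightarrow> 'a \<times> 'a" where "W s = (indicator ({..t} \<inter> {0<..T}) s *\<^sub>R e, 0)" for s
      have ind: "indicator ({..t} \<inter> {0<..T}) s *\<^sub>R e = (if s \<in> {..t} \<inter> {0<..T} then e else 0)" for s
        by (simp add: indicator_def)
      have W: "sq_integrable W" unfolding W_def
      proof (rule sq_integrable_bounded(1)[of _ "norm e" T])
        show "(\<lambda>s. (indicator ({..t} \<inter> {0<..T}) s *\<^sub>R e, 0::'a)) \<in> borel_measurable borel"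
          by (intro borel_measurable_Pair) measurable
      qed (use T in \<open>auto simp: norm_Pair indicator_def zero_prod_def\<close>)
      have prim: "(LINT s|lborel. g s \<bullet> (indicator ({..t} \<inter> {0<..T}) s *\<^sub>R e)) = primitive g t \<bullet> e"
        if "integrable lborel g" "\<And>s. s \<notin> {0<..T} \<Longrightarrow> g s = 0" for g
        unfolding primitive_inner[OF that(1)]
      proof (intro Bochner_Integration.integral_cong refl)
        fix s
        show "g s \<bullet> (indicator ({..t} \<inter> {0<..T}) s *\<^sub>R e) = g s \<bullet> (indicator {..t} s *\<^sub>R e)"
          using that(2)[of s] by (cases "s \<in> {0<..T}") (auto simp: indicator_def)
      qed
      have "(LINT s|lborel. z s \<bullet> W s) \<le> (U t - u0) \<bullet> e"
      proof (rule weak[OF W])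
        show "(LINT s|lborel. x k s \<bullet> W s) \<le> (u (\<kappa> k) t - u0) \<bullet> e" for k
          using prim[OF vint v0, of "\<kappa> k"] by (simp add: x_def W_def u_def)
        show "(\<lambda>k. (u (\<kappa> k) t - u0) \<bullet> e) \<longlonglongrightarrow> (U t - u0) \<bullet> e"
          by (intro tendsto_intros Ulim t)
      qed
      then show "primitive v' t \<bullet> e \<le> (U t - u0) \<bullet> e"
        using prim[OF v'int v'0] by (simp add: W_def inner_prod_def v'_def[abs_def])
    qed
    then show ?thesis by simp
  qed

  have sub': "AE t in lborel. t \<in> {0<..<T}
      \<longrightarrow> \<eta>' t \<in> semiconvex_subdifferential L E (u0 + primitive v' t)"
    using pointwise \<eta>'eq
  proof eventually_elim
    case (elim t)
    show ?case unfolding semiconvex_subdifferential_def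
    proof (intro impI CollectI allI)
      fix y assume t: "t \<in> {0<..<T}"
      then have t': "t \<in> {0<..T}" "t \<in> {0..T}" by auto
      have le: "x k t \<bullet> (0, y - U t) \<le> E y - E (p (\<kappa> k) t) + L * (norm (y - p (\<kappa> k) t))\<^sup>2
          + M * norm (p (\<kappa> k) t - U t)" for k
      proof -
        have "\<eta> (\<kappa> k) t \<bullet> (y - p (\<kappa> k) t) \<le> E y - E (p (\<kappa> k) t) + L * (norm (y - p (\<kappa> k) t))\<^sup>2"
          using \<eta>sub[OF t'(1)] unfolding semiconvex_subdifferential_def by blast
        moreover have "\<eta> (\<kappa> k) t \<bullet> (p (\<kappa> k) t - U t) \<le> M * norm (p (\<kappa> k) t - U t)"
          by (rule order_trans[OF norm_cauchy_schwarz]) (intro mult_right_mono \<eta>M norm_ge_zero)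
        moreover have "\<eta> (\<kappa> k) t \<bullet> (y - U t)
            = \<eta> (\<kappa> k) t \<bullet> (y - p (\<kappa> k) t) + \<eta> (\<kappa> k) t \<bullet> (p (\<kappa> k) t - U t)"
          by (simp add: inner_diff_right)
        ultimately show ?thesis by (simp add: x_def)
      qed
      have El: "(\<lambda>k. E (p (\<kappa> k) t)) \<longlonglongrightarrow> E (U t)"
        using continuous_on_tendsto_compose[OF E(1) plim[OF t'(1)]] by simp
      have lim: "(\<lambda>k. E y - E (p (\<kappa> k) t) + L * (norm (y - p (\<kappa> k) t))\<^sup>2 + M * norm (p (\<kappa> k) t - U t))
         \<longlonglongrightarrow> E y - E (U t) + L * (norm (y - U t))\<^sup>2 + M * norm (U t - U t)"
        by (intro tendsto_intros El plim[OF t'(1)])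
      have "z t \<bullet> (0, y - U t) \<le> E y - E (U t) + L * (norm (y - U t))\<^sup>2 + M * norm (U t - U t)"
        by (rule elim(1)[rule_format, OF le lim])
      then show "\<eta>' t \<bullet> (y - (u0 + primitive v' t))
          \<le> E y - E (u0 + primitive v' t) + L * (norm (y - (u0 + primitive v' t)))\<^sup>2"
        using elim(2) U_eq[OF t'(2)] by (simp add: inner_prod_def)
    qed
  qed

  have chain: "(LINT t|lborel. \<eta>' t \<bullet> v' t) \<le> E (U T) - E u0"
  proof -
    have "AE t in lborel. t \<in> {0<..<T} \<longrightarrow>
       (\<forall>z. \<eta>' t \<bullet> (z - (u0 + primitive v' t))
           \<le> E z - E (u0 + primitive v' t) + L * (norm (z - (u0 + primitive v' t)))\<^sup>2)"
      using sub' by (simp add: semiconvex_subdifferential_def)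
    from chain_inequality[OF E(1) T L M v'sq v'0 \<eta>'m \<eta>'M this]
    show ?thesis using U_eq[of T] T by simp
  qed

  define vt where "vt t = (if t \<in> {0<..T} then - A (\<eta>' t - f t) else 0)" for t
  have vtsq: "sq_integrable vt"
  proof (rule sq_integrable_bound[of _ "\<lambda>t. (norm (\<eta>' t - f t))\<^sup>2 / \<tau>\<^sup>2"])
    show "vt \<in> borel_measurable borel" unfolding vt_def by measurable
    show "integrable lborel (\<lambda>t. (norm (\<eta>' t - f t))\<^sup>2 / \<tau>\<^sup>2)"
      using sq_integrable_diff[OF \<eta>'sq f] by (simp add: sq_integrable_def)
    show "(norm (vt t))\<^sup>2 \<le> (norm (\<eta>' t - f t))\<^sup>2 / \<tau>\<^sup>2" for t
      using cocoercive_norm_le[OF A(1) \<tau>, of "\<eta>' t - f t" 0] A(2)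
      by (auto simp: vt_def power_divide[symmetric] intro!: power_mono)
  qed
  define b where "b t = v' t - vt t" for t
  have bsq: "sq_integrable b" unfolding b_def by (rule sq_integrable_diff[OF v'sq vtsq])
  \<comment> \<open>In the cocoercivity inequality the square of \<open>v k - vt\<close> is bounded below by its tangent at \<open>b\<close>,
    that is \<open>(norm d)\<^sup>2 \<ge> 2 * (d \<bullet> b) - (norm b)\<^sup>2\<close>.  What remains is linear in \<open>(v k, \<eta> k)\<close>, with
    the coefficient \<open>W\<close>, except for the product \<open>v k \<bullet> \<eta> k\<close>.\<close>
  define W where "W t = ((2 * \<tau>) *\<^sub>R b t - \<eta>' t, - vt t)" for t
  have Wsq: "sq_integrable W" unfolding W_def
    by (intro sq_integrable_Pair sq_integrable_diff sq_integrable_scale sq_integrable_minus bsq \<eta>'sq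
        vtsq)
  define q where "q t = - (vt t \<bullet> \<eta>' t) + \<tau> * (norm (b t))\<^sup>2 + 2 * \<tau> * (vt t \<bullet> b t)" for t
  have qint: "integrable lborel q" unfolding q_def
    using sq_integrable_inner[OF vtsq \<eta>'sq] sq_integrable_inner[OF vtsq bsq] bsq
        by (simp add: sq_integrable_def)
  have xW: "(LINT t|lborel. x k t \<bullet> W t)
      \<le> E u0 - E (prox E (l (\<kappa> k)) (u (\<kappa> k) T)) + l (\<kappa> k) * (C - m) + (LINT t|lborel. q t)" for k
  proof -
    define n where "n = \<kappa> k"
    have ptw: "x k t \<bullet> W t \<le> - (v n t \<bullet> \<eta> n t) + q t" for t
    proof (cases "t \<in> {0<..T}")
      case True
      define d where "d = v n t - vt t"
      have "d = - (A (\<eta> n t - f t) - A (\<eta>' t - f t))" unfolding d_def v(2)[of n t] vt_def \<eta>_def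
          using True by simp
      then have "\<tau> * (norm d)\<^sup>2 \<le> - (d \<bullet> (\<eta> n t - \<eta>' t))"
        using A(1)[unfolded cocoercive_def, rule_format, of "\<eta> n t - f t" "\<eta>' t - f t"]
        by (simp add: norm_minus_commute inner_diff)
      moreover have "2 * (d \<bullet> b t) - (norm (b t))\<^sup>2 \<le> (norm d)\<^sup>2"
        using zero_le_power2[of "norm (d - b t)"]
            by (simp add: power2_norm_eq_inner inner_diff inner_commute)
      then have "\<tau> * (2 * (d \<bullet> b t) - (norm (b t))\<^sup>2) \<le> \<tau> * (norm d)\<^sup>2" using \<tau>
          by (intro mult_left_mono) auto
      ultimately have "\<tau> * (2 * (d \<bullet> b t) - (norm (b t))\<^sup>2) \<le> - (d \<bullet> (\<eta> n t - \<eta>' t))" by linarith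
      then show ?thesis
        by (simp add: x_def W_def q_def d_def n_def[symmetric] inner_diff inner_commute algebra_simps)
    next
      case False
      then have "vt t = 0" unfolding vt_def by (rule if_not_P)
      then show ?thesis using \<tau> v'0[OF False] x0[OF False] v0[OF False] by (simp add: q_def b_def)
    qed
    have veta: "v n t \<bullet> moreau_grad E (l n) (w n t) = v n t \<bullet> \<eta> n t" for t
      using v0[of t n] by (cases "t \<in> {0<..T}") (auto simp: \<eta>_def)
    have "(LINT t|lborel. x k t \<bullet> W t) \<le> (LINT t|lborel. - (v n t \<bullet> \<eta> n t) + q t)"
      by (rule Bochner_Integration.integral_mono[OF sq_integrable_inner[OF x(1) Wsq] _ ptw])
        (intro Bochner_Integration.integrable_add Bochner_Integration.integrable_minus
            sq_integrable_inner[OF v(1) \<eta>sq(1)] qint)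
    also have "\<dots> = - (LINT t|lborel. v n t \<bullet> \<eta> n t) + (LINT t|lborel. q t)"
      using sq_integrable_inner[OF v(1) \<eta>sq(1), of n n] qint by simp
    also have "\<dots> \<le> E u0 - E (prox E (l n) (u n T)) + l n * (C - m) + (LINT t|lborel. q t)"
      using diss[of n] by (simp add: veta u_def)
    finally show ?thesis by (simp add: n_def)
  qed
  have proxT: "(\<lambda>k. prox E (l (\<kappa> k)) (u (\<kappa> k) T)) \<longlonglongrightarrow> U T"
  proof -
    have le: "norm (prox E (l n) (u n T) - u n T) \<le> sqrt (2 * l n * (C - m))" for n
      using prox_estimate(2)[OF en(2) E(2) l] by (simp add: u_def)
    have "(\<lambda>k. sqrt (2 * l (\<kappa> k) * (C - m))) \<longlonglongrightarrow> sqrt (2 * 0 * (C - m))" by (intro tendsto_intros l\<kappa>)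
    then have null: "(\<lambda>k. sqrt (2 * l (\<kappa> k) * (C - m))) \<longlonglongrightarrow> 0" by simp
    have "(\<lambda>k. prox E (l (\<kappa> k)) (u (\<kappa> k) T) - u (\<kappa> k) T) \<longlonglongrightarrow> 0"
      by (rule Lim_null_comparison[OF always_eventually null]) (intro allI le)
    from tendsto_add[OF this Ulim[of T]] T show ?thesis by simp
  qed
  have "(LINT t|lborel. z t \<bullet> W t) \<le> E u0 - E (U T) + 0 * (C - m) + (LINT t|lborel. q t)"
  proof (rule weak[OF Wsq xW])
    have "(\<lambda>k. E (prox E (l (\<kappa> k)) (u (\<kappa> k) T))) \<longlonglongrightarrow> E (U T)"
      using continuous_on_tendsto_compose[OF E(1) proxT] by simp
    then show "(\<lambda>k. E u0 - E (prox E (l (\<kappa> k)) (u (\<kappa> k) T)) + l (\<kappa> k) * (C - m) + (LINT t|lborel. q t))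
      \<longlonglongrightarrow> E u0 - E (U T) + 0 * (C - m) + (LINT t|lborel. q t)"
      by (intro tendsto_intros l\<kappa>)
  qed
  then have "(LINT t|lborel. z t \<bullet> W t) \<le> - (LINT t|lborel. \<eta>' t \<bullet> v' t) + (LINT t|lborel. q t)"
    using chain by linarith
  moreover have "(LINT t|lborel. z t \<bullet> W t) = (LINT t|lborel. \<tau> * (norm (b t))\<^sup>2 - \<eta>' t \<bullet> v' t + q t)"
  proof (rule integral_cong_AE)
    show "AE t in lborel. z t \<bullet> W t = \<tau> * (norm (b t))\<^sup>2 - \<eta>' t \<bullet> v' t + q t"
      using \<eta>'eq
    proof eventually_elim
      case (elim t)
      have "z t \<bullet> W t = v' t \<bullet> ((2 * \<tau>) *\<^sub>R b t - \<eta>' t) + \<eta>' t \<bullet> (- vt t)"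
        using elim by (simp add: W_def inner_prod_def v'_def)
      moreover have "v' t = b t + vt t" by (simp add: b_def)
      ultimately show ?case
        by (simp add: q_def inner_add inner_diff inner_commute power2_norm_eq_inner algebra_simps)
    qed
    have [measurable]: "z \<in> borel_measurable borel" "W \<in> borel_measurable borel"
        "b \<in> borel_measurable borel"
      using z(1) Wsq bsq by (auto simp: sq_integrable_def)
    show "(\<lambda>t. z t \<bullet> W t) \<in> borel_measurable lborel" by measurable
    show "(\<lambda>t. \<tau> * (norm (b t))\<^sup>2 - \<eta>' t \<bullet> v' t + q t) \<in> borel_measurable lborel"
      using qint by measurable
  qed
  moreover have "\<dots> = \<tau> * (LINT t|lborel. (norm (b t))\<^sup>2) - (LINT t|lborel. \<eta>' t \<bullet> v' t)
      + (LINT t|lborel. q t)"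
    using bsq qint sq_integrable_inner[OF \<eta>'sq v'sq] by (simp add: sq_integrable_def)
  ultimately have "\<tau> * (LINT t|lborel. (norm (b t))\<^sup>2) \<le> 0" by linarith
  then have "(LINT t|lborel. (norm (b t))\<^sup>2) \<le> 0" using \<tau> by (simp add: mult_le_0_iff)
  moreover have "0 \<le> (LINT t|lborel. (norm (b t))\<^sup>2)" by (intro integral_nonneg_AE) auto
  ultimately have "(LINT t|lborel. (norm (b t))\<^sup>2) = 0" by linarith
  then have b0: "AE t in lborel. (norm (b t))\<^sup>2 = 0"
    using bsq by (subst (asm) integral_nonneg_eq_0_iff_AE) (auto simp: sq_integrable_def)
  have "AE t in lborel. t \<in> {0<..<T} \<longrightarrow> v' t = - A (\<eta>' t - f t)"
    using b0 by eventually_elim (auto simp: b_def vt_def)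
  then show ?thesis by (intro that[OF v'sq \<eta>'sq _ sub']) (rule v'0)
qed


section \<open>The hypergraph energy and its perturbation\<close>

lemma powr_convex_combination:
  fixes x y :: real
  assumes "1 \<le> p" "0 \<le> x" "0 \<le> y" "0 \<le> s" "s \<le> 1"
  shows "((1 - s) * x + s * y) powr p \<le> (1 - s) * x powr p + s * y powr p"
proof -
  have scale: "(r * z) powr p \<le> r * z powr p" if "0 \<le> r" "r \<le> 1" "0 \<le> z" for r z :: real
  proof (cases "r = 0")
    case False
    then have "r powr p \<le> r powr 1" using that assms(1) by (intro powr_mono') auto
    then have "r powr p \<le> r" using that by simp
    then have "r powr p * z powr p \<le> r * z powr p" by (rule mult_right_mono) simp
    then show ?thesis using that by (simp add: powr_mult)
  qed simp
  show ?thesis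
  proof (cases "x = 0 \<or> y = 0")
    case True
    then show ?thesis using scale[of "1 - s" x] scale[of s y] assms by auto
  next
    case False
    then have "x \<in> {0<..}" "y \<in> {0<..}" using assms by auto
    from convex_onD[OF powr_convex[OF assms(1)] assms(4,5) this] show ?thesis by simp
  qed
qed

lemma edge_spread_properties:
  fixes e :: "'n::finite set"
  assumes "e \<noteq> {}"
  shows "\<And>i j. i \<in> e \<Longrightarrow> j \<in> e \<Longrightarrow> \<bar>x $ i - x $ j\<bar> \<le> edge_spread e x"
    "\<And>c. (\<And>i j. i \<in> e \<Longrightarrow> j \<in> e \<Longrightarrow> \<bar>x $ i - x $ j\<bar> \<le> c) \<Longrightarrow> edge_spread e x \<le> c"
    "0 \<le> edge_spread e x" "edge_spread e 0 = 0"
proof -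
  have fin: "finite ((\<lambda>(i, j). \<bar>x $ i - x $ j\<bar>) ` (e \<times> e))" for x :: "real ^ 'n" by simp
  have ne: "(\<lambda>(i, j). \<bar>x $ i - x $ j\<bar>) ` (e \<times> e) \<noteq> {}" for x :: "real ^ 'n" using assms by simp
  show le: "\<And>i j. i \<in> e \<Longrightarrow> j \<in> e \<Longrightarrow> \<bar>x $ i - x $ j\<bar> \<le> edge_spread e x"
    unfolding edge_spread_def by (rule Max_ge[OF fin]) force
  show ge: "\<And>c. (\<And>i j. i \<in> e \<Longrightarrow> j \<in> e \<Longrightarrow> \<bar>x $ i - x $ j\<bar> \<le> c) \<Longrightarrow> edge_spread e x \<le> c" for x :: "real ^ 'n"
    unfolding edge_spread_def by (subst Max_le_iff[OF fin ne]) auto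
  obtain i where "i \<in> e" using assms by blast
  from le[OF this this] show "0 \<le> edge_spread e x" by simp
  show "edge_spread e 0 = 0"
    using \<open>i \<in> e\<close> unfolding edge_spread_def by (intro Max_eqI) (auto intro!: image_eqI[of _ _ "(i, i)"])
qed

lemma edge_spread_convex:
  fixes e :: "'n::finite set"
  assumes "e \<noteq> {}" "0 \<le> s" "s \<le> 1"
  shows "edge_spread e ((1 - s) *\<^sub>R x + s *\<^sub>R y) \<le> (1 - s) * edge_spread e x + s * edge_spread e y"
proof (rule edge_spread_properties(2)[OF assms(1)])
  fix i j assume ij: "i \<in> e" "j \<in> e"
  have "\<bar>((1 - s) *\<^sub>R x + s *\<^sub>R y) $ i - ((1 - s) *\<^sub>R x + s *\<^sub>R y) $ j\<bar>
    = \<bar>(1 - s) * (x $ i - x $ j) + s * (y $ i - y $ j)\<bar>" by (simp add: algebra_simps)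
  also have "\<dots> \<le> \<bar>(1 - s) * (x $ i - x $ j)\<bar> + \<bar>s * (y $ i - y $ j)\<bar>" by (rule abs_triangle_ineq)
  also have "\<dots> = (1 - s) * \<bar>x $ i - x $ j\<bar> + s * \<bar>y $ i - y $ j\<bar>" using assms by (simp add: abs_mult)
  also have "\<dots> \<le> (1 - s) * edge_spread e x + s * edge_spread e y"
    using assms ij by (intro add_mono mult_left_mono edge_spread_properties(1)) auto
  finally show "\<bar>((1 - s) *\<^sub>R x + s *\<^sub>R y) $ i - ((1 - s) *\<^sub>R x + s *\<^sub>R y) $ j\<bar> \<le> \<dots>" .
qed

lemma weighted_hypergraph_edge:
  "weighted_hypergraph E w \<Longrightarrow> e \<in> E \<Longrightarrow> e \<noteq> {}" "weighted_hypergraph E w \<Longrightarrow> e \<in> E \<Longrightarrow> 0 \<le> w e"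
  unfolding weighted_hypergraph_def by fastforce+

lemma hypergraph_energy_convex:
  fixes E :: "'n::finite set set"
  assumes G: "weighted_hypergraph E w" and p: "1 \<le> p"
  shows "convex_on UNIV (hypergraph_energy E w p)"
proof (rule convex_onI)
  fix s :: real and x y :: "real ^ 'n"
  assume s: "0 < s" "s < 1"
  have edge: "w e * edge_spread e ((1 - s) *\<^sub>R x + s *\<^sub>R y) powr p
     \<le> (1 - s) * (w e * edge_spread e x powr p) + s * (w e * edge_spread e y powr p)" if "e \<in> E" for e
  proof -
    note ne = weighted_hypergraph_edge(1)[OF G that]
    have "edge_spread e ((1 - s) *\<^sub>R x + s *\<^sub>R y) powr p
        \<le> ((1 - s) * edge_spread e x + s * edge_spread e y) powr p"
      using edge_spread_convex[OF ne, of s x y] edge_spread_properties(3)[OF ne] s p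
          by (intro powr_mono2) auto
    also have "\<dots> \<le> (1 - s) * edge_spread e x powr p + s * edge_spread e y powr p"
      using s by (intro powr_convex_combination p edge_spread_properties(3)[OF ne]) auto
    finally have "w e * edge_spread e ((1 - s) *\<^sub>R x + s *\<^sub>R y) powr p \<le> w e * \<dots>"
      by (rule mult_left_mono) (rule weighted_hypergraph_edge(2)[OF G that])
    then show ?thesis by (simp add: algebra_simps)
  qed
  have "hypergraph_energy E w p ((1 - s) *\<^sub>R x + s *\<^sub>R y)
    \<le> 1 / p * (\<Sum>e\<in>E. (1 - s) * (w e * edge_spread e x powr p) + s * (w e * edge_spread e y powr p))"
    unfolding hypergraph_energy_def using p by (intro mult_left_mono sum_mono edge) auto
  also have "\<dots> = (1 - s) * hypergraph_energy E w p x + s * hypergraph_energy E w p y"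
    by (simp only: hypergraph_energy_def sum.distrib sum_distrib_left[symmetric])
      (simp only: distrib_left mult.left_commute)
  finally show "hypergraph_energy E w p ((1 - s) *\<^sub>R x + s *\<^sub>R y) \<le> \<dots>" .
qed simp

lemma hypergraph_energy_nonneg:
  assumes "weighted_hypergraph E w" "1 \<le> p"
  shows "0 \<le> hypergraph_energy E w p x" "hypergraph_energy E w p 0 = 0"
proof -
  show "0 \<le> hypergraph_energy E w p x"
    unfolding hypergraph_energy_def using assms(2) weighted_hypergraph_edge(2)[OF assms(1)]
    by (intro mult_nonneg_nonneg sum_nonneg) auto
  show "hypergraph_energy E w p 0 = 0"
    using weighted_hypergraph_edge(1)[OF assms(1)]
        by (simp add: hypergraph_energy_def edge_spread_properties(4))
qed

lemma convex_imp_semiconvex: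
  fixes \<phi> :: "'a::real_inner \<Rightarrow> real"
  assumes "convex_on UNIV \<phi>"
  shows "semiconvex 0 \<phi>"
  unfolding semiconvex_def
proof (intro allI impI)
  fix x z :: 'a and s :: real assume s: "0 \<le> s" "s \<le> 1"
  have "x + s *\<^sub>R (z - x) = (1 - s) *\<^sub>R x + s *\<^sub>R z" by (simp add: algebra_simps)
  then show "\<phi> (x + s *\<^sub>R (z - x)) \<le> (1 - s) * \<phi> x + s * \<phi> z + 0 * (s * (1 - s) * (norm (z - x))\<^sup>2)"
    using convex_onD[OF assms s, of x z] by simp
qed

lemma semiconvex_add:
  fixes f g :: "'a::real_inner \<Rightarrow> real"
  assumes "semiconvex K f" "semiconvex L g"
  shows "semiconvex (K + L) (\<lambda>x. f x + g x)"
  unfolding semiconvex_def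
proof (intro allI impI)
  fix x z :: 'a and s :: real assume s: "0 \<le> s" "s \<le> 1"
  have "f (x + s *\<^sub>R (z - x)) \<le> (1 - s) * f x + s * f z + K * (s * (1 - s) * (norm (z - x))\<^sup>2)"
    "g (x + s *\<^sub>R (z - x)) \<le> (1 - s) * g x + s * g z + L * (s * (1 - s) * (norm (z - x))\<^sup>2)"
    using assms s unfolding semiconvex_def by auto
  then show "f (x + s *\<^sub>R (z - x)) + g (x + s *\<^sub>R (z - x))
     \<le> (1 - s) * (f x + g x) + s * (f z + g z) + (K + L) * (s * (1 - s) * (norm (z - x))\<^sup>2)"
    by (simp add: algebra_simps)
qed

lemma semiconvex_subdifferential_0: "semiconvex_subdifferential 0 \<phi> x = subdifferential \<phi> x"
  by (simp add: semiconvex_subdifferential_def subdifferential_def)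

lemma moreau_grad_cocoercive:
  fixes \<phi> :: "'a::euclidean_space \<Rightarrow> real"
  assumes "convex_on UNIV \<phi>" "\<And>z. m \<le> \<phi> z" "0 < \<tau>"
  shows "moreau_grad \<phi> \<tau> x \<in> subdifferential \<phi> (prox \<phi> \<tau> x)" "cocoercive \<tau> (moreau_grad \<phi> \<tau>)"
proof -
  have cont: "continuous_on UNIV \<phi>" using convex_on_continuous[OF open_UNIV assms(1)] .
  show sub: "moreau_grad \<phi> \<tau> x \<in> subdifferential \<phi> (prox \<phi> \<tau> x)" for x
    using moreau_grad_subdifferential[OF cont assms(2,3) convex_imp_semiconvex[OF assms(1)]]
    by (simp add: semiconvex_subdifferential_0)
  show "cocoercive \<tau> (moreau_grad \<phi> \<tau>)" unfolding cocoercive_def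
  proof (intro allI)
    fix x y
    define px py gx gy where "px = prox \<phi> \<tau> x" and "py = prox \<phi> \<tau> y"
      and "gx = moreau_grad \<phi> \<tau> x" and "gy = moreau_grad \<phi> \<tau> y"
    have "gx \<bullet> (py - px) \<le> \<phi> py - \<phi> px" "gy \<bullet> (px - py) \<le> \<phi> px - \<phi> py"
      using sub[of x] sub[of y] by (auto simp: subdifferential_def px_def py_def gx_def gy_def)
    then have mono: "0 \<le> (gx - gy) \<bullet> (px - py)" by (simp add: inner_diff)
    have "x = px + \<tau> *\<^sub>R gx" "y = py + \<tau> *\<^sub>R gy"
      using prox_eq[OF assms(3), of x \<phi>] prox_eq[OF assms(3), of y \<phi>]
      by (simp_all add: px_def py_def gx_def gy_def diff_eq_eq add.commute)
    then have "x - y = (px - py) + \<tau> *\<^sub>R (gx - gy)" by (simp add: algebra_simps)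
    then have "(gx - gy) \<bullet> (x - y) = (gx - gy) \<bullet> (px - py) + \<tau> * (norm (gx - gy))\<^sup>2"
      by (simp add: inner_add_right power2_norm_eq_inner)
    then show "\<tau> * (norm (moreau_grad \<phi> \<tau> x - moreau_grad \<phi> \<tau> y))\<^sup>2
        \<le> (moreau_grad \<phi> \<tau> x - moreau_grad \<phi> \<tau> y) \<bullet> (x - y)"
      using mono by (simp add: gx_def gy_def)
  qed
qed

lemma moreau_grad_0:
  fixes \<phi> :: "'a::euclidean_space \<Rightarrow> real"
  assumes "continuous_on UNIV \<phi>" "\<And>z. 0 \<le> \<phi> z" "\<phi> 0 = 0" "0 < \<tau>"
  shows "moreau_grad \<phi> \<tau> 0 = 0"
proof -
  have "moreau \<phi> \<tau> 0 \<le> 0" using moreau_le[OF assms(1,2,4), of 0 0] assms(3) by simp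
  then have "(norm (prox \<phi> \<tau> 0))\<^sup>2 / (2 * \<tau>) \<le> 0" using assms(2)[of "prox \<phi> \<tau> 0"]
      by (simp add: moreau_def)
  then have "(norm (prox \<phi> \<tau> 0))\<^sup>2 \<le> 0" using assms(4) by (simp add: divide_le_0_iff)
  then have "prox \<phi> \<tau> 0 = 0" by simp
  then show ?thesis by (simp add: moreau_grad_def)
qed

lemma GDERIV_along_segment:
  assumes "GDERIV k (x + s *\<^sub>R d) :> D"
  shows "((\<lambda>s. k (x + s *\<^sub>R d)) has_real_derivative (d \<bullet> D)) (at s)"
proof -
  have 1: "((\<lambda>s. x + s *\<^sub>R d) has_derivative (\<lambda>h. h *\<^sub>R d)) (at s)"
    by (auto intro!: derivative_eq_intros)
  have 2: "(k has_derivative (\<lambda>h. h \<bullet> D)) (at (x + s *\<^sub>R d))" using assms by (simp add: gderiv_def)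
  have "(k \<circ> (\<lambda>s. x + s *\<^sub>R d) has_derivative (\<lambda>h. h \<bullet> D) \<circ> (\<lambda>h. h *\<^sub>R d)) (at s)"
    by (rule diff_chain_at[OF 1 2])
  moreover have "(\<lambda>h. h \<bullet> D) \<circ> (\<lambda>h. h *\<^sub>R d) = (*) (d \<bullet> D)" by (auto simp: fun_eq_iff)
  ultimately show ?thesis by (simp add: has_field_derivative_def o_def)
qed

lemma lipschitz_gradient_bound:
  fixes k :: "'a::real_inner \<Rightarrow> real"
  assumes k: "\<And>x. GDERIV k x :> \<pi> x" and L: "L-lipschitz_on UNIV \<pi>"
  shows "\<bar>k y - k x - \<pi> x \<bullet> (y - x)\<bar> \<le> L * (norm (y - x))\<^sup>2"
proof -
  have "\<exists>s>0. s < 1 \<and> k (x + 1 *\<^sub>R (y - x)) - k (x + 0 *\<^sub>R (y - x))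
      = (1 - 0) * ((y - x) \<bullet> \<pi> (x + s *\<^sub>R (y - x)))"
    by (rule MVT2) (auto intro: GDERIV_along_segment k)
  then obtain s where s: "0 < s" "s < 1" "k y - k x = (y - x) \<bullet> \<pi> (x + s *\<^sub>R (y - x))" by auto
  have "k y - k x - \<pi> x \<bullet> (y - x) = (\<pi> (x + s *\<^sub>R (y - x)) - \<pi> x) \<bullet> (y - x)"
    by (simp add: s(3) inner_diff inner_commute)
  then have "\<bar>k y - k x - \<pi> x \<bullet> (y - x)\<bar> \<le> norm (\<pi> (x + s *\<^sub>R (y - x)) - \<pi> x) * norm (y - x)"
    using Cauchy_Schwarz_ineq2 by metis
  also have "norm (\<pi> (x + s *\<^sub>R (y - x)) - \<pi> x) \<le> L * norm (y - x)"
  proof -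
    have L0: "0 \<le> L" using L by (rule lipschitz_on_nonneg)
    have "norm (\<pi> (x + s *\<^sub>R (y - x)) - \<pi> x) \<le> L * norm (s *\<^sub>R (y - x))"
      using lipschitz_onD[OF L, of "x + s *\<^sub>R (y - x)" x] by (simp add: dist_norm)
    also have "\<dots> \<le> L * norm (y - x)"
      using s L0 by (intro mult_left_mono) (auto intro: mult_left_le_one_le)
    finally show ?thesis .
  qed
  finally show ?thesis by (simp add: power2_eq_square mult_right_mono mult.assoc)
qed

lemma lipschitz_gradient_semiconvex:
  fixes k :: "'a::real_inner \<Rightarrow> real"
  assumes k: "\<And>x. GDERIV k x :> \<pi> x" and L: "L-lipschitz_on UNIV \<pi>"
  shows "semiconvex L k"
  unfolding semiconvex_def
proof (intro allI impI)
  fix x z :: 'a and s :: real assume s: "0 \<le> s" "s \<le> 1"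
  define y where "y = x + s *\<^sub>R (z - x)"
  define D where "D = (norm (z - x))\<^sup>2"
  define r where "r = \<pi> y \<bullet> (z - x)"
  have xy: "x - y = - (s *\<^sub>R (z - x))" and zy: "z - y = (1 - s) *\<^sub>R (z - x)"
      by (simp_all add: y_def algebra_simps)
  have "k y + \<pi> y \<bullet> (x - y) - L * (norm (x - y))\<^sup>2 \<le> k x" "k y + \<pi> y \<bullet> (z - y) - L * (norm (z - y))\<^sup>2
      \<le> k z"
    using lipschitz_gradient_bound[OF k L, of x y] lipschitz_gradient_bound[OF k L, of z y] by linarith+
  then have "k y - s * r - L * (s\<^sup>2 * D) \<le> k x" "k y + (1 - s) * r - L * ((1 - s)\<^sup>2 * D) \<le> k z"
    unfolding xy zy by (simp_all add: r_def D_def power_mult_distrib)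
  then have "(1 - s) * (k y - s * r - L * (s\<^sup>2 * D)) + s * (k y + (1 - s) * r - L * ((1 - s)\<^sup>2 * D))
      \<le> (1 - s) * k x + s * k z"
    using s by (intro add_mono mult_left_mono) auto
  moreover have "(1 - s) * (k y - s * r - L * (s\<^sup>2 * D)) + s * (k y + (1 - s) * r - L * ((1 - s)\<^sup>2 * D))
     = k y - L * (s * (1 - s) * D)" by (simp add: power2_eq_square algebra_simps)
  ultimately show "k (x + s *\<^sub>R (z - x))
      \<le> (1 - s) * k x + s * k z + L * (s * (1 - s) * (norm (z - x))\<^sup>2)"
    by (simp add: y_def D_def)
qed

text \<open>The sum rule for a convex function and a perturbation that is differentiable at the point in
  question: comparing with \<open>x + s *\<^sub>R (z - x)\<close> and dividing by \<open>s\<close>, the quadratic defect disappears.\<close>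

lemma subdifferential_minus_gradient:
  fixes \<phi> g :: "'a::real_inner \<Rightarrow> real"
  assumes \<phi>: "convex_on UNIV \<phi>" and g: "GDERIV g x :> d"
    and \<eta>: "\<eta> \<in> semiconvex_subdifferential L (\<lambda>x. \<phi> x + g x) x"
  shows "\<eta> - d \<in> subdifferential \<phi> x"
  unfolding subdifferential_def
proof (intro CollectI allI)
  fix z
  define D where "D = (norm (z - x))\<^sup>2"
  have *: "\<eta> \<bullet> (z - x) \<le> (\<phi> z - \<phi> x) + (g (x + s *\<^sub>R (z - x)) - g x) / s + L * s * D" if s: "0 < s" "s
      < 1" for s
  proof -
    define y where "y = x + s *\<^sub>R (z - x)"
    have "\<eta> \<bullet> (y - x) \<le> (\<phi> y + g y) - (\<phi> x + g x) + L * (norm (y - x))\<^sup>2"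
      using \<eta> unfolding semiconvex_subdifferential_def by blast
    moreover have "\<phi> y \<le> (1 - s) * \<phi> x + s * \<phi> z"
      using convex_imp_semiconvex[OF \<phi>] s unfolding semiconvex_def y_def by force
    moreover have "\<eta> \<bullet> (y - x) = s * (\<eta> \<bullet> (z - x))" "(norm (y - x))\<^sup>2 = s\<^sup>2 * D"
      by (simp_all add: y_def D_def power_mult_distrib)
    moreover have "(1 - s) * \<phi> x + s * \<phi> z = s * (\<phi> z - \<phi> x) + \<phi> x" by (simp add: algebra_simps)
    ultimately have "s * (\<eta> \<bullet> (z - x)) \<le> s * (\<phi> z - \<phi> x) + (g y - g x) + L * (s\<^sup>2 * D)"
      by simp
    also have "\<dots> = s * ((\<phi> z - \<phi> x) + (g y - g x) / s + L * s * D)"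
      using s by (simp add: field_simps power2_eq_square)
    finally show ?thesis using s by (simp add: y_def)
  qed
  have "((\<lambda>s. g (x + s *\<^sub>R (z - x))) has_real_derivative ((z - x) \<bullet> d)) (at 0)"
    by (rule GDERIV_along_segment) (simp add: g)
  then have "((\<lambda>s. (g (x + s *\<^sub>R (z - x)) - g x) / s) \<longlongrightarrow> (z - x) \<bullet> d) (at 0)"
    by (simp add: DERIV_def)
  then have "((\<lambda>s. (g (x + s *\<^sub>R (z - x)) - g x) / s) \<longlongrightarrow> (z - x) \<bullet> d) (at_right 0)"
    by (rule tendsto_mono[rotated]) (simp add: at_le)
  then have "((\<lambda>s. (\<phi> z - \<phi> x) + (g (x + s *\<^sub>R (z - x)) - g x) / s + L * s * D) \<longlongrightarrow> (\<phi> z - \<phi> x) + (z - x)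
      \<bullet> d + L * 0 * D) (at_right 0)"
    by (intro tendsto_intros)
  moreover have "\<forall>\<^sub>F s in at_right 0. \<eta> \<bullet> (z - x)
      \<le> (\<phi> z - \<phi> x) + (g (x + s *\<^sub>R (z - x)) - g x) / s + L * s * D"
    using eventually_at_right_real[OF zero_less_one] by eventually_elim (rule *, auto)
  ultimately have "\<eta> \<bullet> (z - x) \<le> (\<phi> z - \<phi> x) + (z - x) \<bullet> d + L * 0 * D"
    by (intro tendsto_lowerbound) auto
  then show "(\<eta> - d) \<bullet> (z - x) \<le> \<phi> z - \<phi> x" by (simp add: inner_diff_left inner_commute)
qed

lemma GDERIV_norm_powr:
  fixes x :: "'a::euclidean_space"
  assumes q: "2 < q"
  shows "GDERIV (\<lambda>x. (a / q) * norm x powr q) x :> (a * norm x powr (q - 2)) *\<^sub>R x"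
proof (cases "x = 0")
  case True
  have "((\<lambda>y::'a. (a / q) * norm y powr q) has_derivative (\<lambda>h. 0)) (at 0)"
    unfolding has_derivative_iff_norm
  proof (intro conjI)
    have "((\<lambda>y::'a. \<bar>a / q\<bar> * norm y powr (q - 1)) \<longlongrightarrow> \<bar>a / q\<bar> * norm (0::'a) powr (q - 1)) (at 0)"
      using q by (intro tendsto_intros) auto
    then have "((\<lambda>y::'a. \<bar>a / q\<bar> * norm y powr (q - 1)) \<longlongrightarrow> 0) (at 0)" by simp
    then show "((\<lambda>y::'a. norm (a / q * norm y powr q - a / q * norm (0::'a) powr q - 0) / norm (y - 0))
        \<longlongrightarrow> 0) (at 0)"
    proof (rule Lim_transform_eventually)
      show "\<forall>\<^sub>F y::'a in at 0. \<bar>a / q\<bar> * norm y powr (q - 1)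
          = norm (a / q * norm y powr q - a / q * norm (0::'a) powr q - 0) / norm (y - 0)"
        unfolding eventually_at_filter
        by (intro always_eventually) (auto simp: powr_diff abs_mult)
    qed
  qed simp
  then show ?thesis using True by (simp add: gderiv_def)
next
  case False
  have D: "DERIV (\<lambda>r. (a / q) * r powr q) (norm x) :> a * norm x powr (q - 1)"
    using False q by (auto intro!: derivative_eq_intros)
  have "GDERIV (\<lambda>x. (a / q) * norm x powr q) x :> (a * norm x powr (q - 1)) *\<^sub>R sgn x"
    by (rule GDERIV_DERIV_compose[OF GDERIV_norm[OF False] D])
  moreover have "norm x powr (q - 1) = norm x powr (q - 2) * norm x"
    using False powr_add[of "norm x" "q - 2" 1] by simp
  then have "(a * norm x powr (q - 1)) *\<^sub>R sgn x = (a * norm x powr (q - 2)) *\<^sub>R x"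
    using False by (simp add: sgn_div_norm)
  ultimately show ?thesis by simp
qed

lemma norm_powr_convex:
  assumes "0 \<le> a" "1 \<le> q"
  shows "convex_on UNIV (\<lambda>x::'a::real_normed_vector. a * norm x powr q)"
proof (rule convex_onI)
  fix s :: real and x y :: 'a
  assume s: "0 < s" "s < 1"
  have "norm ((1 - s) *\<^sub>R x + s *\<^sub>R y) \<le> (1 - s) * norm x + s * norm y"
    using norm_triangle_ineq[of "(1 - s) *\<^sub>R x" "s *\<^sub>R y"] s by simp
  then have "norm ((1 - s) *\<^sub>R x + s *\<^sub>R y) powr q \<le> ((1 - s) * norm x + s * norm y) powr q"
    using assms by (intro powr_mono2) auto
  also have "\<dots> \<le> (1 - s) * norm x powr q + s * norm y powr q"
    using s assms by (intro powr_convex_combination) auto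
  finally have "a * norm ((1 - s) *\<^sub>R x + s *\<^sub>R y) powr q \<le> a * \<dots>" using assms by (intro mult_left_mono)
  then show "a * norm ((1 - s) *\<^sub>R x + s *\<^sub>R y) powr q
      \<le> (1 - s) * (a * norm x powr q) + s * (a * norm y powr q)"
    by (simp add: algebra_simps)
qed simp

lemma powr_dominates_square:
  fixes c q M :: real
  assumes "0 < c" "2 < q" "0 \<le> M"
  obtains C where "\<And>r. 0 \<le> r \<Longrightarrow> M * r\<^sup>2 - C \<le> c * r powr q"
proof
  define R where "R = (M / c) powr (1 / (q - 2))"
  fix r :: real assume r: "0 \<le> r"
  show "M * r\<^sup>2 - M * R\<^sup>2 \<le> c * r powr q"
  proof (cases "r \<le> R")
    case True
    then have "M * r\<^sup>2 \<le> M * R\<^sup>2" using r assms by (intro mult_left_mono power_mono)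
    moreover have "0 \<le> c * r powr q" using assms by simp
    ultimately show ?thesis by linarith
  next
    case False
    then have r0: "0 < r" using powr_ge_zero[of "M / c" "1 / (q - 2)"] unfolding R_def by linarith
    have "M / c = R powr (q - 2)" using assms by (simp add: R_def powr_powr)
    also have "\<dots> \<le> r powr (q - 2)" using False assms by (intro powr_mono2) (auto simp: R_def)
    finally have "M \<le> c * r powr (q - 2)" using assms by (simp add: field_simps)
    then have "M * r\<^sup>2 \<le> c * r powr (q - 2) * r\<^sup>2" by (rule mult_right_mono) simp
    also have "r powr (q - 2) * r\<^sup>2 = r powr q"
      using r0 powr_add[of r "q - 2" 2] by (simp add: powr_numeral)
    then have "c * r powr (q - 2) * r\<^sup>2 = c * r powr q" by (simp add: mult.assoc)
    finally show ?thesis using assms(3) by (smt (verit) mult_nonneg_nonneg zero_le_power2)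
  qed
qed

text \<open>The superquadratic power dominates the at most quadratic decay of \<open>k\<close>.\<close>

lemma total_energy_coercive:
  fixes k :: "'a::real_inner \<Rightarrow> real" and \<phi> :: "'a \<Rightarrow> real"
  assumes k: "\<And>x. GDERIV k x :> \<pi> x" and L: "L-lipschitz_on UNIV \<pi>"
    and \<phi>: "\<And>x. 0 \<le> \<phi> x" and aq: "0 < a" "2 < q"
  shows "\<exists>m. \<forall>x. (norm x)\<^sup>2 + m \<le> \<phi> x + ((a / q) * norm x powr q + k x)"
proof -
  have L0: "0 \<le> L" using L by (rule lipschitz_on_nonneg)
  define P where "P = norm (\<pi> 0)"
  obtain C where C: "\<And>r. 0 \<le> r \<Longrightarrow> (L + P + 1) * r\<^sup>2 - C \<le> (a / q) * r powr q"
    using powr_dominates_square[of "a / q" q "L + P + 1"] aq L0 by (auto simp: P_def)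
  show ?thesis
  proof (intro exI[of _ "k 0 - P - C"] allI)
    fix x :: 'a
    define r where "r = norm x"
    have "\<pi> 0 \<bullet> x \<ge> - (P * r)" using Cauchy_Schwarz_ineq2[of "\<pi> 0" x] by (simp add: P_def r_def)
    moreover have "P * r \<le> P * (1 + r\<^sup>2)"
    proof (rule mult_left_mono)
      have "0 \<le> (r - 1)\<^sup>2" by simp
      then have "2 * r \<le> 1 + r\<^sup>2" by (simp add: power2_diff)
      then show "r \<le> 1 + r\<^sup>2" using zero_le_power2[of r] by linarith
    qed (simp add: P_def)
    moreover have "k 0 + \<pi> 0 \<bullet> x - L * r\<^sup>2 \<le> k x"
      using lipschitz_gradient_bound[OF k L, of x 0] by (simp add: r_def)
    moreover have "(L + P + 1) * r\<^sup>2 - C \<le> (a / q) * r powr q" using C[of r] by (simp add: r_def)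
    moreover have "(L + P + 1) * r\<^sup>2 = L * r\<^sup>2 + P * r\<^sup>2 + r\<^sup>2" "P * (1 + r\<^sup>2) = P + P * r\<^sup>2"
        by (simp_all add: algebra_simps)
    ultimately have "r\<^sup>2 + (k 0 - P - C) \<le> (a / q) * r powr q + k x" by linarith
    then show "(norm x)\<^sup>2 + (k 0 - P - C) \<le> \<phi> x + ((a / q) * norm x powr q + k x)"
      using \<phi>[of x] by (simp add: r_def)
  qed
qed


section \<open>Primitives as Sobolev functions\<close>

lemma integrable_lebesgue_on:
  fixes g :: "real \<Rightarrow> 'a::euclidean_space"
  assumes "set_integrable lborel S g" "S \<in> sets borel"
  shows "integrable (lebesgue_on S) g"
proof -
  have "integrable lebesgue (\<lambda>t. indicator S t *\<^sub>R g t)"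
    using assms(1) unfolding set_integrable_def by (subst integrable_completion) auto
  then show ?thesis using assms(2) by (subst integrable_restrict_space) auto
qed

lemma integral_lebesgue_on:
  fixes g :: "real \<Rightarrow> 'a::euclidean_space"
  assumes "g \<in> borel_measurable borel" "S \<in> sets borel"
  shows "(LINT t|lebesgue_on S. g t) = (LINT t|lborel. indicator S t *\<^sub>R g t)"
proof -
  have "(LINT t|lebesgue_on S. g t) = (LINT t|lebesgue. indicator S t *\<^sub>R g t)"
    by (rule integral_restrict_space) (use assms(2) in simp)
  also have "\<dots> = (LINT t|lborel. indicator S t *\<^sub>R g t)"
  proof (rule integral_completion)
    note [measurable] = assms
    show "(\<lambda>t. indicator S t *\<^sub>R g t) \<in> borel_measurable lborel" by measurable
  qed
  finally show ?thesis .
qed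

lemma AE_lebesgue_on:
  assumes "AE t in lborel. t \<in> S \<longrightarrow> P t" "S \<in> sets borel"
  shows "AE t in lebesgue_on S. P t"
proof -
  have "AE t in lebesgue. t \<in> S \<longrightarrow> P t" using assms(1) by (rule AE_completion)
  then show ?thesis using assms(2) by (simp add: AE_restrict_space_iff)
qed

lemma borel_imp_lebesgue_on:
  fixes g :: "real \<Rightarrow> 'a::euclidean_space"
  assumes "g \<in> borel_measurable borel"
  shows "g \<in> borel_measurable (lebesgue_on S)"
proof -
  have "g \<in> borel_measurable lborel" using assms by simp
  then have "g \<in> borel_measurable lebesgue" by (rule measurable_completion)
  then show ?thesis by (rule measurable_restrict_space1)
qed

lemma powr_2_norm: "norm x powr 2 = (norm x)\<^sup>2"
  by (cases "norm x = 0") (simp_all add: powr_numeral)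

lemma in_L_2_iff:
  "in_L 2 S g \<longleftrightarrow> g \<in> borel_measurable (lebesgue_on S) \<and> integrable (lebesgue_on S) (\<lambda>t. (norm (g t))\<^sup>2)"
  by (simp add: in_L_def powr_2_norm)

lemma sq_integrable_in_L_2:
  assumes "sq_integrable g" "S \<in> sets borel"
  shows "in_L 2 S g"
  unfolding in_L_2_iff
  by (intro conjI borel_imp_lebesgue_on integrable_lebesgue_on set_integrable_of_integrable assms(2)
      sq_integrable_measurable[OF assms(1)]
      conjunct2[OF assms(1)[unfolded sq_integrable_def]])

lemma in_L_2_imp_in_L_1:
  fixes g :: "real \<Rightarrow> 'a::euclidean_space"
  assumes "in_L 2 {0<..<T} g"
  shows "in_L 1 {0<..<T} g"
proof -
  have g: "g \<in> borel_measurable (lebesgue_on {0<..<T})"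
      "integrable (lebesgue_on {0<..<T}) (\<lambda>t. (norm (g t))\<^sup>2)"
    using assms unfolding in_L_2_iff by blast+
  have fin: "finite_measure (lebesgue_on {0<..<T})"
    by (rule finite_measure_lebesgue_on) simp
  have "integrable (lebesgue_on {0<..<T}) (\<lambda>t. norm (g t))"
    by (rule finite_measure.square_integrable_imp_integrable[OF fin _ g(2)])
      (rule measurable_compose[OF g(1) borel_measurable_norm])
  then have "integrable (lebesgue_on {0<..<T}) (\<lambda>t. norm (g t) powr 1)" by simp
  with g(1) show ?thesis unfolding in_L_def by (rule conjI)
qed

lemma in_L_2_add:
  fixes g h :: "real \<Rightarrow> 'a::euclidean_space"
  assumes "in_L 2 S g" "in_L 2 S h"
  shows "in_L 2 S (\<lambda>t. g t + h t)"
proof -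
  have g: "g \<in> borel_measurable (lebesgue_on S)" "integrable (lebesgue_on S) (\<lambda>t. (norm (g t))\<^sup>2)"
    and h: "h \<in> borel_measurable (lebesgue_on S)" "integrable (lebesgue_on S) (\<lambda>t. (norm (h t))\<^sup>2)"
    using assms unfolding in_L_2_iff by blast+
  have "integrable (lebesgue_on S) (\<lambda>t. (norm (g t + h t))\<^sup>2)"
  proof (rule Bochner_Integration.integrable_bound)
    show "integrable (lebesgue_on S) (\<lambda>t. 2 * (norm (g t))\<^sup>2 + 2 * (norm (h t))\<^sup>2)"
      by (intro Bochner_Integration.integrable_add integrable_mult_right g h)
    show "(\<lambda>t. (norm (g t + h t))\<^sup>2) \<in> borel_measurable (lebesgue_on S)"
      by (intro borel_measurable_power measurable_compose[OF _ borel_measurable_norm]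
          borel_measurable_add g h)
    show "AE t in lebesgue_on S. norm ((norm (g t + h t))\<^sup>2)
        \<le> norm (2 * (norm (g t))\<^sup>2 + 2 * (norm (h t))\<^sup>2)"
      by (intro AE_I2) (simp add: norm_add_sq_le)
  qed
  with borel_measurable_add[OF g(1) h(1)] show ?thesis unfolding in_L_2_iff by (rule conjI)
qed

lemma in_L_2_minus:
  fixes g :: "real \<Rightarrow> 'a::euclidean_space"
  assumes "in_L 2 S g"
  shows "in_L 2 S (\<lambda>t. - g t)"
  using assms unfolding in_L_2_iff norm_minus_cancel by (intro conjI borel_measurable_uminus) blast+

lemma lebesgue_borel_representative:
  fixes g :: "real \<Rightarrow> 'a::euclidean_space"
  assumes "g \<in> borel_measurable lebesgue"
  obtains g' where "g' \<in> borel_measurable borel" "AE t in lborel. g t = g' t"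
proof -
  have "\<exists>h. h \<in> borel_measurable lborel \<and> (AE t in lborel. g t \<bullet> b = h t)" for b
    using completion_ex_borel_measurable_real[of "\<lambda>t. g t \<bullet> b" lborel] assms by auto
  then obtain h where h: "\<And>b. h b \<in> borel_measurable lborel" "\<And>b. AE t in lborel. g t \<bullet> b = h b t"
      by metis
  show ?thesis
  proof (rule that)
    show "(\<lambda>t. \<Sum>b\<in>Basis. h b t *\<^sub>R b) \<in> borel_measurable borel" using h(1) by simp
    have "AE t in lborel. \<forall>b\<in>Basis. g t \<bullet> b = h b t"
      by (rule AE_finite_allI) (simp_all add: h(2))
    then show "AE t in lborel. g t = (\<Sum>b\<in>Basis. h b t *\<^sub>R b)"
    proof eventually_elim
      case (elim t)
      have "g t = (\<Sum>b\<in>Basis. (g t \<bullet> b) *\<^sub>R b)" by (simp add: euclidean_representation)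
      also have "\<dots> = (\<Sum>b\<in>Basis. h b t *\<^sub>R b)" using elim by (intro sum.cong) auto
      finally show ?case .
    qed
  qed
qed

lemma in_L_2_representative:
  fixes f :: "real \<Rightarrow> 'a::euclidean_space"
  assumes f: "in_L 2 {0<..<T} f"
  obtains f' where "sq_integrable f'" "AE t in lborel. t \<in> {0<..<T} \<longrightarrow> f t = f' t"
proof -
  define S where "S = {0<..<T}"
  have S: "S \<in> sets borel" "S \<in> sets lebesgue" by (auto simp: S_def)
  have "f \<in> borel_measurable (lebesgue_on S)" and i: "integrable (lebesgue_on S) (\<lambda>t. (norm (f t))\<^sup>2)"
    using f unfolding in_L_2_iff S_def by blast+
  then have "(\<lambda>t. if t \<in> S then f t else 0) \<in> borel_measurable lebesgue"
    using borel_measurable_if[OF S(2), of f] by blast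
  then obtain g where g: "g \<in> borel_measurable borel" "AE t in lborel. (if t \<in> S then f t else 0) = g t"
    by (rule lebesgue_borel_representative)
  have ifS: "indicator S t *\<^sub>R (norm (f t))\<^sup>2 = (norm (if t \<in> S then f t else 0))\<^sup>2" for t by simp
  have "integrable lebesgue (\<lambda>t. indicator S t *\<^sub>R (norm (f t))\<^sup>2)"
    using i S by (subst (asm) integrable_restrict_space) auto
  then have "integrable lebesgue (\<lambda>t. (norm (if t \<in> S then f t else 0))\<^sup>2)" unfolding ifS .
  then have "integrable lebesgue (\<lambda>t. (norm (g t))\<^sup>2)"
  proof (subst integrable_cong_AE)
    show "AE t in lebesgue. (norm (g t))\<^sup>2 = (norm (if t \<in> S then f t else 0))\<^sup>2"
      using g(2) by (intro AE_completion) (auto elim: eventually_mono)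
    show "(\<lambda>t. (norm (g t))\<^sup>2) \<in> borel_measurable lebesgue"
      using g(1) by (intro measurable_completion) simp
  qed (auto dest: borel_measurable_integrable)
  then have "integrable lborel (\<lambda>t. (norm (g t))\<^sup>2)"
    using g(1) by (subst (asm) integrable_completion) auto
  then have "sq_integrable g" using g(1) by (simp add: sq_integrable_def)
  moreover have "AE t in lborel. t \<in> {0<..<T} \<longrightarrow> f t = g t"
    using g(2) by eventually_elim (auto simp: S_def)
  ultimately show ?thesis by (rule that)
qed

lemma le_weighted_mean:
  fixes a b c x :: real
  assumes x: "x\<^sup>2 \<le> a * b" and "0 \<le> a" "0 \<le> b" and c: "0 < c"
  shows "x \<le> a / (2 * c) + (c / 2) * b"
proof -
  define X Y where "X = a / (2 * c)" and "Y = (c / 2) * b"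
  have "a * b = 4 * (X * Y)" using c by (simp add: X_def Y_def)
  moreover have "0 \<le> (X - Y)\<^sup>2" by simp
  then have "4 * (X * Y) \<le> (X + Y)\<^sup>2" by (simp add: power2_eq_square algebra_simps)
  ultimately have "x\<^sup>2 \<le> (X + Y)\<^sup>2" using x by linarith
  moreover have "0 \<le> X + Y" using assms by (simp add: X_def Y_def)
  ultimately have "x \<le> X + Y" by (rule power2_le_imp_le)
  then show ?thesis by (simp add: X_def Y_def)
qed

lemma primitive_abs_continuous:
  fixes v :: "real \<Rightarrow> 'a::euclidean_space"
  assumes v: "sq_integrable v" "integrable lborel v"
  shows "abs_continuous_on I (\<lambda>t. u0 + primitive v t)"
  unfolding abs_continuous_on_def
proof (intro allI impI)
  fix \<epsilon> :: real assume \<epsilon>: "0 < \<epsilon>"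
  have iv2: "integrable lborel (\<lambda>t. (norm (v t))\<^sup>2)" using v by (simp add: sq_integrable_def)
  have [measurable]: "v \<in> borel_measurable borel" using v(1) by (rule sq_integrable_measurable)
  define V where "V = (LINT t|lborel. (norm (v t))\<^sup>2)"
  have V: "0 \<le> V" unfolding V_def by (intro integral_nonneg_AE) auto
  define c where "c = \<epsilon> / (V + 1)"
  have c: "0 < c" "c * V < \<epsilon>" using \<epsilon> V by (simp_all add: c_def field_simps)
  show "\<exists>\<delta>>0. \<forall>(n::nat) s t. (\<forall>i<n. s i \<in> I \<and> t i \<in> I \<and> s i \<le> t i) \<and>
        disjoint_family_on (\<lambda>i. {s i<..<t i}) {..<n} \<and> (\<Sum>i<n. t i - s i) < \<delta> \<longrightarrow>
        (\<Sum>i<n. norm (u0 + primitive v (t i) - (u0 + primitive v (s i)))) < \<epsilon>"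
  proof (intro exI conjI allI impI)
    show "0 < c * \<epsilon>" using c \<epsilon> by simp
    fix n :: nat and s t :: "nat \<Rightarrow> real"
    assume H: "(\<forall>i<n. s i \<in> I \<and> t i \<in> I \<and> s i \<le> t i) \<and>
        disjoint_family_on (\<lambda>i. {s i<..<t i}) {..<n} \<and> (\<Sum>i<n. t i - s i) < c * \<epsilon>"
    define W where "W i = (LINT r:{s i<..<t i}|lborel. (norm (v r))\<^sup>2)" for i
    have step: "norm (u0 + primitive v (t i) - (u0 + primitive v (s i)))
        \<le> (t i - s i) / (2 * c) + (c / 2) * W i" if "i < n" for i
    proof -
      have st: "s i \<le> t i" using H that by blast
      have "(norm (primitive v (t i) - primitive v (s i)))\<^sup>2
          \<le> (t i - s i) * (LINT r:{s i<..t i}|lborel. (norm (v r))\<^sup>2)"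
        using primitive_increment_sq[OF v st] primitive_diff[OF iv2 st] by simp
      also have "(LINT r:{s i<..t i}|lborel. (norm (v r))\<^sup>2) = W i"
        unfolding W_def set_lebesgue_integral_def
      proof (rule integral_cong_AE)
        show "AE r in lborel. indicator {s i<..t i} r *\<^sub>R (norm (v r))\<^sup>2
            = indicator {s i<..<t i} r *\<^sub>R (norm (v r))\<^sup>2"
          using AE_lborel_singleton[of "t i"] by eventually_elim (auto simp: indicator_def)
      qed measurable
      finally have sq: "(norm (primitive v (t i) - primitive v (s i)))\<^sup>2 \<le> (t i - s i) * W i" .
      have W: "0 \<le> W i" unfolding W_def set_lebesgue_integral_def by (intro integral_nonneg_AE) auto
      have "norm (primitive v (t i) - primitive v (s i)) \<le> (t i - s i) / (2 * c) + (c / 2) * W i"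
        by (rule le_weighted_mean[OF sq _ W c(1)]) (simp add: st)
      then show ?thesis by simp
    qed
    have "(\<Sum>i<n. W i) \<le> V"
    proof -
      have int: "integrable lborel (\<lambda>r. indicator {s i<..<t i} r *\<^sub>R (norm (v r))\<^sup>2)" for i
        using set_integrable_of_integrable[OF iv2, of "{s i<..<t i}"] by (simp add: set_integrable_def)
      have "(\<Sum>i<n. W i) = (LINT r|lborel. (\<Sum>i<n. indicator {s i<..<t i} r *\<^sub>R (norm (v r))\<^sup>2))"
        unfolding W_def set_lebesgue_integral_def using int
            by (subst Bochner_Integration.integral_sum) auto
      also have "\<dots> \<le> V" unfolding V_def
      proof (rule Bochner_Integration.integral_mono[OF _ iv2])
        show "integrable lborel (\<lambda>r. \<Sum>i<n. indicator {s i<..<t i} r *\<^sub>R (norm (v r))\<^sup>2)"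
          by (intro Bochner_Integration.integrable_sum int)
        fix r
        have "(\<Sum>i<n. indicator {s i<..<t i} r) = (indicator (\<Union>i<n. {s i<..<t i}) r :: real)"
          using H by (intro indicator_UN_disjoint[symmetric]) auto
        also have "\<dots> \<le> 1" by (rule indicator_le_1)
        finally have "(\<Sum>i<n. indicator {s i<..<t i} r) * (norm (v r))\<^sup>2 \<le> 1 * (norm (v r))\<^sup>2"
          by (intro mult_right_mono) auto
        then show "(\<Sum>i<n. indicator {s i<..<t i} r *\<^sub>R (norm (v r))\<^sup>2) \<le> (norm (v r))\<^sup>2"
          by (simp add: sum_distrib_right)
      qed
      finally show ?thesis .
    qed
    then have cW: "(c / 2) * (\<Sum>i<n. W i) \<le> c * V / 2" using c by simp
    have "(\<Sum>i<n. norm (u0 + primitive v (t i) - (u0 + primitive v (s i))))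
        \<le> (\<Sum>i<n. (t i - s i) / (2 * c) + (c / 2) * W i)"
      by (intro sum_mono step) auto
    also have "\<dots> = (\<Sum>i<n. t i - s i) / (2 * c) + (c / 2) * (\<Sum>i<n. W i)"
      by (simp add: sum.distrib sum_divide_distrib sum_distrib_left)
    also have "\<dots> < \<epsilon> / 2 + \<epsilon> / 2"
    proof -
      have "(\<Sum>i<n. t i - s i) / (2 * c) < (c * \<epsilon>) / (2 * c)" using H c
          by (intro divide_strict_right_mono) auto
      then have "(\<Sum>i<n. t i - s i) / (2 * c) < \<epsilon> / 2" using c by simp
      moreover have "c * V / 2 < \<epsilon> / 2" using c by simp
      ultimately show ?thesis using cW by linarith
    qed
    finally show "(\<Sum>i<n. norm (u0 + primitive v (t i) - (u0 + primitive v (s i)))) < \<epsilon>" by simp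
  qed
qed

lemma test_function_facts:
  assumes "test_function {0<..<T} \<theta>" "0 < T"
  shows "\<And>t. (\<theta> has_real_derivative deriv \<theta> t) (at t)" "continuous_on UNIV (deriv \<theta>)"
      "continuous_on UNIV \<theta>"
    "\<And>t. t \<notin> {0<..<T} \<Longrightarrow> \<theta> t = 0"
proof -
  have d: "\<And>n. (deriv ^^ n) \<theta> differentiable_on UNIV"
    and K: "\<exists>K. compact K \<and> K \<subseteq> {0<..<T} \<and> (\<forall>t. t \<notin> K \<longrightarrow> \<theta> t = 0)"
    using assms by (auto simp: test_function_def)
  have d0: "\<theta> differentiable_on UNIV" using d[of 0] by simp
  then show "\<And>t. (\<theta> has_real_derivative deriv \<theta> t) (at t)"
    by (metis DERIV_deriv_iff_real_differentiable UNIV_I differentiable_on_def)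
  show "continuous_on UNIV (deriv \<theta>)" using d[of 1] by (simp add: differentiable_imp_continuous_on)
  show "continuous_on UNIV \<theta>" using d0 by (rule differentiable_imp_continuous_on)
  show "\<And>t. t \<notin> {0<..<T} \<Longrightarrow> \<theta> t = 0" using K by blast
qed

text \<open>Integration by parts, by Fubini's theorem on the triangle \<open>s \<le> t\<close>.\<close>

lemma primitive_has_weak_deriv:
  fixes v :: "real \<Rightarrow> 'a::euclidean_space"
  assumes v: "integrable lborel v" "\<And>t. t \<notin> {0<..T} \<Longrightarrow> v t = 0" and T: "0 < T"
  shows "has_weak_deriv (\<lambda>t. u0 + primitive v t) v {0<..<T}"
  unfolding has_weak_deriv_def
proof (intro allI impI)
  fix \<theta> assume "test_function {0<..<T} \<theta>"
  note \<theta> = test_function_facts[OF this T]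
  define d where "d = deriv \<theta>"
  have cd: "continuous_on UNIV d" using \<theta>(2) by (simp add: d_def)
  have [measurable]: "v \<in> borel_measurable borel" "d \<in> borel_measurable borel"
      "\<theta> \<in> borel_measurable borel"
    using v cd \<theta>(3) by (auto intro: borel_measurable_continuous_onI)
  have cu: "continuous_on UNIV (primitive v)" by (rule continuous_primitive[OF v(1)])
  have [measurable]: "primitive v \<in> borel_measurable borel" using cu
      by (rule borel_measurable_continuous_onI)
  have "compact (d ` {0..T})" by (intro compact_continuous_image continuous_on_subset[OF cd]) auto
  then obtain D where D: "\<And>t. t \<in> {0..T} \<Longrightarrow> \<bar>d t\<bar> \<le> D"
      by (fastforce dest!: compact_imp_bounded simp: bounded_iff)
  have sd: "set_integrable lborel {a<..<T} d" for a
    by (rule set_integrable_subset[OF borel_integrable_atLeastAtMost'[of a T]])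
        (auto intro: continuous_on_subset[OF cd])
  have intd: "(LINT t|lborel. indicator {a<..<T} t *\<^sub>R d t) = \<theta> T - \<theta> a" if "0 \<le> a" "a \<le> T" for a
  proof -
    have "(d has_integral (\<theta> T - \<theta> a)) {a..T}"
      using that \<theta>(1) by (intro fundamental_theorem_of_calculus)
        (auto simp: d_def has_real_derivative_iff_has_vector_derivative[symmetric] intro:
            has_field_derivative_at_within)
    then have "integral {a..T} d = \<theta> T - \<theta> a" by (rule integral_unique)
    moreover from set_borel_integral_eq_integral(2)[OF sd]
    have "(LINT t|lborel. indicator {a<..<T} t *\<^sub>R d t) = integral {a..T} d"
      by (simp add: set_lebesgue_integral_def integral_open_interval_real)
    ultimately show ?thesis by simp
  qed
  define g where "g t s = (indicator {0<..<T} t * indicator {..t} s * d t) *\<^sub>R v s" for t s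
  have gm: "case_prod g \<in> borel_measurable (lborel \<Otimes>\<^sub>M lborel)"
  proof -
    have "case_prod g = (\<lambda>p. (indicator {0<..<T} (fst p) * (if snd p \<le> fst p then 1 else 0) * d
        (fst p)) *\<^sub>R v (snd p))"
      by (auto simp: g_def fun_eq_iff indicator_def)
    also have "\<dots> \<in> borel_measurable (lborel \<Otimes>\<^sub>M lborel)" by measurable
    finally show ?thesis .
  qed
  have gle: "norm (g t s) \<le> (D * indicator {0<..<T} t) * norm (v s)" for t s
    using D[of t] by (auto simp: g_def indicator_def intro!: mult_right_mono)
  have gint: "integrable (lborel \<Otimes>\<^sub>M lborel) (case_prod g)"
  proof (rule Bochner_Integration.integrable_bound[OF _ gm])
    show "integrable (lborel \<Otimes>\<^sub>M lborel) (\<lambda>(t, s). (D * indicator {0<..<T} t) * norm (v s))"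
    proof (rule lborel_pair.Fubini_integrable)
      show "(\<lambda>(t, s). (D * indicator {0<..<T} t) * norm (v s)) \<in> borel_measurable (lborel \<Otimes>\<^sub>M lborel)"
          by measurable
      have "(\<lambda>t. LINT s|lborel. norm (case (t, s) of (t, s) \<Rightarrow> (D * indicator {0<..<T} t) * norm (v s)))
        = (\<lambda>t. (\<bar>D\<bar> * (LINT s|lborel. norm (v s))) * indicator {0<..<T} t)"
        by (auto simp: fun_eq_iff abs_mult)
      then show "integrable lborel (\<lambda>t. LINT s|lborel. norm
          (case (t, s) of (t, s) \<Rightarrow> (D * indicator {0<..<T} t) * norm (v s)))"
        using T by simp
      show "AE t in lborel. integrable lborel
          (\<lambda>s. case (t, s) of (t, s) \<Rightarrow> (D * indicator {0<..<T} t) * norm (v s))"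
        using v(1) by simp
    qed
    show "AE p in lborel \<Otimes>\<^sub>M lborel. norm (case_prod g p)
        \<le> norm (case p of (t, s) \<Rightarrow> (D * indicator {0<..<T} t) * norm (v s))"
    proof (intro AE_I2)
      fix p :: "real \<times> real"
      show "norm (case_prod g p) \<le> norm (case p of (t, s) \<Rightarrow> (D * indicator {0<..<T} t) * norm (v s))"
        using order_trans[OF gle[of "fst p" "snd p"] abs_ge_self] by (simp add: case_prod_beta)
    qed
  qed
  have inner1: "(LINT s|lborel. g t s) = indicator {0<..<T} t *\<^sub>R (d t *\<^sub>R primitive v t)" for t
  proof -
    have "(LINT s|lborel. g t s) = (LINT s|lborel. (indicator {0<..<T} t * d t) *\<^sub>R
        (indicator {..t} s *\<^sub>R v s))"
      by (simp add: g_def ac_simps)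
    also have "\<dots> = (indicator {0<..<T} t * d t) *\<^sub>R primitive v t"
      unfolding primitive_def set_lebesgue_integral_def by (rule integral_scaleR_right)
    finally show ?thesis by simp
  qed
  have inner2: "(LINT t|lborel. g t s) = - (indicator {0<..<T} s *\<^sub>R (\<theta> s *\<^sub>R v s))" for s
  proof (cases "s \<in> {0<..T}")
    case True
    have "AE t in lborel. g t s = (indicator {s<..<T} t *\<^sub>R d t) *\<^sub>R v s"
      using AE_lborel_singleton[of s] by eventually_elim (use True in \<open>auto simp: g_def indicator_def\<close>)
    then have "(LINT t|lborel. g t s) = (LINT t|lborel. (indicator {s<..<T} t *\<^sub>R d t) *\<^sub>R v s)"
      by (rule integral_cong_AE[rotated 2]) (auto simp: g_def indicator_def)
    also have "\<dots> = (LINT t|lborel. indicator {s<..<T} t *\<^sub>R d t) *\<^sub>R v s"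
      using sd by (intro integral_scaleR_left) (simp add: set_integrable_def)
    also have "\<dots> = - (\<theta> s *\<^sub>R v s)" using intd[of s] True \<theta>(4)[of T] by simp
    finally show ?thesis using \<theta>(4)[of s] by (auto simp: indicator_def)
  qed (use v(2) in \<open>auto simp: g_def\<close>)
  have i1: "integrable lborel (\<lambda>t. indicator {0<..<T} t *\<^sub>R (d t *\<^sub>R u0))"
    using integrable_scaleR_left[OF sd[of 0, unfolded set_integrable_def], of u0] by simp
  have u0: "(LINT t|lborel. indicator {0<..<T} t *\<^sub>R (d t *\<^sub>R u0)) = 0"
  proof -
    have "(LINT t|lborel. indicator {0<..<T} t *\<^sub>R (d t *\<^sub>R u0))
        = (LINT t|lborel. (indicator {0<..<T} t *\<^sub>R d t) *\<^sub>R u0)"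
      by simp
    also have "\<dots> = (LINT t|lborel. indicator {0<..<T} t *\<^sub>R d t) *\<^sub>R u0"
      using sd by (intro integral_scaleR_left) (simp add: set_integrable_def)
    finally show ?thesis using intd[of 0] \<theta>(4)[of T] \<theta>(4)[of 0] T by simp
  qed
  have i2: "integrable lborel (\<lambda>t. indicator {0<..<T} t *\<^sub>R (d t *\<^sub>R primitive v t))"
  proof -
    have "set_integrable lborel {0<..<T} (\<lambda>t. d t *\<^sub>R primitive v t)"
      by (rule set_integrable_subset[OF borel_integrable_atLeastAtMost'[of 0 T]])
        (auto intro!: continuous_on_scaleR continuous_on_subset[OF cd] continuous_on_subset[OF cu])
    then show ?thesis by (simp add: set_integrable_def)
  qed
  have "(LINT t|lebesgue_on {0<..<T}. deriv \<theta> t *\<^sub>R (u0 + primitive v t))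
      = (LINT t|lborel. indicator {0<..<T} t *\<^sub>R (d t *\<^sub>R u0)
          + indicator {0<..<T} t *\<^sub>R (d t *\<^sub>R primitive v t))"
    unfolding d_def[symmetric]
    by (subst integral_lebesgue_on) (simp_all add: scaleR_add_right)
  also have "\<dots> = (LINT t|lborel. LINT s|lborel. g t s)"
    unfolding inner1 using i1 i2 u0 by simp
  also have "\<dots> = (LINT s|lborel. LINT t|lborel. g t s)"
    by (rule lborel_pair.Fubini_integral[OF gint, symmetric])
  also have "\<dots> = - (LINT t|lborel. indicator {0<..<T} t *\<^sub>R (\<theta> t *\<^sub>R v t))"
    unfolding inner2 by simp
  also have "(LINT t|lborel. indicator {0<..<T} t *\<^sub>R (\<theta> t *\<^sub>R v t))
      = (LINT t|lebesgue_on {0<..<T}. \<theta> t *\<^sub>R v t)"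
    by (rule integral_lebesgue_on[symmetric]) auto
  finally show "(LINT t|lebesgue_on {0<..<T}. deriv \<theta> t *\<^sub>R (u0 + primitive v t))
      = - (LINT t|lebesgue_on {0<..<T}. \<theta> t *\<^sub>R v t)" .
qed


section \<open>The hypergraph system\<close>

theorem theorem4p1:
  fixes E :: "'n::finite set set"
    and w :: "'n set \<Rightarrow> real"
    and \<pi> :: "real ^ 'n \<Rightarrow> real ^ 'n"
    and k :: "real ^ 'n \<Rightarrow> real"
    and u\<^sub>0 :: "real ^ 'n"
    and f :: "real \<Rightarrow> real ^ 'n"
    and p a q T \<tau> :: real
  assumes "weighted_hypergraph E w"
    and "hypergraph_connected E"
    and "p \<ge> 1" and "a > 0" and "q > 2" and "T > 0"
    and "\<exists>L. L-lipschitz_on UNIV \<pi>"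
    and "\<forall>x. GDERIV k x :> \<pi> x"
    and "\<tau> > 0"
    and "in_L 2 {0<..<T} f"
  shows "\<exists>u \<mu>. hypergraph_system_solution E w p a q \<pi> \<tau> T u\<^sub>0 f u \<mu> \<and>
           in_W1 2 {0<..<T} u \<and> in_L 2 {0<..<T} \<mu>"
proof -
  note T = \<open>T > 0\<close> and \<tau> = \<open>\<tau> > 0\<close>
  obtain L where L: "L-lipschitz_on UNIV \<pi>" using assms(7) by blast
  have k: "GDERIV k x :> \<pi> x" for x using assms(8) by blast
  define \<phi> where "\<phi> = hypergraph_energy E w p"
  define g where "g x = (a / q) * norm x powr q + k x" for x
  define F where "F x = \<phi> x + g x" for x
  have \<phi>cv: "convex_on UNIV \<phi>" unfolding \<phi>_def by (rule hypergraph_energy_convex[OF assms(1,3)])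
  have \<phi>0: "0 \<le> \<phi> x" "\<phi> 0 = 0" for x
    unfolding \<phi>_def by (rule hypergraph_energy_nonneg[OF assms(1,3)])+
  have \<phi>ct: "continuous_on UNIV \<phi>" by (rule convex_on_continuous[OF open_UNIV \<phi>cv])
  define d where "d x = (a * norm x powr (q - 2)) *\<^sub>R x + \<pi> x" for x
  have g: "GDERIV g x :> d x" for x
    unfolding g_def d_def by (intro GDERIV_add GDERIV_norm_powr k assms(5))
  have gct: "continuous_on UNIV g"
    using g by (intro has_derivative_continuous_on)
        (auto simp: gderiv_def intro: has_derivative_at_withinI)
  have Fct: "continuous_on UNIV F" unfolding F_def by (intro continuous_on_add \<phi>ct gct)
  have "semiconvex (0 + (0 + L)) F" unfolding F_def g_def
    using assms(4,5) by (intro semiconvex_add convex_imp_semiconvex \<phi>cv norm_powr_convex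
        lipschitz_gradient_semiconvex[OF k L]) auto
  then have Fsc: "semiconvex L F" by simp
  obtain m where "\<forall>x. (norm x)\<^sup>2 + m \<le> \<phi> x + ((a / q) * norm x powr q + k x)"
    using total_energy_coercive[where \<phi> = \<phi>, OF k L \<phi>0(1) assms(4,5)] by blast
  then have m: "(norm x)\<^sup>2 + m \<le> F x" for x by (simp add: F_def g_def)
  have Fm: "m \<le> F x" for x using m[of x] zero_le_power2[of "norm x"] by linarith
  have Fbd: "bounded {x. F x \<le> r}" for r
  proof (rule boundedI)
    fix x assume "x \<in> {x. F x \<le> r}"
    then have "(norm x)\<^sup>2 \<le> r - m" using m[of x] by simp
    then show "norm x \<le> sqrt (r - m)" by (rule real_le_rsqrt)
  qed
  obtain f' where f': "sq_integrable f'" "AE t in lborel. t \<in> {0<..<T} \<longrightarrow> f t = f' t"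
    using in_L_2_representative[OF assms(10)] .
  define A where "A = moreau_grad \<phi> \<tau>"
  have A: "A x \<in> subdifferential \<phi> (prox \<phi> \<tau> x)" "cocoercive \<tau> A" for x
    unfolding A_def by (rule moreau_grad_cocoercive[OF \<phi>cv \<phi>0(1) \<tau>])+
  have A0: "A 0 = 0" unfolding A_def by (rule moreau_grad_0[OF \<phi>ct \<phi>0 \<tau>])
  obtain v \<eta> where v: "sq_integrable v" and \<eta>: "sq_integrable \<eta>" and v0: "\<And>t. t \<notin> {0<..T} \<Longrightarrow> v t = 0"
    and sub: "AE t in lborel. t \<in> {0<..<T} \<longrightarrow> \<eta> t \<in> semiconvex_subdifferential L F (u\<^sub>0 + primitive v t)"
    and eq: "AE t in lborel. t \<in> {0<..<T} \<longrightarrow> v t = - A (\<eta> t - f' t)"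
    by (rule doubly_nonlinear_existence[OF Fct Fm Fbd Fsc lipschitz_on_nonneg[OF L] A(2) A0 \<tau> f'(1) T,
        of u\<^sub>0]) blast
  have vint: "integrable lborel v" by (rule sq_integrable_imp_integrable[OF v v0])
  define S where "S = {0<..<T}"
  have S: "S \<in> sets borel" by (simp add: S_def)
  define u where "u t = u\<^sub>0 + primitive v t" for t
  \<comment> \<open>This equals \<open>prox \<phi> \<tau> (\<eta> t - f t)\<close> at almost every \<open>t\<close> in \<open>S\<close>.\<close>
  define \<mu> where "\<mu> t = (\<tau> *\<^sub>R v t + \<eta> t) + - f t" for t
  have v2: "in_L 2 S v" by (rule sq_integrable_in_L_2[OF v S])
  have \<mu>2: "in_L 2 S \<mu>" unfolding \<mu>_def
    by (rule in_L_2_add[OF sq_integrable_in_L_2[OF sq_integrable_add[OF sq_integrable_scale[OF v] \<eta>] S]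
        in_L_2_minus[OF assms(10)[folded S_def]]])
  have uct: "continuous_on UNIV u" unfolding u_def
      by (intro continuous_on_add continuous_on_const continuous_primitive vint)
  have u2: "in_L 2 S u"
    unfolding in_L_2_iff
  proof (intro conjI borel_imp_lebesgue_on integrable_lebesgue_on S)
    show "u \<in> borel_measurable borel" using uct by (rule borel_measurable_continuous_onI)
    have "continuous_on UNIV (\<lambda>t. (norm (u t))\<^sup>2)" by (intro continuous_intros uct)
    from integrable_lborel_continuous_interval(1)[OF this, of 0 T]
    show "set_integrable lborel S (\<lambda>t. (norm (u t))\<^sup>2)" by (simp add: S_def set_integrable_def)
  qed
  have wd: "has_weak_deriv u v S"
    unfolding u_def S_def by (rule primitive_has_weak_deriv[OF vint v0 T])
  have ac: "abs_continuous_on {0..T} u" unfolding u_def by (rule primitive_abs_continuous[OF v vint])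
  have u0: "u 0 = u\<^sub>0" using primitive_outside(1)[of T v 0] v0 by (simp add: u_def)
  have incl: "AE t in lborel. t \<in> S \<longrightarrow> - v t \<in> subdifferential \<phi> (\<mu> t)
      \<and> \<eta> t - d (u t) \<in> subdifferential \<phi> (u t)"
    using sub eq f'(2)
  proof eventually_elim
    case (elim t)
    show ?case
    proof (intro impI conjI)
      assume t: "t \<in> S"
      have vt: "v t = - A (\<eta> t - f' t)" and ft: "f t = f' t" using elim t by (auto simp: S_def)
      have "\<mu> t = prox \<phi> \<tau> (\<eta> t - f' t)"
        using prox_eq[OF \<tau>, of "\<eta> t - f' t" \<phi>] by (simp add: \<mu>_def vt ft A_def algebra_simps)
      then show "- v t \<in> subdifferential \<phi> (\<mu> t)" using A(1)[of "\<eta> t - f' t"] by (simp add: vt)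
      have "\<eta> t \<in> semiconvex_subdifferential L (\<lambda>x. \<phi> x + g x) (u t)"
        using elim t by (simp add: S_def u_def F_def[abs_def])
      then show "\<eta> t - d (u t) \<in> subdifferential \<phi> (u t)"
          by (rule subdifferential_minus_gradient[OF \<phi>cv g])
    qed
  qed
  have "hypergraph_system_solution E w p a q \<pi> \<tau> T u\<^sub>0 f u \<mu>"
    unfolding hypergraph_system_solution_def hypergraph_Laplacian_def \<phi>_def[symmetric] S_def[symmetric]
  proof (intro conjI exI)
    show "abs_continuous_on {0..T} u" by (rule ac)
    show "in_L 1 S u" "in_L 1 S \<mu>" "in_L 1 S v"
      using in_L_2_imp_in_L_1 u2 \<mu>2 v2 unfolding S_def by blast+
    show "u 0 = u\<^sub>0" by (rule u0)
    show "has_weak_deriv u v S" by (rule wd)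
    show "AE t in lebesgue_on S. 0 \<in> (\<lambda>\<xi>. v t + \<xi>) ` subdifferential \<phi> (\<mu> t)"
    proof (rule AE_lebesgue_on[OF _ S])
      show "AE t in lborel. t \<in> S \<longrightarrow> 0 \<in> (\<lambda>\<xi>. v t + \<xi>) ` subdifferential \<phi> (\<mu> t)"
        using incl
      proof eventually_elim
        case (elim t)
        have "0 = v t + - v t" by simp
        with elim show ?case by blast
      qed
    qed
    show "AE t in lebesgue_on S. \<mu> t \<in>
        (\<lambda>\<xi>. \<tau> *\<^sub>R v t + \<xi> + (a * norm (u t) powr (q - 2)) *\<^sub>R u t + \<pi> (u t) - f t) ` subdifferential \<phi>
        (u t)"
    proof (rule AE_lebesgue_on[OF _ S])
      show "AE t in lborel. t \<in> S \<longrightarrow> \<mu> t \<in>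
          (\<lambda>\<xi>. \<tau> *\<^sub>R v t + \<xi> + (a * norm (u t) powr (q - 2)) *\<^sub>R u t + \<pi> (u t) - f t) ` subdifferential
          \<phi> (u t)"
        using incl
      proof eventually_elim
        case (elim t)
        show ?case
        proof
          assume "t \<in> S"
          show "\<mu> t \<in> (\<lambda>\<xi>. \<tau> *\<^sub>R v t + \<xi> + (a * norm (u t) powr (q - 2)) *\<^sub>R u t + \<pi> (u t) - f t) `
              subdifferential \<phi> (u t)"
          proof (rule image_eqI)
            show "\<eta> t - d (u t) \<in> subdifferential \<phi> (u t)" using elim \<open>t \<in> S\<close> by blast
            show "\<mu> t = \<tau> *\<^sub>R v t + (\<eta> t - d (u t)) + (a * norm (u t) powr (q - 2)) *\<^sub>R u t + \<pi> (u t)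
                - f t"
              by (simp add: \<mu>_def d_def)
          qed
        qed
      qed
    qed
  qed
  moreover have "in_W1 2 {0<..<T} u"
    unfolding in_W1_def S_def[symmetric] using u2 v2 wd by blast
  moreover have "in_L 2 {0<..<T} \<mu>" using \<mu>2 by (simp only: S_def)
  ultimately show ?thesis by blast
qed

end
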